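(* Let $\mathcal T$ be a triangulation with vertex set $V$, edge set $E$ and triangle set $T$, and let $\theta:E\to[0,\pi)$ and $\Xi:V\to(0,\infty)$ be given. There exists a euclidean hyperideal circle pattern with triangulation $\mathcal T$, intersection angles $\theta$ and cone/boundary angles $\Xi$ if and only if the set of coherent angle systems $\mathcal A(\mathcal T,\theta,\Xi)$ is not empty. In this case, the circle pattern is unique up to scale, i.e. the pair $(l,r)$ of edge lengths and vertex-circle radii is unique up to multiplication of all lengths and radii by a positive constant (one constant for each connected component of the surface).
   Context: A triangulation $\mathcal T$ is a finite two-dimensional CW complex whose total space is a surface (2-manifold, possibly with boundary), such that the closed disk of each 2-cell has exactly three points on its boundary mapped to vertices. It is assumed regular (closed cells are embedded), so each triangle has three distinct vertices and three distinct edges, and each edge lies in exactly one triangle (boundary edge) or exactly two triangles (interior edge). $V,E,T$ are the sets of vertices, edges, triangles. For $t\in T$ and distinct vertices $i,j$ of $t$, "$ij$" denotes the edge of $t$ joining $i$ and $j$. Decorated triangles. Take a euclidean triangle with vertices $v_1,v_2,v_3\in\mathbb R^2$, side lengths $l_{ij}=|v_i-v_j|$, and radii $r_1,r_2,r_3>0$ with $r_i+r_j<l_{ij}$ for $i\ne j$. There is a unique circle (the face-circle), with center $c$ and radius $R>0$, orthogonal to the three vertex-circles (the circles with centers $v_i$ and radii $r_i$), i.e. $|c-v_i|^2=R^2+r_i^2$ for $i=1,2,3$. The angles of the decorated triangle are: $\gamma_i$, the interior angle of the triangle at $v_i$; and $\alpha_{ij}=\alpha_{ji}\in(0,\pi)$,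 the angle between side $v_iv_j$ and the face-circle, defined by $\cos\alpha_{ij}=d_{ij}/R$, where $d_{ij}$ is the signed distance of $c$ from the line $v_iv_j$, positive if $c$ lies on the same side as the triangle. Circle patterns. A euclidean hyperideal circle pattern with triangulation $\mathcal T$ is a pair of functions $l:E\to\mathbb R_{>0}$, $r:V\to\mathbb R_{>0}$ such that: (0) for each triangle the lengths of its sides satisfy the strict triangle inequalities (so $l$ defines a piecewise flat metric on the surface); (i) $r_i+r_j<l_{ij}$ for each edge $ij$; (ii) for each interior edge $ij$ with adjacent triangles $t=ijk$ and $t'=jil$, if the two triangles are laid out abutting along $ij$ in the euclidean plane with vertex-circles of the given radii, then the face-circle of one triangle intersects the fourth vertex-circle not at all or at an angle at most $\pi/2$; precisely, if $c,R$ are center and radius of the face-circle of $t$ and $v_l$ is the position of vertex $l$, then $|c-v_l|^2\ge R^2+r_l^2$. Each triangle $t$ then becomes a decorated triangle with angles $\alpha^t_{ij},\gamma^t_i$. The cone/boundary angle at $i\in V$ is the sum $\Xi_i$ of all triangle angles $\gamma^t_i$ over $t\ni i$. The intersection angle at an interior edge $ij$ between triangles $t,t'$ is the (exterior) intersection angle of the two face-circles, $\theta_{ij}=\pi-\alpha^t_{ij}-\alpha^{t'}_{ij}\in[0,\pi)$ (it is $0$ iff the face-circles coincide). At a boundary edge $ij$ of triangle $t$ it is $\theta_{ij}=\pi-\alpha^t_{ij}\in(0,\pi)$. Coherent angle systems. Let $\Delta\subset\mathbb R^6$ be the set of $(\alpha_{12},\alpha_{23},\alpha_{31},\gamma_1,\gamma_2,\gamma_3)$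 with all $\alpha_{ij}>0$, all $\gamma_i>0$, $\gamma_1+\gamma_2+\gamma_3=\pi$, and $\gamma_1+\alpha_{12}+\alpha_{31}<\pi$, $\gamma_2+\alpha_{23}+\alpha_{12}<\pi$, $\gamma_3+\alpha_{31}+\alpha_{23}<\pi$. Label the coordinates of $\mathbb R^{6|T|}$ by $\alpha^t_{ij}=\alpha^t_{ji}$ and $\gamma^t_i$ ($t\in T$, $i\neq j$ vertices of $t$). $\mathcal A(\mathcal T,\theta,\Xi)$ is the set of $(\alpha,\gamma)\in\mathbb R^{6|T|}$ such that: for each $t=ijk\in T$, $(\alpha^t_{ij},\alpha^t_{jk},\alpha^t_{ki},\gamma^t_i,\gamma^t_j,\gamma^t_k)\in\Delta$; for each interior edge $ij$ with adjacent triangles $t,t'$, $\alpha^t_{ij}+\alpha^{t'}_{ij}=\pi-\theta_{ij}$; for each boundary edge $ij$ with adjacent triangle $t$, $\theta_{ij}>0$ and $\alpha^t_{ij}=\pi-\theta_{ij}$; for each $i\in V$, $\sum_{t\ni i}\gamma^t_i=\Xi_i$. Its elements are called coherent angle systems. *)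

theory Defs
  imports "HOL-Analysis.Analysis"
begin

section \<open>Triangulated surfaces\<close>

text \<open>
  A finite regular CW complex is determined up to cellular homeomorphism by the incidence
  relation of its cells, so a triangulation is given by finite sets of vertices, edges and
  triangles, the endpoints of every edge and the three sides of every triangle.
  Cells are not identified with their vertex sets: several edges may have the same endpoints,
  and two triangles may share two or three sides.
\<close>

record ('v, 'e, 't) cells =
  vertices :: "'v set"
  edges :: "'e set"
  triangles :: "'t set"
  ends :: "'e \<Rightarrow> 'v set"
  sides :: "'t \<Rightarrow> 'e set"

definition corners :: "('v, 'e, 't) cells \<Rightarrow> 't \<Rightarrow> 'v set" where
  "corners X t = (\<Union>e\<in>sides X t. ends X e)"

definition adj_triangles :: "('v, 'e, 't) cells \<Rightarrow> 'e \<Rightarrow> 't set" where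
  "adj_triangles X e = {t \<in> triangles X. e \<in> sides X t}"

definition star :: "('v, 'e, 't) cells \<Rightarrow> 'v \<Rightarrow> 't set" where
  "star X i = {t \<in> triangles X. i \<in> corners X t}"

text \<open>Two triangles at \<open>i\<close> are neighbours if they have a side through \<open>i\<close> in common.\<close>

definition neighbours_at :: "('v, 'e, 't) cells \<Rightarrow> 'v \<Rightarrow> ('t \<times> 't) set" where
  "neighbours_at X i =
     {(s, t). s \<in> star X i \<and> t \<in> star X i \<and> (\<exists>e \<in> sides X s \<inter> sides X t. i \<in> ends X e)}"

text \<open>
  Regularity gives two distinct endpoints per edge, and three distinct sides and corners per
  triangle; injectivity of \<open>ends X\<close> then says that any two corners of a triangle are joined by
  exactly one of its sides.  The total space is a surface with boundary if and only if every
  edge lies in one or two triangles and the link of every vertex is a circle or an arc.  Given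
  the condition on edges, all components of a vertex link are circles or arcs, so it
  remains to require that the link is nonempty and connected.
\<close>

definition surface_triangulation :: "('v, 'e, 't) cells \<Rightarrow> bool" where
  "surface_triangulation X \<longleftrightarrow>
     finite (vertices X) \<and> finite (edges X) \<and> finite (triangles X) \<and>
     (\<forall>e\<in>edges X. ends X e \<subseteq> vertices X \<and> card (ends X e) = 2) \<and>
     (\<forall>t\<in>triangles X. sides X t \<subseteq> edges X \<and> card (sides X t) = 3 \<and>
        card (corners X t) = 3 \<and> inj_on (ends X) (sides X t)) \<and>
     (\<forall>e\<in>edges X. card (adj_triangles X e) = 1 \<or> card (adj_triangles X e) = 2) \<and>
     (\<forall>i\<in>vertices X. star X i \<noteq> {} \<and>
        (\<forall>s\<in>star X i. \<forall>t\<in>star X i. (s, t) \<in> (neighbours_at X i)\<^sup>*))"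

text \<open>The vertex sets of the connected components of the surface.\<close>

definition adjacent_vertices :: "('v, 'e, 't) cells \<Rightarrow> ('v \<times> 'v) set" where
  "adjacent_vertices X = {(i, j). \<exists>e\<in>edges X. ends X e = {i, j}}"

definition component_of :: "('v, 'e, 't) cells \<Rightarrow> 'v \<Rightarrow> 'v set" where
  "component_of X i = {j. (i, j) \<in> (adjacent_vertices X)\<^sup>*}"

definition surface_components :: "('v, 'e, 't) cells \<Rightarrow> 'v set set" where
  "surface_components X = component_of X ` vertices X"

text \<open>
  \<open>labels X t i j k a b c\<close>: the triangle \<open>t\<close> has corners \<open>i, j, k\<close> and sides
  \<open>a = ij\<close>, \<open>b = jk\<close>, \<open>c = ki\<close>.
\<close>

definition labels ::
    "('v, 'e, 't) cells \<Rightarrow> 't \<Rightarrow> 'v \<Rightarrow> 'v \<Rightarrow> 'v \<Rightarrow> 'e \<Rightarrow> 'e \<Rightarrow> 'e \<Rightarrow> bool" where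
  "labels X t i j k a b c \<longleftrightarrow>
     corners X t = {i, j, k} \<and> sides X t = {a, b, c} \<and>
     ends X a = {i, j} \<and> ends X b = {j, k} \<and> ends X c = {k, i}"

definition opposite_corner :: "('v, 'e, 't) cells \<Rightarrow> 't \<Rightarrow> 'e \<Rightarrow> 'v" where
  "opposite_corner X t e = the_elem (corners X t - ends X e)"

section \<open>Decorated triangles in the plane\<close>

text \<open>The unsigned angle between two nonzero vectors.\<close>

definition vec_angle :: "real^2 \<Rightarrow> real^2 \<Rightarrow> real" where
  "vec_angle u v = arccos (u \<bullet> v / (norm u * norm v))"

text \<open>Signed distance of \<open>c\<close> from the line \<open>L\<close>, positive on the side of \<open>q\<close>, \<open>q \<notin> L\<close>.
  The vector \<open>q - closest_point L q\<close> is normal to \<open>L\<close>.\<close>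

definition signed_dist :: "(real^2) set \<Rightarrow> real^2 \<Rightarrow> real^2 \<Rightarrow> real" where
  "signed_dist L q c = (c - closest_point L q) \<bullet> sgn (q - closest_point L q)"

text \<open>
  The circle with center \<open>c\<close> and radius \<open>R\<close> is orthogonal to the circles with centers \<open>p i\<close>
  and radii \<open>r i\<close>, \<open>i \<in> A\<close>.
\<close>

definition is_face_circle ::
    "'v set \<Rightarrow> ('v \<Rightarrow> real^2) \<Rightarrow> ('v \<Rightarrow> real) \<Rightarrow> real^2 \<Rightarrow> real \<Rightarrow> bool" where
  "is_face_circle A p r c R \<longleftrightarrow> R > 0 \<and> (\<forall>i\<in>A. (dist c (p i))\<^sup>2 = R\<^sup>2 + (r i)\<^sup>2)"

definition face_circle ::
    "'v set \<Rightarrow> ('v \<Rightarrow> real^2) \<Rightarrow> ('v \<Rightarrow> real) \<Rightarrow> (real^2) \<times> real" where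
  "face_circle A p r = (THE (c, R). is_face_circle A p r c R)"

text \<open>\<open>p\<close> places the corners of \<open>t\<close> in the plane at the distances prescribed by \<open>l\<close>.\<close>

definition is_layout ::
    "('v, 'e, 't) cells \<Rightarrow> ('e \<Rightarrow> real) \<Rightarrow> 't \<Rightarrow> ('v \<Rightarrow> real^2) \<Rightarrow> bool" where
  "is_layout X l t p \<longleftrightarrow>
     (\<forall>e\<in>sides X t. \<forall>i j. ends X e = {i, j} \<longrightarrow> dist (p i) (p j) = l e)"

text \<open>
  Layouts are unique up to a euclidean isometry, so the angles below do not depend on the
  choice.
\<close>

definition layout ::
    "('v, 'e, 't) cells \<Rightarrow> ('e \<Rightarrow> real) \<Rightarrow> 't \<Rightarrow> ('v \<Rightarrow> real^2)" where
  "layout X l t = (SOME p. is_layout X l t p)"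

text \<open>The interior angle \<open>\<gamma>\<^sup>t\<^sub>i\<close>.\<close>

definition corner_angle ::
    "('v, 'e, 't) cells \<Rightarrow> ('e \<Rightarrow> real) \<Rightarrow> 't \<Rightarrow> 'v \<Rightarrow> real" where
  "corner_angle X l t i =
     (let p = layout X l t in
      THE x. \<exists>j k. corners X t = {i, j, k} \<and> x = vec_angle (p j - p i) (p k - p i))"

text \<open>
  The angle \<open>\<alpha>\<^sup>t\<^sub>i\<^sub>j\<close> between the side \<open>e = ij\<close> and the face-circle.  It is the angle in
  \<open>(0, \<pi>)\<close> with cosine \<open>d\<^sub>i\<^sub>j / R\<close>, which exists because the condition
  \<open>r\<^sub>i + r\<^sub>j < l\<^sub>i\<^sub>j\<close> implies that the face-circle crosses the line \<open>ij\<close> at two points.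
\<close>

definition side_angle ::
    "('v, 'e, 't) cells \<Rightarrow> ('e \<Rightarrow> real) \<Rightarrow> ('v \<Rightarrow> real) \<Rightarrow> 't \<Rightarrow> 'e \<Rightarrow> real" where
  "side_angle X l r t e =
     (let p = layout X l t;
          (c, R) = face_circle (corners X t) p r;
          d = signed_dist (affine hull (p ` ends X e)) (p (opposite_corner X t e)) c
      in arccos (d / R))"

section \<open>Euclidean hyperideal circle patterns\<close>

text \<open>
  \<open>p\<close> and \<open>q\<close> lay out \<open>t\<close> and \<open>t'\<close> on opposite sides of their common side \<open>e\<close>.  Two
  placements are used because the corners opposite to \<open>e\<close> may be the same vertex.
\<close>

definition abutting_layouts ::
    "('v, 'e, 't) cells \<Rightarrow> ('e \<Rightarrow> real) \<Rightarrow> 'e \<Rightarrow> 't \<Rightarrow> 't \<Rightarrow>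
     ('v \<Rightarrow> real^2) \<Rightarrow> ('v \<Rightarrow> real^2) \<Rightarrow> bool" where
  "abutting_layouts X l e t t' p q \<longleftrightarrow>
     is_layout X l t p \<and> is_layout X l t' q \<and> (\<forall>i\<in>ends X e. p i = q i) \<and>
     signed_dist (affine hull (p ` ends X e))
       (p (opposite_corner X t e)) (q (opposite_corner X t' e)) < 0"

definition locally_delaunay ::
    "('v, 'e, 't) cells \<Rightarrow> ('e \<Rightarrow> real) \<Rightarrow> ('v \<Rightarrow> real) \<Rightarrow> 'e \<Rightarrow> bool" where
  "locally_delaunay X l r e \<longleftrightarrow>
     (\<forall>t t' p q. adj_triangles X e = {t, t'} \<and> t \<noteq> t' \<and> abutting_layouts X l e t t' p q \<longrightarrow>
        (let (c, R) = face_circle (corners X t) p r; m = opposite_corner X t' e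
         in (dist c (q m))\<^sup>2 \<ge> R\<^sup>2 + (r m)\<^sup>2))"

definition hyperideal_circle_pattern ::
    "('v, 'e, 't) cells \<Rightarrow> ('e \<Rightarrow> real) \<Rightarrow> ('v \<Rightarrow> real) \<Rightarrow> bool" where
  "hyperideal_circle_pattern X l r \<longleftrightarrow>
     (\<forall>e\<in>edges X. l e > 0) \<and> (\<forall>i\<in>vertices X. r i > 0) \<and>
     (\<forall>t\<in>triangles X. \<forall>i j k a b c. labels X t i j k a b c \<longrightarrow>
        l a < l b + l c \<and> l b < l c + l a \<and> l c < l a + l b) \<and>
     (\<forall>e\<in>edges X. \<forall>i j. ends X e = {i, j} \<longrightarrow> r i + r j < l e) \<and>
     (\<forall>e\<in>edges X. locally_delaunay X l r e)"

text \<open>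
  This is \<open>\<pi> - \<alpha>\<^sup>t\<^sub>i\<^sub>j - \<alpha>\<^sup>t\<^sup>'\<^sub>i\<^sub>j\<close> at an interior edge and \<open>\<pi> - \<alpha>\<^sup>t\<^sub>i\<^sub>j\<close> at a boundary edge.
\<close>

definition intersection_angle ::
    "('v, 'e, 't) cells \<Rightarrow> ('e \<Rightarrow> real) \<Rightarrow> ('v \<Rightarrow> real) \<Rightarrow> 'e \<Rightarrow> real" where
  "intersection_angle X l r e = pi - (\<Sum>t\<in>adj_triangles X e. side_angle X l r t e)"

definition cone_angle :: "('v, 'e, 't) cells \<Rightarrow> ('e \<Rightarrow> real) \<Rightarrow> 'v \<Rightarrow> real" where
  "cone_angle X l i = (\<Sum>t\<in>star X i. corner_angle X l t i)"

definition circle_pattern_with_angles ::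
    "('v, 'e, 't) cells \<Rightarrow> ('e \<Rightarrow> real) \<Rightarrow> ('v \<Rightarrow> real) \<Rightarrow>
     ('e \<Rightarrow> real) \<Rightarrow> ('v \<Rightarrow> real) \<Rightarrow> bool" where
  "circle_pattern_with_angles X \<theta> \<Xi> l r \<longleftrightarrow>
     hyperideal_circle_pattern X l r \<and>
     (\<forall>e\<in>edges X. intersection_angle X l r e = \<theta> e) \<and>
     (\<forall>i\<in>vertices X. cone_angle X l i = \<Xi> i)"

section \<open>Coherent angle systems\<close>

definition Delta :: "(real \<times> real \<times> real \<times> real \<times> real \<times> real) set" where
  "Delta = {(\<alpha>12, \<alpha>23, \<alpha>31, \<gamma>1, \<gamma>2, \<gamma>3).
     \<alpha>12 > 0 \<and> \<alpha>23 > 0 \<and> \<alpha>31 > 0 \<and> \<gamma>1 > 0 \<and> \<gamma>2 > 0 \<and> \<gamma>3 > 0 \<and>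
     \<gamma>1 + \<gamma>2 + \<gamma>3 = pi \<and>
     \<gamma>1 + \<alpha>12 + \<alpha>31 < pi \<and> \<gamma>2 + \<alpha>23 + \<alpha>12 < pi \<and> \<gamma>3 + \<alpha>31 + \<alpha>23 < pi}"

text \<open>
  The coordinates of \<open>\<real>\<^sup>6\<^sup>|\<^sup>T\<^sup>|\<close> are \<open>\<alpha> t e\<close> for the sides \<open>e\<close> and \<open>\<gamma> t i\<close> for the corners \<open>i\<close> of
  the triangles \<open>t\<close>; all other values of \<open>\<alpha>\<close> and \<open>\<gamma>\<close> are irrelevant.
\<close>

definition coherent_angle_systems ::
    "('v, 'e, 't) cells \<Rightarrow> ('e \<Rightarrow> real) \<Rightarrow> ('v \<Rightarrow> real) \<Rightarrow>
     (('t \<Rightarrow> 'e \<Rightarrow> real) \<times> ('t \<Rightarrow> 'v \<Rightarrow> real)) set" where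
  "coherent_angle_systems X \<theta> \<Xi> = {(\<alpha>, \<gamma>).
     (\<forall>t\<in>triangles X. \<forall>i j k a b c. labels X t i j k a b c \<longrightarrow>
        (\<alpha> t a, \<alpha> t b, \<alpha> t c, \<gamma> t i, \<gamma> t j, \<gamma> t k) \<in> Delta) \<and>
     (\<forall>e\<in>edges X. \<forall>t t'. adj_triangles X e = {t, t'} \<and> t \<noteq> t' \<longrightarrow>
        \<alpha> t e + \<alpha> t' e = pi - \<theta> e) \<and>
     (\<forall>e\<in>edges X. \<forall>t. adj_triangles X e = {t} \<longrightarrow> \<theta> e > 0 \<and> \<alpha> t e = pi - \<theta> e) \<and>
     (\<forall>i\<in>vertices X. (\<Sum>t\<in>star X i. \<gamma> t i) = \<Xi> i)}"

end

theory Submission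
  imports Defs "HOL-Analysis.Analysis"
begin

text \<open>
  Following Rivin, Leibon and Springborn, circle patterns are the critical points of a volume
  function on the polytope of coherent angle systems.  A decorated triangle is the shadow of a
  hyperbolic tetrahedron with one ideal and three hyperideal vertices.  Twice its volume is a sum
  over the three corners of values of the Lobachevsky function; the derivative with respect to
  \<open>\<gamma>\<^sub>i\<close> is \<open>ln (r\<^sub>i / R)\<close> and the one with respect to \<open>\<alpha>\<^sub>i\<^sub>j\<close> is \<open>-\<lambda>\<^sub>i\<^sub>j\<close>, where
  \<open>l\<^sub>i\<^sub>j\<^sup>2 = r\<^sub>i\<^sup>2 + r\<^sub>j\<^sup>2 + 2 r\<^sub>i r\<^sub>j cosh \<lambda>\<^sub>i\<^sub>j\<close>.  Hence an angle system in the open polytope is critical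
  if and only if the triangles can be scaled so that they fit together.

  Uniqueness: in the coordinates \<open>\<alpha>\<^sub>i\<^sub>j\<close>, \<open>ln (r\<^sub>i / R)\<close> the second variation of the volume is diagonal,
  and it is definite on the variations that preserve \<open>\<gamma>\<^sub>1 + \<gamma>\<^sub>2 + \<gamma>\<^sub>3\<close>, so the gradient is strictly monotone along segments of angle systems.  If two
  patterns have the same \<open>\<theta>\<close> and \<open>\<Xi>\<close>, then the difference of their gradients is orthogonal to the
  difference of their angle systems.

  Existence: the volume has a maximum on the closed polytope, and it remains to see that the
  maximum is not on the boundary.  In the direction of a strict system the slope at the boundary is
  \<open>+\<infinity>\<close>, unless all triangles are either nondegenerate up to \<open>\<alpha>\<^sub>i\<^sub>j = 0\<close> or collapsed with
  \<open>\<alpha>\<^sub>i\<^sub>j = \<gamma>\<^sub>k = \<pi>\<close>.  A collapsed triangle is excluded by first decreasing its angle \<open>\<pi>\<close>, which costs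
  nothing to first order, and adding a small multiple \<open>\<kappa>\<close> of the direction to the strict system,
  which gains of the order of \<open>\<kappa> ln (1 / \<kappa>)\<close>.  Finally an angle \<open>\<alpha>\<^sub>i\<^sub>j = 0\<close> can be increased at the
  expense of the angle on the other side of the edge, because \<open>\<lambda>\<^sub>i\<^sub>j = 0\<close> on the one side and
  \<open>\<lambda>\<^sub>i\<^sub>j > 0\<close> on the other.
\<close>

section \<open>The Lobachevsky function\<close>

text \<open>The derivative of \<open>lob\<close> is infinite at 0 and \<open>pi\<close>, so the
  volume has no gradient on the boundary of the polytope. Its variation there has the form -C s ln s
  + D s + o(s); at a maximum C <= 0, and D <= 0 if C = 0. Towards a strict system every triangle
  without a side angle \<open>pi\<close> contributes C >= 0, with equality only if all its corners
  are hyperideal. A collapsed triangle contributes minus the change of its angle sum, which is 0 in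
  every admissible direction: at this order it is invisible. That is why D, as a function of the
  direction, has to be expanded once more. At a maximum inside, changes of the side angles alone
  make \<open>\<lambda>\<^sub>i\<^sub>j\<close> agree on both sides of an edge, and changes of the
  corner angles alone make ln (r / R) split into a triangle term and a vertex term. These terms are
  the Lagrange multipliers of the angle sums in the triangles and at the vertices; they are -ln R
  and ln r. The angles of a triangle do not know its scale, and the multipliers restore it.\<close>

text \<open>The Lobachevsky function \<open>x \<mapsto> - \<integral>\<^sub>0\<^sup>x ln (2 sin t) dt\<close> up to a constant.  The logarithmic singularities
  of the integrand at \<open>0\<close> and \<open>\<pi>\<close> are integrated explicitly, so that the remaining integrand is
  continuous on \<open>[0, \<pi>]\<close>.\<close>

definition entr :: "real \<Rightarrow> real" where
  "entr x = x - x * ln x"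

definition sin_ratio :: "real \<Rightarrow> real" where
  "sin_ratio x = (if x = 0 \<or> x = pi then 1 / pi else sin x / (x * (pi - x)))"

definition lob :: "real \<Rightarrow> real" where
  "lob x = entr x - entr (pi - x) - integral {0..x} (\<lambda>t. ln (2 * sin_ratio t))"

lemma sin_ratio_pos:
  assumes "0 \<le> x" "x \<le> pi" shows "0 < sin_ratio x"
  using assms sin_gt_zero[of x] by (cases "x = 0 \<or> x = pi") (auto simp: sin_ratio_def)

lemma tendsto_sin_over_x: "((\<lambda>x::real. sin x / x) \<longlongrightarrow> 1) (at 0)"
  using DERIV_sin[of "0::real"] by (simp add: DERIV_def)

lemma continuous_on_sin_ratio: "continuous_on {0..pi} sin_ratio"
proof (rule continuous_at_imp_continuous_on, intro ballI)
  fix x assume "x \<in> {0..pi}"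
  have lim0: "((\<lambda>y. sin y / (y * (pi - y))) \<longlongrightarrow> 1 / pi) (at 0)"
  proof -
    have "((\<lambda>y. (sin y / y) * (1 / (pi - y))) \<longlongrightarrow> 1 * (1 / (pi - 0))) (at 0)"
      by (intro tendsto_intros tendsto_sin_over_x) auto
    then show ?thesis by simp
  qed
  consider "x = 0" | "x = pi" | "x \<noteq> 0" "x \<noteq> pi" by blast
  then show "isCont sin_ratio x"
  proof cases
    case 1
    have "eventually (\<lambda>y. y \<in> - {pi}) (nhds (0::real))"
      by (rule eventually_nhds_in_open) auto
    then have "eventually (\<lambda>y. sin y / (y * (pi - y)) = sin_ratio y) (at 0)"
      unfolding eventually_at_filter by eventually_elim (auto simp: sin_ratio_def)
    from tendsto_cong[THEN iffD1, OF this lim0] show ?thesis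
      unfolding isCont_def 1 by (simp add: sin_ratio_def[of 0])
  next
    case 2
    have "filterlim (\<lambda>y. pi - y) (at 0) (at pi)"
      by (auto simp: filterlim_at eventually_at_filter intro!: tendsto_eq_intros)
    from filterlim_compose[OF lim0 this]
    have lim: "((\<lambda>y. sin y / (y * (pi - y))) \<longlongrightarrow> 1 / pi) (at pi)"
      by (simp add: mult.commute)
    have "eventually (\<lambda>y. y \<in> - {0}) (nhds pi)"
      by (rule eventually_nhds_in_open) auto
    then have "eventually (\<lambda>y. sin y / (y * (pi - y)) = sin_ratio y) (at pi)"
      unfolding eventually_at_filter by eventually_elim (auto simp: sin_ratio_def)
    from tendsto_cong[THEN iffD1, OF this lim] show ?thesis
      unfolding isCont_def 2 by (simp add: sin_ratio_def[of pi])
  next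
    case 3
    have "eventually (\<lambda>y. y \<in> - {0, pi}) (nhds x)"
      using 3 by (intro eventually_nhds_in_open) auto
    then have ev: "eventually (\<lambda>y. sin_ratio y = sin y / (y * (pi - y))) (nhds x)"
      by eventually_elim (auto simp: sin_ratio_def)
    have "isCont (\<lambda>y. sin y / (y * (pi - y))) x"
      using 3 by (intro continuous_intros) auto
    then show ?thesis using isCont_cong[OF ev] by simp
  qed
qed

lemma ln_sin_ratio_integral_deriv:
  assumes "x \<in> {0..pi}"
  shows "((\<lambda>x. integral {0..x} (\<lambda>t. ln (2 * sin_ratio t))) has_real_derivative
           ln (2 * sin_ratio x)) (at x within {0..pi})"
proof (rule integral_has_real_derivative)
  show "continuous_on {0..pi} (\<lambda>t. ln (2 * sin_ratio t))"
    using sin_ratio_pos by (intro continuous_intros continuous_on_sin_ratio) (auto simp: less_le)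
qed (use assms in auto)

lemma entr_deriv: "x > 0 \<Longrightarrow> (entr has_real_derivative - ln x) (at x within A)"
  unfolding entr_def [abs_def] by (auto intro!: derivative_eq_intros)

lemma tendsto_x_ln_x: "((\<lambda>x::real. x * ln x) \<longlongrightarrow> 0) (at_right 0)"
proof -
  have "((\<lambda>y::real. - (ln y / y)) \<longlongrightarrow> 0) at_top"
    using tendsto_minus[OF ln_x_over_x_tendsto_0] by simp
  from filterlim_compose[OF this filterlim_inverse_at_top_right]
  have "((\<lambda>x::real. - (ln (inverse x) / inverse x)) \<longlongrightarrow> 0) (at_right 0)" .
  moreover have "eventually (\<lambda>x::real. - (ln (inverse x) / inverse x) = x * ln x) (at_right 0)"
    using eventually_at_right_less[of 0] by eventually_elim (simp add: ln_inverse divide_inverse mult.commute)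
  ultimately show ?thesis by (rule Lim_transform_eventually)
qed

lemma continuous_on_entr: "continuous_on {0..} entr"
proof (rule continuous_on_eq_continuous_within[THEN iffD2], intro ballI)
  fix x :: real assume "x \<in> {0..}"
  show "continuous (at x within {0..}) entr"
  proof (cases "x = 0")
    case True
    have "((\<lambda>x::real. x - x * ln x) \<longlongrightarrow> 0 - 0) (at_right 0)"
      by (intro tendsto_intros tendsto_x_ln_x)
    then show ?thesis
      by (simp add: True continuous_within at_within_Ici_at_right entr_def [abs_def])
  next
    case False
    then have "x > 0" using \<open>x \<in> {0..}\<close> by auto
    then show ?thesis using entr_deriv DERIV_continuous by blast
  qed
qed

lemma continuous_on_lob: "continuous_on {0..pi} lob"
proof -
  have "continuous_on {0..pi} (\<lambda>x. entr (pi - x))"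
    by (rule continuous_on_compose2[OF continuous_on_entr]) (auto intro!: continuous_intros)
  moreover have "continuous_on {0..pi} entr"
    by (rule continuous_on_subset[OF continuous_on_entr]) auto
  moreover have "continuous_on {0..pi} (\<lambda>x. integral {0..x} (\<lambda>t. ln (2 * sin_ratio t)))"
    using ln_sin_ratio_integral_deriv DERIV_continuous continuous_on_eq_continuous_within by blast
  ultimately show ?thesis
    unfolding lob_def [abs_def] by (intro continuous_intros)
qed

lemma lob_deriv:
  assumes "0 < x" "x < pi"
  shows "(lob has_real_derivative - ln (2 * sin x)) (at x)"
proof -
  have I: "((\<lambda>x. integral {0..x} (\<lambda>t. ln (2 * sin_ratio t))) has_real_derivative
           ln (2 * sin_ratio x)) (at x)"
    using ln_sin_ratio_integral_deriv[of x] at_within_Icc_at[of 0 x pi] assms by simp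
  have E: "((\<lambda>x. entr (pi - x)) has_real_derivative - (- ln (pi - x))) (at x)"
    by (rule DERIV_chain'[THEN DERIV_cong]) (use assms in \<open>auto intro!: derivative_eq_intros entr_deriv\<close>)
  have "sin x > 0" using assms by (simp add: sin_gt_zero)
  then have "ln (2 * sin_ratio x) = ln 2 + ln (sin x) - ln x - ln (pi - x)"
    using assms by (simp add: sin_ratio_def ln_mult ln_div)
  moreover have "ln (2 * sin x) = ln 2 + ln (sin x)" using \<open>sin x > 0\<close> by (simp add: ln_mult)
  ultimately show ?thesis
    unfolding lob_def [abs_def]
    using entr_deriv[of x UNIV] E I assms by (auto intro!: derivative_eq_intros)
qed

text \<open>Encodes f s = f 0 - C s ln s + D s + o(s) for s -> 0+. A one-sided derivative is the
  case C = 0; the entropy x - x ln x at 0 produces the logarithm.\<close>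

definition log_slope :: "(real \<Rightarrow> real) \<Rightarrow> real \<Rightarrow> real \<Rightarrow> bool" where
  "log_slope f C D \<longleftrightarrow> ((\<lambda>s. (f s - f 0) / s + C * ln s) \<longlongrightarrow> D) (at_right 0)"

lemma log_slope_const: "log_slope (\<lambda>s. k) 0 0"
  by (simp add: log_slope_def)

lemma log_slope_add:
  assumes "log_slope f C D" "log_slope g C' D'"
  shows "log_slope (\<lambda>s. f s + g s) (C + C') (D + D')"
  using tendsto_add[OF assms[unfolded log_slope_def]]
  by (simp add: log_slope_def algebra_simps add_divide_distrib diff_divide_distrib)

lemma log_slope_sum:
  assumes "\<And>i. i \<in> I \<Longrightarrow> log_slope (f i) (C i) (D i)"
  shows "log_slope (\<lambda>s. \<Sum>i\<in>I. f i s) (\<Sum>i\<in>I. C i) (\<Sum>i\<in>I. D i)"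
  using assms
proof (induction I rule: infinite_finite_induct)
  case (insert i I)
  then show ?case by (simp add: log_slope_add)
qed (simp_all add: log_slope_const)

lemma log_slope_derivative:
  assumes "(f has_real_derivative D) (at_right 0)"
  shows "log_slope f 0 D"
  using assms by (simp add: log_slope_def has_field_derivative_iff)

text \<open>Since -ln s tends to infinity, a positive C outweighs any D; D decides only if C
  vanishes.\<close>

lemma log_slope_not_max:
  assumes "log_slope f C D" "C > 0 \<or> (C = 0 \<and> D > 0)"
    and "eventually (\<lambda>s. f s \<le> f 0) (at_right 0)"
  shows False
proof -
  have lim: "((\<lambda>s. (f s - f 0) / s + C * ln s) \<longlongrightarrow> D) (at_right 0)"
    using assms(1) by (simp add: log_slope_def)
  have le: "eventually (\<lambda>s. (f s - f 0) / s + C * ln s \<le> C * ln s) (at_right 0)"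
    using assms(3) eventually_at_right_less[of 0]
    by eventually_elim (simp add: divide_nonpos_pos)
  have small: "eventually (\<lambda>s. C * ln s < m) (at_right 0)" if "C > 0" for m
  proof -
    have "eventually (\<lambda>s. ln s < m / C) (at_right (0::real))"
      using ln_at_0 unfolding filterlim_at_bot_dense by blast
    then show ?thesis by eventually_elim (use that in \<open>simp add: field_simps\<close>)
  qed
  show False
  proof (cases "C > 0")
    case True
    have "eventually (\<lambda>s. (f s - f 0) / s + C * ln s > D - 1) (at_right 0)"
      by (rule order_tendstoD(1)[OF lim]) auto
    with le small[OF True, of "D - 1"] have "eventually (\<lambda>s::real. False) (at_right 0)"
      by eventually_elim auto
    then show False by (simp add: trivial_limit_at_right_real)
  next
    case False
    then have "C = 0" "D > 0" using assms(2) by auto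
    have "eventually (\<lambda>s. (f s - f 0) / s + C * ln s > 0) (at_right 0)"
      by (rule order_tendstoD(1)[OF lim \<open>D > 0\<close>])
    with le have "eventually (\<lambda>s::real. False) (at_right 0)"
      by eventually_elim (use \<open>C = 0\<close> in auto)
    then show False by (simp add: trivial_limit_at_right_real)
  qed
qed

text \<open>The coefficient D of \<open>lob\<close> at y in direction c, with
  \<open>at_end y * c\<close> as C. At the ends the factor ln s is split off, which leaves c - c ln
  (2 |c|). The derivative of \<open>lob\<close> is symmetric about \<open>pi / 2\<close>, so the
  same expression serves 0 with c >= 0 and \<open>pi\<close> with c <= 0.\<close>

definition lob_slope :: "real \<Rightarrow> real \<Rightarrow> real" where
  "lob_slope y c = (if y = 0 \<or> y = pi then c - c * ln (2 * \<bar>c\<bar>) else - (c * ln (2 * sin y)))"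

definition at_end :: "real \<Rightarrow> real" where
  "at_end y = (if y = 0 \<or> y = pi then 1 else 0)"

lemma log_slope_entr_0:
  assumes "c \<ge> 0" shows "log_slope (\<lambda>s. entr (s * c)) c (c - c * ln c)"
proof -
  have "eventually (\<lambda>s. (entr (s * c) - entr (0 * c)) / s + c * ln s = c - c * ln c) (at_right 0)"
    using eventually_at_right_less[of 0]
  proof eventually_elim
    case (elim s)
    then show ?case using assms
      by (cases "c = 0") (auto simp: entr_def ln_mult field_simps)
  qed
  then show ?thesis unfolding log_slope_def by (rule tendsto_eventually)
qed

lemma log_slope_minus:
  assumes "log_slope f C D" shows "log_slope (\<lambda>s. - f s) (- C) (- D)"
  using tendsto_minus[OF assms[unfolded log_slope_def]]
  by (simp add: log_slope_def algebra_simps diff_divide_distrib add_divide_distrib)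

text \<open>One-sided chain rule along a ray that stays in A for 0 < s < e. The base point is
  written \<open>y + 0 * c\<close> to match the chain rule at s = 0.\<close>

lemma DERIV_affine:
  assumes "(f has_real_derivative D) (at (y + 0 * c) within A)"
    and "\<And>s. s > 0 \<Longrightarrow> s < e \<Longrightarrow> y + s * c \<in> A" "e > 0"
  shows "((\<lambda>s. f (y + s * c)) has_real_derivative D * c) (at_right 0)"
proof -
  have ev: "at 0 within {0<..} = at 0 within {0<..<e}"
    by (rule at_within_nhd[of 0 "{..<e}"]) (use \<open>e > 0\<close> in auto)
  have sub: "(\<lambda>s. y + s * c) ` {0<..<e} \<subseteq> A" using assms(2) by auto
  have "((\<lambda>s. y + s * c) has_real_derivative c) (at 0 within {0<..<e})"
    by (auto intro!: derivative_eq_intros)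
  from DERIV_image_chain[OF DERIV_subset[OF assms(1) sub] this] show ?thesis
    using ev by (simp add: o_def)
qed

text \<open>At an end, only the entropy term whose argument vanishes is singular; the other one and
  the integral are differentiable within the interval. The sign conditions make the ray point into
  the interval.\<close>

lemma log_slope_lob:
  assumes "0 \<le> y" "y \<le> pi" "y = 0 \<Longrightarrow> 0 \<le> c" "y = pi \<Longrightarrow> c \<le> 0"
  shows "log_slope (\<lambda>s. lob (y + s * c)) (at_end y * c) (lob_slope y c)"
proof -
  let ?I = "\<lambda>x. integral {0..x} (\<lambda>t. ln (2 * sin_ratio t))"
  consider "c = 0" | "y = 0" "c > 0" | "y = pi" "c < 0" | "0 < y" "y < pi"
    using assms by fastforce
  then show ?thesis
  proof cases
    case 1
    then show ?thesis using log_slope_const by (auto simp: lob_slope_def)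
  next
    case 2
    have in_dom: "y + s * c \<in> {0..pi}" if "s > 0" "s < pi / c" for s
      using that 2 by (auto simp: field_simps)
    have "((\<lambda>s. ?I (y + s * c)) has_real_derivative ln (2 * sin_ratio y) * c) (at_right 0)"
      by (rule DERIV_affine[OF _ in_dom, where e = "pi / c"]) (use 2 ln_sin_ratio_integral_deriv[of y] in auto)
    then have I: "log_slope (\<lambda>s. ?I (y + s * c)) 0 (ln (2 * sin_ratio y) * c)"
      by (rule log_slope_derivative)
    have E: "((\<lambda>x. entr (pi - x)) has_real_derivative ln (pi - y)) (at (y + 0 * c) within {0..pi})"
      by (rule DERIV_chain'[THEN DERIV_cong]) (use 2 in \<open>auto intro!: derivative_eq_intros entr_deriv\<close>)
    have "((\<lambda>s. entr (pi - (y + s * c))) has_real_derivative ln (pi - y) * c) (at_right 0)"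
      by (rule DERIV_affine[OF E in_dom, where e = "pi / c"]) (use 2 in auto)
    then have E': "log_slope (\<lambda>s. entr (pi - (y + s * c))) 0 (ln (pi - y) * c)"
      by (rule log_slope_derivative)
    have "log_slope (\<lambda>s. entr (y + s * c)) c (c - c * ln c)"
      using log_slope_entr_0[of c] 2 by simp
    from log_slope_add[OF log_slope_add[OF this log_slope_minus[OF E']] log_slope_minus[OF I]]
    show ?thesis
      using 2 by (simp add: lob_def lob_slope_def at_end_def sin_ratio_def ln_mult ln_div algebra_simps)
  next
    case 3
    have in_dom: "y + s * c \<in> {0..pi}" if "s > 0" "s < pi / (- c)" for s
      using that 3 mult_neg_pos[of c s] by (auto simp: field_simps)
    have "((\<lambda>s. ?I (y + s * c)) has_real_derivative ln (2 * sin_ratio y) * c) (at_right 0)"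
      by (rule DERIV_affine[OF _ in_dom, where e = "pi / (- c)"]) (use 3 ln_sin_ratio_integral_deriv[of y] in \<open>auto simp: divide_simps\<close>)
    then have I: "log_slope (\<lambda>s. ?I (y + s * c)) 0 (ln (2 * sin_ratio y) * c)"
      by (rule log_slope_derivative)
    have "((\<lambda>s. entr (y + s * c)) has_real_derivative (- ln y) * c) (at_right 0)"
      by (rule DERIV_affine[OF _ in_dom, where e = "pi / (- c)"]) (use 3 entr_deriv[of y] in \<open>auto simp: divide_simps\<close>)
    then have E': "log_slope (\<lambda>s. entr (y + s * c)) 0 (- ln y * c)"
      by (rule log_slope_derivative)
    have "log_slope (\<lambda>s. entr (s * (- c))) (- c) (- c - (- c) * ln (- c))"
      using log_slope_entr_0[of "- c"] 3 by simp
    note this' = this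
    have "ln (- (c * 2)) = ln (- c) + ln 2" using 3 ln_mult[of "- c" 2] by simp
    note ln2 = this
    from log_slope_add[OF log_slope_add[OF log_slope_minus[OF this'] E'] log_slope_minus[OF I]]
    show ?thesis
      using 3 by (simp add: lob_def lob_slope_def at_end_def sin_ratio_def ln2 ln_mult ln_div algebra_simps)
  next
    case 4
    have "((\<lambda>s. lob (y + s * c)) has_real_derivative - ln (2 * sin y) * c) (at_right 0)"
      by (rule DERIV_affine[of _ _ _ _ UNIV 1]) (use lob_deriv[OF 4] in auto)
    then show ?thesis
      using log_slope_derivative 4 by (fastforce simp: at_end_def lob_slope_def mult.commute)
  qed
qed

text \<open>At an end, \<open>lob_slope\<close> is again an entropy in c and singular at c = 0.
  Hence the slope, as a function of the direction, has a logarithmic expansion of its own; the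
  exclusion of collapsed triangles rests on it.\<close>

lemma log_slope_lob_slope:
  "log_slope (\<lambda>k. lob_slope y (c + k * d))
     (if c = 0 then at_end y * d else 0)
     (if c = 0 \<or> (y \<noteq> 0 \<and> y \<noteq> pi) then lob_slope y d else - (d * ln (2 * \<bar>c\<bar>)))"
proof -
  consider "y \<noteq> 0" "y \<noteq> pi" | "y = 0 \<or> y = pi" "c = 0" | "y = 0 \<or> y = pi" "c \<noteq> 0" by blast
  then show ?thesis
  proof cases
    case 1
    then have "log_slope (\<lambda>k. lob_slope y (c + k * d)) 0 (lob_slope y d)"
      by (intro log_slope_derivative) (auto simp: lob_slope_def intro!: derivative_eq_intros)
    then show ?thesis using 1 by (auto simp: at_end_def)
  next
    case 2
    have "eventually (\<lambda>s. (lob_slope y (c + s * d) - lob_slope y (c + 0 * d)) / s + d * ln s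
        = lob_slope y d) (at_right 0)"
      using eventually_at_right_less[of 0]
    proof eventually_elim
      case (elim s)
      then show ?case using 2
        by (cases "d = 0") (auto simp: lob_slope_def ln_mult abs_mult field_simps)
    qed
    then show ?thesis using 2 unfolding log_slope_def at_end_def
      by (auto intro: tendsto_eventually)
  next
    case 3
    have "((\<lambda>x. x - x * ln (2 * \<bar>x\<bar>)) has_real_derivative - ln (2 * \<bar>c\<bar>)) (at (c + 0 * d))"
    proof (cases "c > 0")
      case True
      have ev: "eventually (\<lambda>x. x - x * ln (2 * \<bar>x\<bar>) = x - x * ln (2 * x)) (nhds c)"
        using eventually_nhds_in_open[of "{0<..}" c] True by (auto elim!: eventually_mono)
      have "((\<lambda>x. x - x * ln (2 * x)) has_real_derivative - ln (2 * c)) (at c)"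
        using True by (auto intro!: derivative_eq_intros)
      then show ?thesis using DERIV_cong_ev[OF refl ev refl] True by simp
    next
      case False
      then have "c < 0" using 3 by auto
      have ev: "eventually (\<lambda>x. x - x * ln (2 * \<bar>x\<bar>) = x - x * ln (- 2 * x)) (nhds c)"
        using eventually_nhds_in_open[of "{..<0}" c] \<open>c < 0\<close> by (auto elim!: eventually_mono)
      have "((\<lambda>x. x - x * ln (- 2 * x)) has_real_derivative - ln (- 2 * c)) (at c)"
        using \<open>c < 0\<close> by (auto intro!: derivative_eq_intros)
      then show ?thesis using DERIV_cong_ev[OF refl ev refl] \<open>c < 0\<close> by simp
    qed
    from DERIV_affine[of _ _ _ _ UNIV 1, OF this]
    have "((\<lambda>k. lob_slope y (c + k * d)) has_real_derivative - ln (2 * \<bar>c\<bar>) * d) (at_right 0)"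
      using 3 by (auto simp: lob_slope_def)
    then show ?thesis using log_slope_derivative 3 by (fastforce simp: mult.commute)
  qed
qed

section \<open>Corners of decorated triangles\<close>

text \<open>(sin g)^2 times the power of the corner with respect to a unit circle whose center has
  signed distances cos a and cos b from the two sides.\<close>

definition corner_disc :: "real \<Rightarrow> real \<Rightarrow> real \<Rightarrow> real" where
  "corner_disc g a b = (cos a)\<^sup>2 + (cos b)\<^sup>2 + 2 * cos a * cos b * cos g - (sin g)\<^sup>2"

text \<open>For a face-circle of radius \<open>1\<close>, \<open>corner_rad \<gamma> \<alpha> \<beta>\<close> is the radius of the vertex-circle at a corner
  with angle \<open>\<gamma>\<close> and side angles \<open>\<alpha>\<close> and \<open>\<beta>\<close>, and \<open>corner_foot \<gamma> \<alpha> \<beta>\<close> is the distance from the corner to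
  the foot of the perpendicular from the center of the face-circle to the side with angle \<open>\<alpha>\<close>.\<close>

definition corner_rad :: "real \<Rightarrow> real \<Rightarrow> real \<Rightarrow> real" where
  "corner_rad g a b = sqrt (corner_disc g a b) / sin g"

definition corner_foot :: "real \<Rightarrow> real \<Rightarrow> real \<Rightarrow> real" where
  "corner_foot g a b = (cos b + cos a * cos g) / sin g"

text \<open>Chosen so that the foot is rad cosh and the half chord sin a, cut by the unit
  face-circle from the side, is rad sinh. The half lengths at the two ends of a side add up to
  \<open>\<lambda>\<^sub>i\<^sub>j\<close>.\<close>

definition half_len :: "real \<Rightarrow> real \<Rightarrow> real \<Rightarrow> real" where
  "half_len g a b = arsinh (sin a / corner_rad g a b)"

text \<open>Vanishing side angles are allowed: the maximum of the volume is first placed in this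
  larger set, where all corner quantities are still regular.\<close>

definition hyperideal_corner :: "real \<Rightarrow> real \<Rightarrow> real \<Rightarrow> bool" where
  "hyperideal_corner g a b \<longleftrightarrow> 0 < g \<and> 0 \<le> a \<and> 0 \<le> b \<and> g + a + b < pi"

lemma hyperideal_corner_commute: "hyperideal_corner g a b \<longleftrightarrow> hyperideal_corner g b a"
  by (auto simp: hyperideal_corner_def)

lemma corner_disc_commute: "corner_disc g a b = corner_disc g b a"
  by (simp add: corner_disc_def algebra_simps)

lemma corner_rad_commute: "corner_rad g a b = corner_rad g b a"
  by (simp add: corner_rad_def corner_disc_commute)

text \<open>The discriminant factors as (cos (a + b) + cos g) (cos (a - b) + cos g), and each factor
  is a product of two sines. This shows its sign and matches its logarithm with derivatives of
  \<open>lob\<close>.\<close>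

lemma corner_disc_eq_prod:
  "corner_disc g a b = 4 * sin ((pi + a + b - g) / 2) * sin ((pi - a - b - g) / 2) *
     sin ((pi + a - b - g) / 2) * sin ((pi - a + b - g) / 2)"
proof -
  have half: "sin ((pi + u) / 2) = cos (u / 2)" "sin ((pi - u) / 2) = cos (u / 2)" for u :: real
    by (simp_all add: sin_add sin_diff add_divide_distrib diff_divide_distrib)
  have 1: "2 * (sin ((pi + a + b - g) / 2) * sin ((pi - a - b - g) / 2)) = cos (a + b) + cos g"
    using half(1)[of "a + b - g"] half(2)[of "a + b + g"] cos_plus_cos[of "a + b" g]
    by (simp add: algebra_simps)
  have 2: "2 * (sin ((pi + a - b - g) / 2) * sin ((pi - a + b - g) / 2)) = cos (a - b) + cos g"
    using half(1)[of "a - b - g"] half(2)[of "a - b + g"] cos_plus_cos[of "a - b" g]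
    by (simp add: algebra_simps)
  have "(cos (a + b) + cos g) * (cos (a - b) + cos g) = corner_disc g a b"
    unfolding cos_add cos_diff corner_disc_def
    using sin_cos_squared_add[of a] sin_cos_squared_add[of b] sin_cos_squared_add[of g] by algebra
  then show ?thesis unfolding 1[symmetric] 2[symmetric] by (simp add: algebra_simps)
qed

context
  fixes g a b :: real
  assumes corner: "hyperideal_corner g a b"
begin

lemma corner_arguments:
  "0 < (pi + a + b - g) / 2" "(pi + a + b - g) / 2 < pi"
  "0 < (pi - a - b - g) / 2" "(pi - a - b - g) / 2 < pi"
  "0 < (pi + a - b - g) / 2" "(pi + a - b - g) / 2 < pi"
  "0 < (pi - a + b - g) / 2" "(pi - a + b - g) / 2 < pi"
  using corner by (auto simp: hyperideal_corner_def)

lemma corner_sin_pos: "0 < sin g" "0 \<le> sin a" "0 \<le> sin b"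
  using corner by (auto simp: hyperideal_corner_def sin_gt_zero sin_ge_zero)

lemma corner_disc_pos: "0 < corner_disc g a b"
  unfolding corner_disc_eq_prod by (intro mult_pos_pos sin_gt_zero corner_arguments) simp

lemma corner_rad_pos: "0 < corner_rad g a b"
  using corner_disc_pos corner_sin_pos by (simp add: corner_rad_def)

lemma corner_rad_sq: "(corner_rad g a b)\<^sup>2 * (sin g)\<^sup>2 = corner_disc g a b"
  using corner_disc_pos corner_sin_pos by (simp add: corner_rad_def power_divide)

text \<open>Since b < pi - (a + g), monotonicity of the cosine gives cos b + cos a cos g > sin a sin
  g, so the foot even exceeds the half chord sin a.\<close>

lemma corner_foot_pos: "0 < corner_foot g a b" "0 < corner_foot g b a"
proof -
  have "cos b > cos (pi - (a + g))" "cos a > cos (pi - (b + g))"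
    using corner by (intro cos_monotone_0_pi; simp add: hyperideal_corner_def)+
  then have "cos b + cos a * cos g > sin a * sin g" "cos a + cos b * cos g > sin b * sin g"
    unfolding cos_pi_minus cos_add by linarith+
  moreover have "sin a * sin g \<ge> 0" "sin b * sin g \<ge> 0" using corner_sin_pos by auto
  ultimately have "cos b + cos a * cos g > 0" "cos a + cos b * cos g > 0" by linarith+
  then show "0 < corner_foot g a b" "0 < corner_foot g b a"
    using corner_sin_pos by (auto simp: corner_foot_def)
qed

text \<open>The power of the corner, computed along the side: the unit face-circle cuts it in a
  chord of half-length sin a around the foot.\<close>

lemma corner_foot_sq: "(corner_foot g a b)\<^sup>2 = (corner_rad g a b)\<^sup>2 + (sin a)\<^sup>2"
proof -
  have "(corner_foot g a b)\<^sup>2 * (sin g)\<^sup>2 = (cos b + cos a * cos g)\<^sup>2"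
    using corner_sin_pos by (simp add: corner_foot_def power_divide)
  also have "\<dots> = corner_disc g a b + (sin a)\<^sup>2 * (sin g)\<^sup>2"
    unfolding corner_disc_def
    using sin_cos_squared_add[of a] sin_cos_squared_add[of b] sin_cos_squared_add[of g] by algebra
  also have "\<dots> = ((corner_rad g a b)\<^sup>2 + (sin a)\<^sup>2) * (sin g)\<^sup>2"
    by (simp add: corner_rad_sq[symmetric] algebra_simps)
  finally show ?thesis using corner_sin_pos by simp
qed

text \<open>Identifies the coefficient of the angle derivative z that arises in
  \<open>corner_derivative\<close>.\<close>

lemma corner_foot_mult:
  "corner_foot g a b * corner_foot g b a = (1 + (corner_rad g a b)\<^sup>2) * cos g + cos a * cos b"
proof -
  have "corner_foot g a b * corner_foot g b a * (sin g)\<^sup>2 = (cos b + cos a * cos g) * (cos a + cos b * cos g)"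
    using corner_sin_pos by (simp add: corner_foot_def power2_eq_square)
  also have "\<dots> = ((sin g)\<^sup>2 + corner_disc g a b) * cos g + cos a * cos b * (sin g)\<^sup>2"
    unfolding corner_disc_def
    using sin_cos_squared_add[of a] sin_cos_squared_add[of b] sin_cos_squared_add[of g] by algebra
  also have "\<dots> = ((1 + (corner_rad g a b)\<^sup>2) * cos g + cos a * cos b) * (sin g)\<^sup>2"
    by (simp add: corner_rad_sq[symmetric] algebra_simps)
  finally show ?thesis using corner_sin_pos by simp
qed

lemma corner_foot_cosh: "corner_foot g a b = corner_rad g a b * cosh (half_len g a b)"
proof -
  have "(corner_rad g a b * cosh (half_len g a b))\<^sup>2 = (corner_foot g a b)\<^sup>2"
    using corner_rad_pos by (simp add: corner_foot_sq power_mult_distrib cosh_square_eq half_len_def field_simps)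
  then show ?thesis
    using corner_rad_pos corner_foot_pos(1) cosh_real_nonneg[of "half_len g a b"]
    by (smt (verit) power2_eq_iff_nonneg mult_nonneg_nonneg)
qed

lemma corner_rad_sinh: "corner_rad g a b * sinh (half_len g a b) = sin a"
  using corner_rad_pos by (simp add: half_len_def)

end

text \<open>Minus the partial derivative of the corner angle with respect to the logarithm of the
  radius, at fixed side angles.\<close>

definition radial_weight :: "real \<Rightarrow> real \<Rightarrow> real \<Rightarrow> real" where
  "radial_weight g a b = (corner_rad g a b)\<^sup>2 * sin g / (corner_foot g a b * corner_foot g b a)"

lemma radial_weight_pos: "hyperideal_corner g a b \<Longrightarrow> 0 < radial_weight g a b"
  using corner_rad_pos[of g a b] corner_foot_pos[of g a b] corner_sin_pos[of g a b]
  by (simp add: radial_weight_def)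

text \<open>Differentiating \<open>(corner_rad g a b)\<^sup>2 * (sin g)\<^sup>2 = corner_disc g a
  b\<close> expresses the change z of the corner angle by the changes x, y of the side angles and
  the change w of the logarithm of the radius. In the coordinates x, y, w the second variation
  becomes diagonal.\<close>

lemma corner_derivative:
  assumes corner: "hyperideal_corner (G s) (A s) (B s)"
    and der: "(G has_real_derivative z) (at s)" "(A has_real_derivative x) (at s)"
      "(B has_real_derivative y) (at s)"
  obtains w where
    "((\<lambda>s. ln (corner_rad (G s) (A s) (B s))) has_real_derivative w) (at s)"
    "((\<lambda>s. half_len (G s) (A s) (B s)) has_real_derivative
       (cos (A s) * x - sin (A s) * w) / corner_foot (G s) (A s) (B s)) (at s)"
    "((\<lambda>s. half_len (G s) (B s) (A s)) has_real_derivative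
       (cos (B s) * y - sin (B s) * w) / corner_foot (G s) (B s) (A s)) (at s)"
    "z = - (sin (A s) / corner_foot (G s) (A s) (B s) * x)
         - sin (B s) / corner_foot (G s) (B s) (A s) * y
         - radial_weight (G s) (A s) (B s) * w"
proof -
  note corner' = corner[unfolded hyperideal_corner_commute[of _ "A s"]]
  let ?r = "corner_rad (G s) (A s) (B s)" and ?f = "corner_foot (G s) (A s) (B s)"
    and ?f' = "corner_foot (G s) (B s) (A s)" and ?d = "corner_disc (G s) (A s) (B s)"
  note pos = corner_rad_pos[OF corner] corner_foot_pos[OF corner] corner_sin_pos(1)[OF corner]
    corner_disc_pos[OF corner]
  define d where "d = - 2 * cos (A s) * sin (A s) * x - 2 * cos (B s) * sin (B s) * y
     - 2 * cos (G s) * (sin (A s) * cos (B s) * x + cos (A s) * sin (B s) * y)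
     - 2 * cos (A s) * cos (B s) * sin (G s) * z - 2 * sin (G s) * cos (G s) * z"
  have disc: "((\<lambda>s. corner_disc (G s) (A s) (B s)) has_real_derivative d) (at s)"
    unfolding corner_disc_def d_def
    by (rule derivative_eq_intros der refl | simp)+ (simp add: algebra_simps power2_eq_square)
  define w where "w = d / (2 * ?d) - cos (G s) * z / sin (G s)"
  have sinG: "((\<lambda>s. sin (G s)) has_real_derivative cos (G s) * z) (at s)"
    using DERIV_chain2[OF DERIV_sin der(1)] .
  have root: "((\<lambda>s. sqrt (corner_disc (G s) (A s) (B s))) has_real_derivative
      inverse (sqrt ?d) / 2 * d) (at s)"
    using DERIV_chain2[OF DERIV_real_sqrt[OF pos(5)] disc] .
  have rad: "((\<lambda>s. corner_rad (G s) (A s) (B s)) has_real_derivative ?r * w) (at s)"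
    unfolding corner_rad_def
  proof (rule DERIV_cong[OF DERIV_divide[OF root sinG]])
    have "d / ?d = inverse (sqrt ?d) * d / sqrt ?d" using pos by (simp add: field_simps)
    then show "(inverse (sqrt ?d) / 2 * d * sin (G s) - sqrt ?d * (cos (G s) * z)) / (sin (G s) * sin (G s))
      = sqrt ?d / sin (G s) * w"
      using pos unfolding w_def by (simp add: field_simps)
  qed (use pos in simp)
  have lnrad: "((\<lambda>s. ln (corner_rad (G s) (A s) (B s))) has_real_derivative w) (at s)"
    by (rule DERIV_cong[OF DERIV_chain2[OF DERIV_ln[OF pos(1)] rad]]) (use pos(1) in simp)
  have half: "((\<lambda>s. half_len (G s) (P s) (Q s)) has_real_derivative
       (cos (P s) * u - sin (P s) * w) / corner_foot (G s) (P s) (Q s)) (at s)"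
    if "(P has_real_derivative u) (at s)" and c: "hyperideal_corner (G s) (P s) (Q s)"
      and rad: "((\<lambda>s. corner_rad (G s) (P s) (Q s)) has_real_derivative corner_rad (G s) (P s) (Q s) * w) (at s)"
    for P Q u
  proof -
    let ?r = "corner_rad (G s) (P s) (Q s)"
    note p = corner_rad_pos[OF c] corner_foot_pos[OF c]
    have "sqrt ((sin (P s) / ?r)\<^sup>2 + 1) = sqrt ((corner_foot (G s) (P s) (Q s) / ?r)\<^sup>2)"
      using p by (simp add: corner_foot_sq[OF c] power_divide field_simps)
    also have "\<dots> = corner_foot (G s) (P s) (Q s) / ?r" using p by simp
    finally have sq: "sqrt ((sin (P s) / ?r)\<^sup>2 + 1) = corner_foot (G s) (P s) (Q s) / ?r" .
    have "((\<lambda>s. sin (P s) / corner_rad (G s) (P s) (Q s)) has_real_derivative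
        (cos (P s) * u - sin (P s) * w) / ?r) (at s)"
      by (rule DERIV_cong[OF DERIV_divide[OF DERIV_chain2[OF DERIV_sin that(1)] rad]])
         (use p in \<open>simp_all add: field_simps\<close>)
    note quot = this
    show ?thesis
      unfolding half_len_def
      by (rule DERIV_cong[OF DERIV_chain2[OF arsinh_real_has_field_derivative quot]])
         (unfold sq, use p in \<open>simp add: field_simps\<close>)
  qed
  have "(?r\<^sup>2 * (sin (G s))\<^sup>2) * w = d / 2 - (?r\<^sup>2 * (sin (G s))\<^sup>2) * cos (G s) * z / sin (G s)"
    unfolding corner_rad_sq[OF corner] w_def using pos by (simp add: field_simps)
  then have "?r\<^sup>2 * sin (G s) * w + ?f * ?f' * z
      = (d / 2 - ?r\<^sup>2 * sin (G s) * cos (G s) * z) / sin (G s) + ?f * ?f' * z"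
    using pos by (simp add: field_simps power2_eq_square)
  also have "\<dots> = - sin (A s) * ?f' * x - sin (B s) * ?f * y"
    unfolding corner_foot_mult[OF corner] unfolding d_def corner_foot_def using pos
    by (simp add: field_simps power2_eq_square)
  finally have "z = (- sin (A s) * ?f' * x - sin (B s) * ?f * y - ?r\<^sup>2 * sin (G s) * w) / (?f * ?f')"
    using pos by (simp add: eq_divide_eq algebra_simps)
  also have "\<dots> = - (sin (A s) / ?f * x) - sin (B s) / ?f' * y - radial_weight (G s) (A s) (B s) * w"
    using pos by (simp add: radial_weight_def diff_divide_distrib)
  finally have "z = - (sin (A s) / ?f * x) - sin (B s) / ?f' * y - radial_weight (G s) (A s) (B s) * w" .
  moreover have "((\<lambda>s. half_len (G s) (B s) (A s)) has_real_derivative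
       (cos (B s) * y - sin (B s) * w) / corner_foot (G s) (B s) (A s)) (at s)"
    by (rule half[where Q = A, OF der(3) corner'])
       (use rad in \<open>simp add: corner_rad_commute[of _ "B _"]\<close>)
  ultimately show ?thesis using that[OF lnrad half[where Q = B, OF der(2) corner rad]] by blast
qed

text \<open>For k0 < 0 the form is Lorentzian, and \<open>timelike\<close> says that the normal
  vector n has negative norm in the dual form. The orthogonal complement of a timelike vector is
  spacelike.\<close>

lemma weighted_form_pos_def:
  fixes k n z :: "'i \<Rightarrow> real" and k0 n0 z0 :: real
  assumes "finite I" "\<And>i. i \<in> I \<Longrightarrow> 0 < k i" "n0 \<noteq> 0"
    and orth: "n0 * z0 + (\<Sum>i\<in>I. n i * z i) = 0"
    and timelike: "k0 < 0 \<Longrightarrow> n0\<^sup>2 / k0 + (\<Sum>i\<in>I. (n i)\<^sup>2 / k i) < 0"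
  shows "0 \<le> k0 * z0\<^sup>2 + (\<Sum>i\<in>I. k i * (z i)\<^sup>2)"
    and "k0 * z0\<^sup>2 + (\<Sum>i\<in>I. k i * (z i)\<^sup>2) = 0 \<Longrightarrow> z0 = 0 \<and> (\<forall>i\<in>I. z i = 0)"
proof -
  let ?P = "\<Sum>i\<in>I. k i * (z i)\<^sup>2" and ?B = "\<Sum>i\<in>I. (n i)\<^sup>2 / k i"
  have P: "0 \<le> ?P" using assms(2) by (intro sum_nonneg) (simp add: less_imp_le)
  have zero: "z0 = 0 \<and> (\<forall>i\<in>I. z i = 0)" if "?P = 0"
  proof -
    have "\<forall>i\<in>I. k i * (z i)\<^sup>2 = 0"
      using that sum_nonneg_eq_0_iff[OF assms(1), of "\<lambda>i. k i * (z i)\<^sup>2"] assms(2)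
      by (simp add: less_imp_le)
    then have "\<forall>i\<in>I. z i = 0" using assms(2) by fastforce
    then show ?thesis using orth assms(3) by simp
  qed
  \<comment> \<open>Cauchy-Schwarz with weights sqrt (k i), once the orthogonality relation has
    replaced n0 z0 by the remaining sum.\<close>
  have cs: "(n0 * z0)\<^sup>2 \<le> ?B * ?P"
  proof -
    have "(\<Sum>i\<in>I. n i * z i) = (\<Sum>i\<in>I. (n i / sqrt (k i)) * (sqrt (k i) * z i))"
      using assms(2) by (intro sum.cong) (auto simp: less_imp_neq[symmetric])
    then have "(\<Sum>i\<in>I. n i * z i)\<^sup>2 \<le> (\<Sum>i\<in>I. (n i / sqrt (k i))\<^sup>2) * (\<Sum>i\<in>I. (sqrt (k i) * z i)\<^sup>2)"
      using Cauchy_Schwarz_ineq_sum by metis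
    also have "(\<Sum>i\<in>I. (n i / sqrt (k i))\<^sup>2) = ?B"
      using assms(2) by (intro sum.cong) (auto simp: power_divide less_imp_le)
    also have "(\<Sum>i\<in>I. (sqrt (k i) * z i)\<^sup>2) = ?P"
      using assms(2) by (intro sum.cong) (auto simp: power_mult_distrib less_imp_le)
    finally have "(\<Sum>i\<in>I. n i * z i)\<^sup>2 \<le> ?B * ?P" .
    moreover have "n0 * z0 = - (\<Sum>i\<in>I. n i * z i)" using orth by simp
    ultimately show ?thesis by simp
  qed
  have "0 \<le> k0 * z0\<^sup>2 + ?P \<and> (k0 * z0\<^sup>2 + ?P = 0 \<longrightarrow> ?P = 0)"
  proof (cases "k0 \<ge> 0")
    case True
    then have "0 \<le> k0 * z0\<^sup>2" by simp
    with P show ?thesis by linarith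
  next
    case False
    then have neg: "k0 < 0" by simp
    \<comment> \<open>Positive by \<open>timelike\<close>; multiplying the form by n0^2 and using
      \<open>cs\<close> bounds it below by \<open>?e * ?P\<close>.\<close>
    let ?e = "n0\<^sup>2 + k0 * ?B"
    have "?e = k0 * (n0\<^sup>2 / k0 + ?B)" using neg by (simp add: field_simps)
    then have e: "?e > 0" using timelike[OF neg] neg by (simp add: mult_neg_neg)
    have "k0 * (?B * ?P) \<le> k0 * (n0 * z0)\<^sup>2" using cs neg by (intro mult_left_mono_neg) auto
    then have ge: "n0\<^sup>2 * (k0 * z0\<^sup>2 + ?P) \<ge> ?e * ?P"
      by (simp add: power_mult_distrib algebra_simps)
    have "0 \<le> ?e * ?P" using e P by simp
    then have "0 \<le> n0\<^sup>2 * (k0 * z0\<^sup>2 + ?P)" using ge by linarith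
    then have 1: "0 \<le> k0 * z0\<^sup>2 + ?P"
      using assms(3) by (simp add: zero_le_mult_iff)
    have "?P = 0" if "k0 * z0\<^sup>2 + ?P = 0"
    proof -
      have "?e * ?P \<le> 0" using ge that by simp
      then show ?thesis using e P by (simp add: mult_le_0_iff)
    qed
    with 1 show ?thesis by blast
  qed
  then show "0 \<le> k0 * z0\<^sup>2 + ?P" "k0 * z0\<^sup>2 + ?P = 0 \<Longrightarrow> z0 = 0 \<and> (\<forall>i\<in>I. z i = 0)"
    using zero by blast+
qed

section \<open>Definiteness of the second variation of a decorated triangle\<close>

lemma Delta_iff:
  "(a12, a23, a31, g1, g2, g3) \<in> Delta \<longleftrightarrow>
     a12 > 0 \<and> a23 > 0 \<and> a31 > 0 \<and> g1 > 0 \<and> g2 > 0 \<and> g3 > 0 \<and> g1 + g2 + g3 = pi \<and>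
     g1 + a12 + a31 < pi \<and> g2 + a23 + a12 < pi \<and> g3 + a31 + a23 < pi"
  by (simp add: Delta_def)

lemma Delta_corners:
  assumes "(a12, a23, a31, g1, g2, g3) \<in> Delta"
  shows "hyperideal_corner g1 a12 a31" "hyperideal_corner g1 a31 a12"
    "hyperideal_corner g2 a23 a12" "hyperideal_corner g2 a12 a23"
    "hyperideal_corner g3 a31 a23" "hyperideal_corner g3 a23 a31"
  using assms by (auto simp: Delta_iff hyperideal_corner_def)

text \<open>Twice the area divided by the circumdiameter, for a unit face-circle: the area doubled
  is the sum of side lengths times signed distances cos a, and side lengths are proportional to the
  sines of the opposite angles.\<close>

definition cos_sum :: "real \<Rightarrow> real \<Rightarrow> real \<Rightarrow> real \<Rightarrow> real \<Rightarrow> real \<Rightarrow> real" where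
  "cos_sum a12 a23 a31 g1 g2 g3 = cos a12 * sin g3 + cos a23 * sin g1 + cos a31 * sin g2"

lemma corner_foot_sum:
  assumes "g1 + g2 + g3 = pi" "sin g1 \<noteq> 0" "sin g2 \<noteq> 0"
  shows "corner_foot g1 a12 a31 + corner_foot g2 a12 a23 =
    cos_sum a12 a23 a31 g1 g2 g3 / (sin g1 * sin g2)"
proof -
  have "g3 = pi - (g1 + g2)" using assms(1) by simp
  then have g3: "sin g3 = sin g1 * cos g2 + cos g1 * sin g2" by (simp only: sin_pi_minus sin_add)
  show ?thesis
    using assms(2,3) unfolding cos_sum_def g3 corner_foot_def by (simp add: field_simps)
qed

lemma cos_sum_rotate: "cos_sum a23 a31 a12 g2 g3 g1 = cos_sum a12 a23 a31 g1 g2 g3"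
  by (simp add: cos_sum_def)

lemma cos_sum_pos:
  assumes "(a12, a23, a31, g1, g2, g3) \<in> Delta"
  shows "0 < cos_sum a12 a23 a31 g1 g2 g3"
proof -
  note c = Delta_corners[OF assms]
  have s: "sin g1 > 0" "sin g2 > 0" using corner_sin_pos c by blast+
  have "0 < corner_foot g1 a12 a31 + corner_foot g2 a12 a23"
    using corner_foot_pos c by (meson add_pos_pos)
  then have "0 < cos_sum a12 a23 a31 g1 g2 g3 / (sin g1 * sin g2)"
    using corner_foot_sum[of g1 g2 g3] s assms by (simp add: Delta_iff)
  moreover have "0 < sin g1 * sin g2" using s by simp
  ultimately show ?thesis by (simp only: zero_less_divide_iff) linarith
qed

text \<open>The share of one corner in the dual norm of the normal vector of the constraint on the
  angle sum. Over a common denominator the three shares add up to \<open>cos_sum\<close>.\<close>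

lemma radial_weight_identity:
  assumes c: "hyperideal_corner g a b" and "cos a \<noteq> 0" "cos b \<noteq> 0"
  shows "(sin a)\<^sup>2 / cos a / corner_foot g a b + (sin b)\<^sup>2 / cos b / corner_foot g b a + radial_weight g a b
    = sin g / (cos a * cos b)"
proof -
  let ?f = "corner_foot g a b" and ?f' = "corner_foot g b a" and ?r = "corner_rad g a b"
  note pos = corner_foot_pos[OF c] corner_sin_pos(1)[OF c]
  have F: "?f * sin g = cos b + cos a * cos g" "?f' * sin g = cos a + cos b * cos g"
    using pos by (simp_all add: corner_foot_def)
  have R: "?r\<^sup>2 * (sin g)\<^sup>2 = (cos a)\<^sup>2 + (cos b)\<^sup>2 + 2 * cos a * cos b * cos g - (sin g)\<^sup>2"
    using corner_rad_sq[OF c] by (simp add: corner_disc_def)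
  have "(sin a)\<^sup>2 * cos b * (?f' * sin g) + (sin b)\<^sup>2 * cos a * (?f * sin g)
      + ?r\<^sup>2 * (sin g)\<^sup>2 * cos a * cos b = (?f * sin g) * (?f' * sin g)"
    unfolding F R using sin_cos_squared_add[of a] sin_cos_squared_add[of b] sin_cos_squared_add[of g]
    by algebra
  then have "sin g * ((sin a)\<^sup>2 * cos b * ?f' + (sin b)\<^sup>2 * cos a * ?f + ?r\<^sup>2 * sin g * cos a * cos b)
     = sin g * (sin g * ?f * ?f')"
    by (simp add: algebra_simps power2_eq_square)
  then have "(sin a)\<^sup>2 * cos b * ?f' + (sin b)\<^sup>2 * cos a * ?f + ?r\<^sup>2 * sin g * cos a * cos b
     = sin g * ?f * ?f'" using pos by simp
  then have "((sin a)\<^sup>2 * cos b * ?f' + (sin b)\<^sup>2 * cos a * ?f + ?r\<^sup>2 * sin g * cos a * cos b)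
     / (cos a * cos b * ?f * ?f') = sin g * ?f * ?f' / (cos a * cos b * ?f * ?f')" by simp
  then show ?thesis using pos assms(2,3)
    by (simp add: radial_weight_def add_divide_distrib power2_eq_square)
qed

lemma Delta_rotate:
  "(a12, a23, a31, g1, g2, g3) \<in> Delta \<Longrightarrow> (a23, a31, a12, g2, g3, g1) \<in> Delta"
  by (auto simp: Delta_iff)

text \<open>In the coordinates given by the side angles and the logarithms of the radii, the second
  variation is diagonal, on the hyperplane that expresses that the corner angles keep their sum.
  At most one of its coefficients, the one of an obtuse side angle, is negative, and the normal
  vector of the hyperplane is timelike because \<open>cos_sum\<close> is positive.\<close>

lemma second_variation_acute:
  assumes D: "(a12, a23, a31, g1, g2, g3) \<in> Delta" and acute: "cos a23 > 0" "cos a31 > 0"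
    and z1: "z1 = - (sin a12 / corner_foot g1 a12 a31 * x12) - sin a31 / corner_foot g1 a31 a12 * x31
         - radial_weight g1 a12 a31 * w1"
    and z2: "z2 = - (sin a23 / corner_foot g2 a23 a12 * x23) - sin a12 / corner_foot g2 a12 a23 * x12
         - radial_weight g2 a23 a12 * w2"
    and z3: "z3 = - (sin a31 / corner_foot g3 a31 a23 * x31) - sin a23 / corner_foot g3 a23 a31 * x23
         - radial_weight g3 a31 a23 * w3"
    and z0: "z1 + z2 + z3 = 0"
  defines "Q \<equiv> cos a12 * (1 / corner_foot g1 a12 a31 + 1 / corner_foot g2 a12 a23) * x12\<^sup>2
     + cos a23 * (1 / corner_foot g2 a23 a12 + 1 / corner_foot g3 a23 a31) * x23\<^sup>2
     + cos a31 * (1 / corner_foot g3 a31 a23 + 1 / corner_foot g1 a31 a12) * x31\<^sup>2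
     + radial_weight g1 a12 a31 * w1\<^sup>2 + radial_weight g2 a23 a12 * w2\<^sup>2 + radial_weight g3 a31 a23 * w3\<^sup>2"
  shows "0 \<le> Q" "Q = 0 \<Longrightarrow> x12 = 0 \<and> x23 = 0 \<and> x31 = 0 \<and> z1 = 0 \<and> z2 = 0 \<and> z3 = 0"
proof -
  note c = Delta_corners[OF D]
  note f = c[THEN corner_foot_pos(1)]
  note m = c(1,3,5)[THEN radial_weight_pos]
  define h12 where "h12 = 1 / corner_foot g1 a12 a31 + 1 / corner_foot g2 a12 a23"
  define h23 where "h23 = 1 / corner_foot g2 a23 a12 + 1 / corner_foot g3 a23 a31"
  define h31 where "h31 = 1 / corner_foot g3 a31 a23 + 1 / corner_foot g1 a31 a12"
  have h: "0 < h12" "0 < h23" "0 < h31" using f by (simp_all add: h12_def h23_def h31_def add_pos_pos)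
  \<comment> \<open>The coordinate x12, whose coefficient may be negative, is kept apart. The five
    others have positive weights k, and n is, up to sign, the normal vector of z1 + z2 + z3 =
    0.\<close>
  define k where "k = (!) [cos a23 * h23, cos a31 * h31, radial_weight g1 a12 a31, radial_weight g2 a23 a12,
    radial_weight g3 a31 a23]"
  define n where "n = (!) [sin a23 * h23, sin a31 * h31, radial_weight g1 a12 a31, radial_weight g2 a23 a12,
    radial_weight g3 a31 a23]"
  define z where "z = (!) [x23, x31, w1, w2, w3]"
  have less5: "{..<5::nat} = {0, 1, 2, 3, 4}" by auto
  have a12: "sin a12 > 0" using D by (auto simp: Delta_iff sin_gt_zero)
  have k: "0 < k i" if "i \<in> {..<5}" for i
      using that h m acute unfolding less5 k_def by auto
  have n0: "sin a12 * h12 \<noteq> 0" using a12 h by simp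
  have orth: "sin a12 * h12 * x12 + (\<Sum>i<5. n i * z i) = 0"
      using z0 unfolding z1 z2 z3 less5 n_def z_def h12_def h23_def h31_def
      by (simp add: algebra_simps)
  \<comment> \<open>The dual norm splits over the corners and becomes \<open>cos_sum\<close> divided
    by the product of the three cosines, exactly one of which is negative here.\<close>
  have tl: "(sin a12 * h12)\<^sup>2 / (cos a12 * h12) + (\<Sum>i<5. (n i)\<^sup>2 / k i) < 0" if "cos a12 * h12 < 0"
    proof -
      have neg: "cos a12 < 0" using that h by (simp add: mult_less_0_iff)
      have red: "(sin a * t)\<^sup>2 / (cos a * t) = (sin a)\<^sup>2 / cos a * t" if "t > 0" for a t :: real
        using that by (simp add: power2_eq_square)
      have red': "t\<^sup>2 / t = t" for t :: real by (simp add: power2_eq_square)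
      have "(sin a12 * h12)\<^sup>2 / (cos a12 * h12) + (\<Sum>i<5. (n i)\<^sup>2 / k i) =
        (sin a12)\<^sup>2 / cos a12 * h12 + (sin a23)\<^sup>2 / cos a23 * h23 + (sin a31)\<^sup>2 / cos a31 * h31 +
        radial_weight g1 a12 a31 + radial_weight g2 a23 a12 + radial_weight g3 a31 a23"
        unfolding less5 n_def k_def using h by (simp add: red red')
      also have "\<dots> =
         ((sin a12)\<^sup>2 / cos a12 / corner_foot g1 a12 a31 + (sin a31)\<^sup>2 / cos a31 / corner_foot g1 a31 a12 + radial_weight g1 a12 a31)
       + ((sin a23)\<^sup>2 / cos a23 / corner_foot g2 a23 a12 + (sin a12)\<^sup>2 / cos a12 / corner_foot g2 a12 a23 + radial_weight g2 a23 a12)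
       + ((sin a31)\<^sup>2 / cos a31 / corner_foot g3 a31 a23 + (sin a23)\<^sup>2 / cos a23 / corner_foot g3 a23 a31 + radial_weight g3 a31 a23)"
        unfolding h12_def h23_def h31_def by (simp add: algebra_simps)
      also have "\<dots> = sin g1 / (cos a12 * cos a31) + sin g2 / (cos a23 * cos a12) + sin g3 / (cos a31 * cos a23)"
      proof -
        have "cos a12 \<noteq> 0" "cos a23 \<noteq> 0" "cos a31 \<noteq> 0" using acute neg by auto
        then show ?thesis
          using radial_weight_identity[OF c(1)] radial_weight_identity[OF c(3)]
            radial_weight_identity[OF c(5)] by presburger
      qed
      also have "\<dots> = cos_sum a12 a23 a31 g1 g2 g3 / (cos a12 * cos a23 * cos a31)"
        using acute neg by (simp add: cos_sum_def field_simps)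
      also have "\<dots> < 0"
        using cos_sum_pos[OF D] acute neg by (simp add: divide_pos_neg mult_neg_pos)
      finally show ?thesis .
    qed
  note * = weighted_form_pos_def[OF finite_lessThan k n0 orth tl]
  have Q: "Q = cos a12 * h12 * x12\<^sup>2 + (\<Sum>i<5. k i * (z i)\<^sup>2)"
    unfolding Q_def less5 k_def z_def h12_def h23_def h31_def by simp
  show "0 \<le> Q" using * Q by simp
  show "x12 = 0 \<and> x23 = 0 \<and> x31 = 0 \<and> z1 = 0 \<and> z2 = 0 \<and> z3 = 0" if "Q = 0"
  proof -
    have "x12 = 0" "\<forall>i\<in>{..<5}. z i = 0" using * Q that by auto
    then show ?thesis unfolding z1 z2 z3 less5 z_def by simp
  qed
qed

text \<open>Two side angles at a common corner add up to less than \<open>pi\<close>, so at most one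
  of the three fails to be acute; a rotation of the labels makes it a12.\<close>

lemma second_variation:
  assumes D: "(a12, a23, a31, g1, g2, g3) \<in> Delta"
    and z1: "z1 = - (sin a12 / corner_foot g1 a12 a31 * x12) - sin a31 / corner_foot g1 a31 a12 * x31
         - radial_weight g1 a12 a31 * w1"
    and z2: "z2 = - (sin a23 / corner_foot g2 a23 a12 * x23) - sin a12 / corner_foot g2 a12 a23 * x12
         - radial_weight g2 a23 a12 * w2"
    and z3: "z3 = - (sin a31 / corner_foot g3 a31 a23 * x31) - sin a23 / corner_foot g3 a23 a31 * x23
         - radial_weight g3 a31 a23 * w3"
    and z0: "z1 + z2 + z3 = 0"
  defines "Q \<equiv> cos a12 * (1 / corner_foot g1 a12 a31 + 1 / corner_foot g2 a12 a23) * x12\<^sup>2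
     + cos a23 * (1 / corner_foot g2 a23 a12 + 1 / corner_foot g3 a23 a31) * x23\<^sup>2
     + cos a31 * (1 / corner_foot g3 a31 a23 + 1 / corner_foot g1 a31 a12) * x31\<^sup>2
     + radial_weight g1 a12 a31 * w1\<^sup>2 + radial_weight g2 a23 a12 * w2\<^sup>2 + radial_weight g3 a31 a23 * w3\<^sup>2"
  shows "0 \<le> Q \<and> (Q = 0 \<longrightarrow> x12 = 0 \<and> x23 = 0 \<and> x31 = 0 \<and> z1 = 0 \<and> z2 = 0 \<and> z3 = 0)"
proof -
  have acute: "cos a > 0" if "cos b \<le> 0" "0 < a" "0 < b" "0 < g" "g + a + b < pi \<or> g + b + a < pi" for a b g :: real
  proof (rule cos_gt_zero)
    have "b \<ge> pi / 2"
    proof (rule ccontr)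
      assume "\<not> b \<ge> pi / 2"
      then show False using cos_gt_zero[of b] that by simp
    qed
    then show "a < pi / 2" using that by argo
  qed (use that in auto)
  note D' = D[unfolded Delta_iff]
  consider "cos a23 > 0" "cos a31 > 0" | "cos a31 > 0" "cos a12 > 0" | "cos a12 > 0" "cos a23 > 0"
    using acute[of a12 a23 g2] acute[of a12 a31 g1] acute[of a23 a31 g3] acute[of a31 a23 g3] D'
    by argo
  then show ?thesis
  proof cases
    case 1
    from second_variation_acute[OF D 1 z1 z2 z3 z0] show ?thesis unfolding Q_def by blast
  next
    case 2
    have "z2 + z3 + z1 = 0" using z0 by simp
    from second_variation_acute[OF Delta_rotate[OF D] 2 z2 z3 z1 this] show ?thesis
      unfolding Q_def by (auto simp: algebra_simps)
  next
    case 3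
    have "z3 + z1 + z2 = 0" using z0 by simp
    from second_variation_acute[OF Delta_rotate[OF Delta_rotate[OF D]] 3 z3 z1 z2 this] show ?thesis
      unfolding Q_def by (auto simp: algebra_simps)
  qed
qed

text \<open>The hyperbolic length \<open>\<lambda>\<^sub>i\<^sub>j\<close> of a side, as opposed to
  its euclidean length.\<close>

definition side_len :: "real \<Rightarrow> real \<Rightarrow> real \<Rightarrow> real \<Rightarrow> real \<Rightarrow> real" where
  "side_len a g b g' b' = half_len g a b + half_len g' a b'"

text \<open>F is the gradient of the volume paired with the direction of the segment from the first
  angle system to the second. Its derivative is minus the form of \<open>second_variation\<close>,
  so F decreases strictly.\<close>

lemma length_monotone:
  assumes D: "(a12, a23, a31, g1, g2, g3) \<in> Delta" and D': "(b12, b23, b31, d1, d2, d3) \<in> Delta"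
    and ne: "(a12, a23, a31, g1, g2, g3) \<noteq> (b12, b23, b31, d1, d2, d3)"
  shows "(ln (corner_rad d1 b12 b31) - ln (corner_rad g1 a12 a31)) * (d1 - g1)
    + (ln (corner_rad d2 b23 b12) - ln (corner_rad g2 a23 a12)) * (d2 - g2)
    + (ln (corner_rad d3 b31 b23) - ln (corner_rad g3 a31 a23)) * (d3 - g3)
    < (side_len b12 d1 b31 d2 b23 - side_len a12 g1 a31 g2 a23) * (b12 - a12)
    + (side_len b23 d2 b12 d3 b31 - side_len a23 g2 a12 g3 a31) * (b23 - a23)
    + (side_len b31 d3 b23 d1 b12 - side_len a31 g3 a23 g1 a12) * (b31 - a31)"
proof -
  define A12 where "A12 = (\<lambda>s. a12 + s * (b12 - a12))"
  define A23 where "A23 = (\<lambda>s. a23 + s * (b23 - a23))"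
  define A31 where "A31 = (\<lambda>s. a31 + s * (b31 - a31))"
  define G1 where "G1 = (\<lambda>s. g1 + s * (d1 - g1))"
  define G2 where "G2 = (\<lambda>s. g2 + s * (d2 - g2))"
  define G3 where "G3 = (\<lambda>s. g3 + s * (d3 - g3))"
  note defs = A12_def A23_def A31_def G1_def G2_def G3_def
  have in_Delta: "(A12 s, A23 s, A31 s, G1 s, G2 s, G3 s) \<in> Delta" if "0 \<le> s" "s \<le> 1" for s
  proof -
    have pos: "0 < p + s * (q - p)" if "0 < p" "0 < q" for p q :: real
    proof -
      have "0 < (1 - s) * p + s * q"
        using that \<open>0 \<le> s\<close> \<open>s \<le> 1\<close> by (cases "s = 0") (auto intro!: add_nonneg_pos)
      then show ?thesis by (simp add: algebra_simps)
    qed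
    have lt: "0 < pi - (p + s * (q - p)) - (p' + s * (q' - p')) - (p'' + s * (q'' - p''))"
      if "p + p' + p'' < pi" "q + q' + q'' < pi" for p q p' q' p'' q''
      using pos[of "pi - p - p' - p''" "pi - q - q' - q''"] that by (simp add: algebra_simps)
    have "G1 s + G2 s + G3 s = (g1 + g2 + g3) + s * ((d1 + d2 + d3) - (g1 + g2 + g3))"
      unfolding defs by (simp add: algebra_simps)
    then have "G1 s + G2 s + G3 s = pi" using D D' by (simp add: Delta_iff)
    moreover have "0 < A12 s" "0 < A23 s" "0 < A31 s" "0 < G1 s" "0 < G2 s" "0 < G3 s"
      unfolding defs using pos D D' by (simp_all add: Delta_iff)
    moreover have "0 < pi - G1 s - A12 s - A31 s" "0 < pi - G2 s - A23 s - A12 s" "0 < pi - G3 s - A31 s - A23 s"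
      unfolding defs using lt D D' by (simp_all add: Delta_iff)
    ultimately show ?thesis unfolding Delta_iff by auto
  qed
  define F where "F = (\<lambda>s. ln (corner_rad (G1 s) (A12 s) (A31 s)) * (d1 - g1)
    + ln (corner_rad (G2 s) (A23 s) (A12 s)) * (d2 - g2)
    + ln (corner_rad (G3 s) (A31 s) (A23 s)) * (d3 - g3)
    - (half_len (G1 s) (A12 s) (A31 s) + half_len (G2 s) (A12 s) (A23 s)) * (b12 - a12)
    - (half_len (G2 s) (A23 s) (A12 s) + half_len (G3 s) (A23 s) (A31 s)) * (b23 - a23)
    - (half_len (G3 s) (A31 s) (A23 s) + half_len (G1 s) (A31 s) (A12 s)) * (b31 - a31))"
  have "\<exists>y. (F has_real_derivative y) (at s) \<and> y < 0" if s: "0 \<le> s" "s \<le> 1" for s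
  proof -
    let ?x12 = "b12 - a12" and ?x23 = "b23 - a23" and ?x31 = "b31 - a31"
      and ?z1 = "d1 - g1" and ?z2 = "d2 - g2" and ?z3 = "d3 - g3"
    note Ds = in_Delta[OF s]
    note c = Delta_corners[OF Ds]
    have der: "(A12 has_real_derivative ?x12) (at s)" "(A23 has_real_derivative ?x23) (at s)"
      "(A31 has_real_derivative ?x31) (at s)" "(G1 has_real_derivative ?z1) (at s)"
      "(G2 has_real_derivative ?z2) (at s)" "(G3 has_real_derivative ?z3) (at s)"
      unfolding defs by (auto intro!: derivative_eq_intros)
    obtain w1 where w1: "((\<lambda>s. ln (corner_rad (G1 s) (A12 s) (A31 s))) has_real_derivative w1) (at s)"
      "((\<lambda>s. half_len (G1 s) (A12 s) (A31 s)) has_real_derivative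
         (cos (A12 s) * ?x12 - sin (A12 s) * w1) / corner_foot (G1 s) (A12 s) (A31 s)) (at s)"
      "((\<lambda>s. half_len (G1 s) (A31 s) (A12 s)) has_real_derivative
         (cos (A31 s) * ?x31 - sin (A31 s) * w1) / corner_foot (G1 s) (A31 s) (A12 s)) (at s)"
      "?z1 = - (sin (A12 s) / corner_foot (G1 s) (A12 s) (A31 s) * ?x12)
         - sin (A31 s) / corner_foot (G1 s) (A31 s) (A12 s) * ?x31
         - radial_weight (G1 s) (A12 s) (A31 s) * w1"
      using corner_derivative[where G = G1 and A = A12 and B = A31 and s = s, OF c(1) der(4,1,3)] by blast
    obtain w2 where w2: "((\<lambda>s. ln (corner_rad (G2 s) (A23 s) (A12 s))) has_real_derivative w2) (at s)"
      "((\<lambda>s. half_len (G2 s) (A23 s) (A12 s)) has_real_derivative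
         (cos (A23 s) * ?x23 - sin (A23 s) * w2) / corner_foot (G2 s) (A23 s) (A12 s)) (at s)"
      "((\<lambda>s. half_len (G2 s) (A12 s) (A23 s)) has_real_derivative
         (cos (A12 s) * ?x12 - sin (A12 s) * w2) / corner_foot (G2 s) (A12 s) (A23 s)) (at s)"
      "?z2 = - (sin (A23 s) / corner_foot (G2 s) (A23 s) (A12 s) * ?x23)
         - sin (A12 s) / corner_foot (G2 s) (A12 s) (A23 s) * ?x12
         - radial_weight (G2 s) (A23 s) (A12 s) * w2"
      using corner_derivative[where G = G2 and A = A23 and B = A12 and s = s, OF c(3) der(5,2,1)] by blast
    obtain w3 where w3: "((\<lambda>s. ln (corner_rad (G3 s) (A31 s) (A23 s))) has_real_derivative w3) (at s)"
      "((\<lambda>s. half_len (G3 s) (A31 s) (A23 s)) has_real_derivative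
         (cos (A31 s) * ?x31 - sin (A31 s) * w3) / corner_foot (G3 s) (A31 s) (A23 s)) (at s)"
      "((\<lambda>s. half_len (G3 s) (A23 s) (A31 s)) has_real_derivative
         (cos (A23 s) * ?x23 - sin (A23 s) * w3) / corner_foot (G3 s) (A23 s) (A31 s)) (at s)"
      "?z3 = - (sin (A31 s) / corner_foot (G3 s) (A31 s) (A23 s) * ?x31)
         - sin (A23 s) / corner_foot (G3 s) (A23 s) (A31 s) * ?x23
         - radial_weight (G3 s) (A31 s) (A23 s) * w3"
      using corner_derivative[where G = G3 and A = A31 and B = A23 and s = s, OF c(5) der(6,3,2)] by blast
    have "?z1 + ?z2 + ?z3 = 0" using D D' by (simp add: Delta_iff)
    note sv = second_variation[OF Ds w1(4) w2(4) w3(4) this]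
    let ?Q = "cos (A12 s) * (1 / corner_foot (G1 s) (A12 s) (A31 s) + 1 / corner_foot (G2 s) (A12 s) (A23 s)) * ?x12\<^sup>2
     + cos (A23 s) * (1 / corner_foot (G2 s) (A23 s) (A12 s) + 1 / corner_foot (G3 s) (A23 s) (A31 s)) * ?x23\<^sup>2
     + cos (A31 s) * (1 / corner_foot (G3 s) (A31 s) (A23 s) + 1 / corner_foot (G1 s) (A31 s) (A12 s)) * ?x31\<^sup>2
     + radial_weight (G1 s) (A12 s) (A31 s) * w1\<^sup>2 + radial_weight (G2 s) (A23 s) (A12 s) * w2\<^sup>2
     + radial_weight (G3 s) (A31 s) (A23 s) * w3\<^sup>2"
    have "?Q > 0" using sv ne by fastforce
    \<comment> \<open>Once z is eliminated, the mixed products of w with x and y cancel, and a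
      diagonal form remains.\<close>
    have corner_term: "w * z - (cos a * x - sin a * w) / f * x - (cos b * y - sin b * w) / f' * y =
      - (cos a * (1 / f) * x\<^sup>2 + cos b * (1 / f') * y\<^sup>2 + m * w\<^sup>2)"
      if "z = - (sin a / f * x) - sin b / f' * y - m * w" for w z a x f b y f' m :: real
      unfolding that by (simp add: diff_divide_distrib algebra_simps power2_eq_square)
    have "(F has_real_derivative
       (w1 * ?z1 + w2 * ?z2 + w3 * ?z3
      - ((cos (A12 s) * ?x12 - sin (A12 s) * w1) / corner_foot (G1 s) (A12 s) (A31 s)
         + (cos (A12 s) * ?x12 - sin (A12 s) * w2) / corner_foot (G2 s) (A12 s) (A23 s)) * ?x12
      - ((cos (A23 s) * ?x23 - sin (A23 s) * w2) / corner_foot (G2 s) (A23 s) (A12 s)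
         + (cos (A23 s) * ?x23 - sin (A23 s) * w3) / corner_foot (G3 s) (A23 s) (A31 s)) * ?x23
      - ((cos (A31 s) * ?x31 - sin (A31 s) * w3) / corner_foot (G3 s) (A31 s) (A23 s)
         + (cos (A31 s) * ?x31 - sin (A31 s) * w1) / corner_foot (G1 s) (A31 s) (A12 s)) * ?x31)) (at s)"
      unfolding F_def
      by (intro DERIV_diff DERIV_add DERIV_cmult_right w1(1-3) w2(1-3) w3(1-3))
    moreover have "(w1 * ?z1 + w2 * ?z2 + w3 * ?z3
      - ((cos (A12 s) * ?x12 - sin (A12 s) * w1) / corner_foot (G1 s) (A12 s) (A31 s)
         + (cos (A12 s) * ?x12 - sin (A12 s) * w2) / corner_foot (G2 s) (A12 s) (A23 s)) * ?x12
      - ((cos (A23 s) * ?x23 - sin (A23 s) * w2) / corner_foot (G2 s) (A23 s) (A12 s)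
         + (cos (A23 s) * ?x23 - sin (A23 s) * w3) / corner_foot (G3 s) (A23 s) (A31 s)) * ?x23
      - ((cos (A31 s) * ?x31 - sin (A31 s) * w3) / corner_foot (G3 s) (A31 s) (A23 s)
         + (cos (A31 s) * ?x31 - sin (A31 s) * w1) / corner_foot (G1 s) (A31 s) (A12 s)) * ?x31) = - ?Q"
      using corner_term[OF w1(4)] corner_term[OF w2(4)] corner_term[OF w3(4)]
      unfolding distrib_left distrib_right by linarith
    ultimately show ?thesis using \<open>?Q > 0\<close> by auto
  qed
  from DERIV_neg_imp_decreasing[OF zero_less_one this] have "F 1 < F 0" by blast
  then show ?thesis unfolding F_def defs side_len_def by (simp add: algebra_simps)
qed

section \<open>Plane geometry of decorated triangles\<close>

lemma plane_expand:
  fixes e n v :: "real^2"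
  assumes "e \<bullet> e = 1" "n \<bullet> n = 1" "e \<bullet> n = 0"
  shows "v = (v \<bullet> e) *\<^sub>R e + (v \<bullet> n) *\<^sub>R n"
proof -
  define a b c d where "a = e $ 1" "b = e $ 2" "c = n $ 1" "d = n $ 2"
  have ab: "a * a + b * b = 1" "c * c + d * d = 1" "a * c + b * d = 0"
    using assms by (simp_all add: inner_vec_def sum_2 a_b_c_d_def)
  have ac: "a * a + c * c = 1" using ab by algebra
  have bd: "b * b + d * d = 1" using ab by algebra
  have "(a * b + c * d)^2 = 0" using ab by algebra
  then have abcd: "a * b + c * d = 0" by simp
  have "v $ 1 = (v $ 1 * a + v $ 2 * b) * a + (v $ 1 * c + v $ 2 * d) * c"
    "v $ 2 = (v $ 1 * a + v $ 2 * b) * b + (v $ 1 * c + v $ 2 * d) * d"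
    using ac bd abcd by algebra+
  then show ?thesis
    by (simp add: vec_eq_iff forall_2 inner_vec_def sum_2 a_b_c_d_def)
qed

lemma plane_norm_sq:
  fixes e n v :: "real^2"
  assumes "e \<bullet> e = 1" "n \<bullet> n = 1" "e \<bullet> n = 0"
  shows "v \<bullet> v = (v \<bullet> e)\<^sup>2 + (v \<bullet> n)\<^sup>2"
proof -
  have "v \<bullet> v = v \<bullet> ((v \<bullet> e) *\<^sub>R e + (v \<bullet> n) *\<^sub>R n)" using plane_expand[OF assms, of v] by simp
  then show ?thesis by (simp add: inner_add_right power2_eq_square)
qed

text \<open>\<open>nc\<close> is the strict Cauchy-Schwarz inequality, i.e. q is off the line. The
  part of q - x orthogonal to the line then gives the unit normal n on the side of q, and the signed
  distance becomes an affine function of c.\<close>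

lemma signed_dist_frame:
  fixes x y q :: "real^2"
  assumes "x \<noteq> y" and nc: "((y - x) \<bullet> (q - x))\<^sup>2 < (dist x y)\<^sup>2 * (dist x q)\<^sup>2"
  obtains e n where "y - x = dist x y *\<^sub>R e" "e \<bullet> e = 1" "n \<bullet> n = 1" "e \<bullet> n = 0" "0 < (q - x) \<bullet> n"
    "\<And>c. signed_dist (affine hull {x, y}) q c = (c - x) \<bullet> n"
proof -
  let ?l = "dist x y"
  define e where "e = (1 / ?l) *\<^sub>R (y - x)"
  have l: "?l > 0" using assms(1) by simp
  have e: "y - x = ?l *\<^sub>R e" using l by (simp add: e_def)
  have "?l\<^sup>2 = (y - x) \<bullet> (y - x)" by (subst dist_commute) (simp add: dist_norm power2_norm_eq_inner)
  then have ee: "e \<bullet> e = 1" using l by (simp add: e_def power2_eq_square)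
  define m where "m = (q - x) - ((q - x) \<bullet> e) *\<^sub>R e"
  have em: "e \<bullet> m = 0" by (simp add: m_def inner_diff_right ee inner_commute)
  have foot: "closest_point (affine hull {x, y}) q = x + ((q - x) \<bullet> e) *\<^sub>R e"
  proof (rule closest_point_unique[symmetric])
    show "x + ((q - x) \<bullet> e) *\<^sub>R e \<in> affine hull {x, y}"
    proof -
      have "x + s *\<^sub>R e = (1 - s / ?l) *\<^sub>R x + (s / ?l) *\<^sub>R y" for s
        by (simp add: e_def algebra_simps)
      then show ?thesis unfolding affine_hull_2 by (smt (verit) mem_Collect_eq)
    qed
    show "\<forall>z\<in>affine hull {x, y}. dist q (x + ((q - x) \<bullet> e) *\<^sub>R e) \<le> dist q z"
    proof
      fix z assume "z \<in> affine hull {x, y}"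
      then obtain u v where uv: "u + v = 1" "z = u *\<^sub>R x + v *\<^sub>R y" unfolding affine_hull_2 by blast
      have "u = 1 - v" using uv(1) by simp
      then have "z - x = v *\<^sub>R (y - x)" unfolding uv(2) \<open>u = 1 - v\<close> by (simp add: algebra_simps)
      then have "z = x + (v * ?l) *\<^sub>R e" using e by (simp add: algebra_simps)
      then have "q - z = m + ((q - x) \<bullet> e - v * ?l) *\<^sub>R e" by (simp add: m_def algebra_simps)
      then have "(q - z) \<bullet> (q - z) = m \<bullet> m + ((q - x) \<bullet> e - v * ?l)\<^sup>2"
        using em ee by (simp add: inner_add_left inner_add_right inner_commute power2_eq_square)
      then have "m \<bullet> m \<le> (q - z) \<bullet> (q - z)" by simp
      then show "dist q (x + ((q - x) \<bullet> e) *\<^sub>R e) \<le> dist q z"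
        by (simp add: dist_norm norm_le m_def diff_diff_eq)
    qed
  qed (auto simp: affine_imp_convex closed_affine_hull)
  have "m \<bullet> m = (q - x) \<bullet> (q - x) - ((q - x) \<bullet> e)\<^sup>2"
    by (simp add: m_def inner_diff_left inner_diff_right ee inner_commute power2_eq_square)
  moreover have "((q - x) \<bullet> e)\<^sup>2 < (q - x) \<bullet> (q - x)"
  proof -
    have "?l\<^sup>2 * ((q - x) \<bullet> e)\<^sup>2 = ((y - x) \<bullet> (q - x))\<^sup>2"
      unfolding e by (simp add: power_mult_distrib inner_commute)
    also have "\<dots> < ?l\<^sup>2 * ((q - x) \<bullet> (q - x))"
      using nc by (simp add: dist_norm norm_minus_commute power2_norm_eq_inner)
    finally show ?thesis using l by simp
  qed
  ultimately have mm: "m \<bullet> m > 0" by simp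
  then have m0: "norm m > 0" by auto
  define n where "n = sgn m"
  have nn: "n \<bullet> n = 1"
    using m0 by (simp add: n_def sgn_div_norm dot_square_norm power2_eq_square)
  have en: "e \<bullet> n = 0" using em by (simp add: n_def sgn_div_norm)
  have "(q - x) \<bullet> m = m \<bullet> m"
    using em unfolding m_def by (simp add: inner_diff_left inner_diff_right ee inner_commute algebra_simps)
  then have "0 < (q - x) \<bullet> n" using mm m0 by (simp add: n_def sgn_div_norm)
  moreover have "signed_dist (affine hull {x, y}) q c = (c - x) \<bullet> n" for c
  proof -
    have "signed_dist (affine hull {x, y}) q c = ((c - x) - ((q - x) \<bullet> e) *\<^sub>R e) \<bullet> n"
      unfolding signed_dist_def foot n_def m_def by (simp add: diff_diff_eq)
    then show ?thesis using en by (simp add: inner_diff_left)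
  qed
  ultimately show ?thesis using that[OF e ee nn en] by blast
qed

section \<open>Trigonometry of euclidean triangles given by their side lengths\<close>

definition triangle_ineqs :: "real \<Rightarrow> real \<Rightarrow> real \<Rightarrow> bool" where
  "triangle_ineqs l1 l2 l3 \<longleftrightarrow> l1 < l2 + l3 \<and> l2 < l3 + l1 \<and> l3 < l1 + l2"

text \<open>Twice the area of the triangle, by Heron's formula.\<close>

definition heron :: "real \<Rightarrow> real \<Rightarrow> real \<Rightarrow> real" where
  "heron l1 l2 l3 = sqrt (4 * l2\<^sup>2 * l3\<^sup>2 - (l2\<^sup>2 + l3\<^sup>2 - l1\<^sup>2)\<^sup>2) / 2"

definition opp_angle :: "real \<Rightarrow> real \<Rightarrow> real \<Rightarrow> real" where
  "opp_angle l1 l2 l3 = arccos ((l2\<^sup>2 + l3\<^sup>2 - l1\<^sup>2) / (2 * l2 * l3))"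

lemma heron_rotate: "heron l2 l3 l1 = heron l1 l2 l3"
  by (simp add: heron_def) (simp add: algebra_simps power2_eq_square)

lemma triangle_ineqs_rotate: "triangle_ineqs l2 l3 l1 = triangle_ineqs l1 l2 l3"
  by (auto simp: triangle_ineqs_def)

lemma triangle_ineqs_pos: "triangle_ineqs l1 l2 l3 \<Longrightarrow> 0 < l1 \<and> 0 < l2 \<and> 0 < l3"
  by (auto simp: triangle_ineqs_def)

lemma heron_pos:
  assumes "triangle_ineqs l1 l2 l3"
  shows "0 < 4 * l2\<^sup>2 * l3\<^sup>2 - (l2\<^sup>2 + l3\<^sup>2 - l1\<^sup>2)\<^sup>2" "0 < heron l1 l2 l3"
proof -
  have "4 * l2\<^sup>2 * l3\<^sup>2 - (l2\<^sup>2 + l3\<^sup>2 - l1\<^sup>2)\<^sup>2 =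
    (l1 + l2 + l3) * (l2 + l3 - l1) * (l3 + l1 - l2) * (l1 + l2 - l3)"
    by (simp add: algebra_simps power2_eq_square)
  also have "\<dots> > 0"
    using assms triangle_ineqs_pos[OF assms] by (simp add: triangle_ineqs_def)
  finally show "0 < 4 * l2\<^sup>2 * l3\<^sup>2 - (l2\<^sup>2 + l3\<^sup>2 - l1\<^sup>2)\<^sup>2" .
  then show "0 < heron l1 l2 l3" by (simp add: heron_def)
qed

lemma opp_angle_facts:
  assumes t: "triangle_ineqs l1 l2 l3"
  shows "cos (opp_angle l1 l2 l3) = (l2\<^sup>2 + l3\<^sup>2 - l1\<^sup>2) / (2 * l2 * l3)"
    and "sin (opp_angle l1 l2 l3) = heron l1 l2 l3 / (l2 * l3)"
    and "0 < opp_angle l1 l2 l3" "opp_angle l1 l2 l3 < pi"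
proof -
  let ?c = "(l2\<^sup>2 + l3\<^sup>2 - l1\<^sup>2) / (2 * l2 * l3)"
  note pos = triangle_ineqs_pos[OF t]
  have "(l2\<^sup>2 + l3\<^sup>2 - l1\<^sup>2)\<^sup>2 < (2 * l2 * l3)\<^sup>2"
    using heron_pos(1)[OF t] by (simp add: power_mult_distrib)
  then have "\<bar>l2\<^sup>2 + l3\<^sup>2 - l1\<^sup>2\<bar> < 2 * l2 * l3"
    using pos by (intro power2_less_imp_less[of "\<bar>_\<bar>"]) auto
  then have c: "-1 < ?c" "?c < 1" using pos by (auto simp: field_simps)
  show cos: "cos (opp_angle l1 l2 l3) = ?c" using c unfolding opp_angle_def by (intro cos_arccos) auto
  show "0 < opp_angle l1 l2 l3" "opp_angle l1 l2 l3 < pi"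
    using arccos_lt_bounded[OF c] by (simp_all add: opp_angle_def)
  then have s: "0 < sin (opp_angle l1 l2 l3)" by (rule sin_gt_zero)
  have h: "0 < heron l1 l2 l3 / (l2 * l3)" using heron_pos(2)[OF t] pos by simp
  have "(heron l1 l2 l3)\<^sup>2 = (4 * l2\<^sup>2 * l3\<^sup>2 - (l2\<^sup>2 + l3\<^sup>2 - l1\<^sup>2)\<^sup>2) / 4"
    using heron_pos(1)[OF t] by (simp add: heron_def power_divide)
  then have "(heron l1 l2 l3 / (l2 * l3))\<^sup>2 = 1 - ?c\<^sup>2"
    using pos by (simp add: power_divide power_mult_distrib field_simps)
  also have "\<dots> = (sin (opp_angle l1 l2 l3))\<^sup>2" by (simp add: cos[symmetric] sin_squared_eq)
  finally show "sin (opp_angle l1 l2 l3) = heron l1 l2 l3 / (l2 * l3)"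
    using s h by (simp add: power2_eq_iff)
qed

text \<open>Sines and cosines alone determine the sum modulo 2 pi. The sine of the sum of two angles
  equals that of the third and is positive, which puts this sum below \<open>pi\<close>, where the
  cosine is injective.\<close>

lemma opp_angle_sum:
  assumes t: "triangle_ineqs l1 l2 l3"
  shows "opp_angle l1 l2 l3 + opp_angle l2 l3 l1 + opp_angle l3 l1 l2 = pi"
proof -
  note t2 = triangle_ineqs_rotate[THEN iffD2, OF t]
  note t3 = triangle_ineqs_rotate[THEN iffD2, OF t2]
  note pos = triangle_ineqs_pos[OF t]
  let ?a = "opp_angle l1 l2 l3" and ?b = "opp_angle l2 l3 l1" and ?c = "opp_angle l3 l1 l2"
  note a = opp_angle_facts[OF t] and b = opp_angle_facts[OF t2] and c = opp_angle_facts[OF t3]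
  have h: "heron l2 l3 l1 = heron l1 l2 l3" "heron l3 l1 l2 = heron l1 l2 l3"
    by (simp_all add: heron_rotate[of l1] heron_rotate[of l2])
  have "(heron l1 l2 l3)\<^sup>2 = (4 * l2\<^sup>2 * l3\<^sup>2 - (l2\<^sup>2 + l3\<^sup>2 - l1\<^sup>2)\<^sup>2) / 4"
    using heron_pos(1)[OF t] by (simp add: heron_def power_divide)
  note h2 = this
  have "sin (?a + ?b) = sin ?c"
    unfolding sin_add a(1,2) b(1,2) c(2) h using pos by (simp add: field_simps power2_eq_square)
  moreover have "0 < sin ?c" using c(3,4) by (rule sin_gt_zero)
  ultimately have sab: "0 < sin (?a + ?b)" by simp
  have lt: "?a + ?b < pi"
  proof (rule ccontr)
    assume "\<not> ?a + ?b < pi"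
    moreover have "?a + ?b < 2 * pi" using a(4) b(4) by simp
    ultimately have "sin (?a + ?b) \<le> 0" by (intro sin_le_zero) auto
    then show False using sab by simp
  qed
  have "cos (?a + ?b) = - cos ?c"
  proof -
    have "cos (?a + ?b) = ((l2\<^sup>2 + l3\<^sup>2 - l1\<^sup>2) * (l3\<^sup>2 + l1\<^sup>2 - l2\<^sup>2) / 4 - (heron l1 l2 l3)\<^sup>2) / (l1 * l2 * l3\<^sup>2)"
      unfolding cos_add a(1,2) b(1,2) h using pos by (simp add: field_simps power2_eq_square)
    also have "\<dots> = - cos ?c"
      unfolding h2 c(1) using pos by (simp add: field_simps power2_eq_square)
    finally show ?thesis .
  qed
  then have "cos (?a + ?b) = cos (pi - ?c)" by simp
  moreover have "0 \<le> ?a + ?b" "?a + ?b \<le> pi" "0 \<le> pi - ?c" "pi - ?c \<le> pi" using lt a b c by auto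
  ultimately have "?a + ?b = pi - ?c" using cos_inj_pi by blast
  then show ?thesis by simp
qed

lemma vec_angle_opp_angle:
  fixes x y z :: "real^2"
  assumes "x \<noteq> y" "x \<noteq> z"
  shows "vec_angle (y - x) (z - x) = opp_angle (dist y z) (dist z x) (dist x y)"
proof -
  have "(dist y z)\<^sup>2 = (norm ((y - x) - (z - x)))\<^sup>2" by (simp add: dist_norm)
  also have "\<dots> = (dist x y)\<^sup>2 + (dist z x)\<^sup>2 - 2 * ((y - x) \<bullet> (z - x))"
    unfolding power2_norm_eq_inner
    by (simp add: inner_diff_left inner_diff_right dist_norm norm_minus_commute power2_norm_eq_inner inner_commute)
  finally show ?thesis
    using assms unfolding vec_angle_def opp_angle_def
    by (simp add: dist_norm norm_minus_commute mult.commute)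
qed

lemma inner_sides:
  fixes x y z :: "real^2"
  shows "(y - x) \<bullet> (z - x) = ((dist x y)\<^sup>2 + (dist z x)\<^sup>2 - (dist y z)\<^sup>2) / 2"
  by (simp add: dist_norm power2_norm_eq_inner inner_diff_left inner_diff_right inner_commute algebra_simps)

lemma dist_sq_inner: "(dist x y)\<^sup>2 = (y - x) \<bullet> (y - x)" for x y :: "'a::real_inner"
  by (subst dist_commute) (simp add: dist_norm power2_norm_eq_inner)

lemma triangle_frame:
  fixes x y z :: "real^2"
  assumes t: "triangle_ineqs (dist y z) (dist z x) (dist x y)"
  obtains e n where "y - x = dist x y *\<^sub>R e" "e \<bullet> e = 1" "n \<bullet> n = 1" "e \<bullet> n = 0"
    "(z - x) \<bullet> n = heron (dist y z) (dist z x) (dist x y) / dist x y"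
    "\<And>c. signed_dist (affine hull {x, y}) z c = (c - x) \<bullet> n"
proof -
  let ?l1 = "dist y z" and ?l2 = "dist z x" and ?l3 = "dist x y"
  note pos = triangle_ineqs_pos[OF t]
  have xy: "x \<noteq> y" using pos by auto
  have nc: "((y - x) \<bullet> (z - x))\<^sup>2 < (dist x y)\<^sup>2 * (dist x z)\<^sup>2"
    using heron_pos(1)[OF t] unfolding inner_sides
    by (simp add: power_divide dist_commute[of x z] algebra_simps)
  obtain e n where f: "y - x = dist x y *\<^sub>R e" "e \<bullet> e = 1" "n \<bullet> n = 1" "e \<bullet> n = 0" "0 < (z - x) \<bullet> n"
    "\<And>c. signed_dist (affine hull {x, y}) z c = (c - x) \<bullet> n"
    using signed_dist_frame[OF xy nc] by blast
  have "?l3 * ((z - x) \<bullet> e) = (y - x) \<bullet> (z - x)" unfolding f(1) by (simp add: inner_commute)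
  then have ze: "(z - x) \<bullet> e = (?l3\<^sup>2 + ?l2\<^sup>2 - ?l1\<^sup>2) / (2 * ?l3)"
    unfolding inner_sides using pos by (simp add: field_simps)
  have "((z - x) \<bullet> n)\<^sup>2 = ?l2\<^sup>2 - ((z - x) \<bullet> e)\<^sup>2"
    using plane_norm_sq[OF f(2-4), of "z - x"] dist_sq_inner[of x z] by (simp add: dist_commute)
  also have "\<dots> = (heron ?l1 ?l2 ?l3 / ?l3)\<^sup>2"
    using heron_pos(1)[OF t] pos unfolding ze heron_def
    by (simp add: power_divide field_simps power2_eq_square)
  finally have sq: "((z - x) \<bullet> n)\<^sup>2 = (heron ?l1 ?l2 ?l3 / ?l3)\<^sup>2" .
  have "0 < heron ?l1 ?l2 ?l3 / ?l3" using heron_pos(2)[OF t] pos by simp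
  then have "(z - x) \<bullet> n = heron ?l1 ?l2 ?l3 / ?l3"
    using power2_eq_imp_eq[OF sq] f(5) by simp
  then show ?thesis using that f by blast
qed

lemma signed_dist_barycentric:
  fixes x y z :: "real^2"
  assumes t: "triangle_ineqs (dist y z) (dist z x) (dist x y)"
    and c: "c - x = u *\<^sub>R (y - x) + v *\<^sub>R (z - x)"
  shows "signed_dist (affine hull {x, y}) z c = v * (heron (dist y z) (dist z x) (dist x y) / dist x y)"
proof -
  obtain e n where f: "y - x = dist x y *\<^sub>R e" "e \<bullet> n = 0"
    "(z - x) \<bullet> n = heron (dist y z) (dist z x) (dist x y) / dist x y"
    "\<And>c. signed_dist (affine hull {x, y}) z c = (c - x) \<bullet> n"
    using triangle_frame[OF t] by metis
  have "(y - x) \<bullet> n = 0" unfolding f(1) using f(2) by simp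
  then show ?thesis unfolding f(4) c by (simp add: inner_add_left f(3))
qed

lemma barycentric_exists:
  fixes x y z c :: "real^2"
  assumes t: "triangle_ineqs (dist y z) (dist z x) (dist x y)"
  obtains u v where "c - x = u *\<^sub>R (y - x) + v *\<^sub>R (z - x)"
proof -
  let ?h = "heron (dist y z) (dist z x) (dist x y) / dist x y"
  obtain e n where f: "y - x = dist x y *\<^sub>R e" "e \<bullet> e = 1" "n \<bullet> n = 1" "e \<bullet> n = 0" "(z - x) \<bullet> n = ?h"
    using triangle_frame[OF t] by metis
  have l: "dist x y > 0" using triangle_ineqs_pos[OF t] by simp
  have h: "?h > 0" using heron_pos(2)[OF t] l by simp
  define v where "v = ((c - x) \<bullet> n) / ?h"
  define u where "u = ((c - x) \<bullet> e - v * ((z - x) \<bullet> e)) / dist x y"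
  have "z - x = ((z - x) \<bullet> e) *\<^sub>R e + ?h *\<^sub>R n" using plane_expand[OF f(2-4), of "z - x"] f(5) by simp
  then have "u *\<^sub>R (y - x) + v *\<^sub>R (z - x) = (u * dist x y + v * ((z - x) \<bullet> e)) *\<^sub>R e + (v * ?h) *\<^sub>R n"
    unfolding f(1) by (metis (no_types, lifting) add.assoc scaleR_add_left scaleR_add_right scaleR_scaleR)
  also have "u * dist x y + v * ((z - x) \<bullet> e) = (c - x) \<bullet> e" using l by (simp add: u_def)
  also have "v * ?h = (c - x) \<bullet> n" using h unfolding v_def by (metis nonzero_eq_divide_eq less_irrefl)
  also have "((c - x) \<bullet> e) *\<^sub>R e + ((c - x) \<bullet> n) *\<^sub>R n = c - x" using plane_expand[OF f(2-4)] by simp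
  finally show ?thesis using that by metis
qed

section \<open>The face-circle and the angles of a decorated triangle\<close>

definition orthogonal_circle ::
    "real^2 \<Rightarrow> real^2 \<Rightarrow> real^2 \<Rightarrow> real \<Rightarrow> real \<Rightarrow> real \<Rightarrow> real^2 \<Rightarrow> real \<Rightarrow> bool" where
  "orthogonal_circle x y z r1 r2 r3 c R \<longleftrightarrow> R > 0 \<and> (dist c x)\<^sup>2 = R\<^sup>2 + r1\<^sup>2 \<and>
     (dist c y)\<^sup>2 = R\<^sup>2 + r2\<^sup>2 \<and> (dist c z)\<^sup>2 = R\<^sup>2 + r3\<^sup>2"

text \<open>The right-hand side is the distance from one center to the radical axis of the two
  vertex-circles, and the radical axis of disjoint discs avoids both of them.\<close>

lemma foot_gt_radius:
  fixes l r r' :: real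
  assumes "0 < r" "0 < r'" "r + r' < l"
  shows "r < (l\<^sup>2 + r\<^sup>2 - r'\<^sup>2) / (2 * l)"
proof -
  have "r'\<^sup>2 < (l - r)\<^sup>2" using assms by (intro power_strict_mono) auto
  then show ?thesis using assms by (simp add: field_simps power2_eq_square)
qed

lemma circle_inner:
  fixes c x y :: "real^2"
  assumes "(dist c x)\<^sup>2 = R\<^sup>2 + r1\<^sup>2" "(dist c y)\<^sup>2 = R\<^sup>2 + r2\<^sup>2"
  shows "(c - x) \<bullet> (y - x) = ((dist x y)\<^sup>2 + r1\<^sup>2 - r2\<^sup>2) / 2"
  using assms by (simp add: dist_sq_inner inner_diff_left inner_diff_right inner_commute)

text \<open>The center is the radical center of the vertex-circles: two linear equations fix its
  coordinate a along the side xy and d across it. Its power a^2 + d^2 - r1^2 is positive by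
  \<open>foot_gt_radius\<close> and serves as R^2.\<close>

lemma orthogonal_circle_exists:
  fixes x y z :: "real^2"
  assumes t: "triangle_ineqs (dist y z) (dist z x) (dist x y)" and "0 < r1" "0 < r2" "r1 + r2 < dist x y"
  obtains c R where "orthogonal_circle x y z r1 r2 r3 c R"
proof -
  let ?h = "heron (dist y z) (dist z x) (dist x y) / dist x y"
  obtain e n where f: "y - x = dist x y *\<^sub>R e" "e \<bullet> e = 1" "n \<bullet> n = 1" "e \<bullet> n = 0" "(z - x) \<bullet> n = ?h"
    using triangle_frame[OF t] by metis
  have l: "dist x y > 0" using triangle_ineqs_pos[OF t] by simp
  have h: "?h > 0" using heron_pos(2)[OF t] l by simp
  define a where "a = ((dist x y)\<^sup>2 + r1\<^sup>2 - r2\<^sup>2) / (2 * dist x y)"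
  define d where "d = (((dist z x)\<^sup>2 + r1\<^sup>2 - r3\<^sup>2) / 2 - a * ((z - x) \<bullet> e)) / ?h"
  define c where "c = x + a *\<^sub>R e + d *\<^sub>R n"
  have "(c - x) \<bullet> e = a" "(c - x) \<bullet> n = d"
    using f by (simp_all add: c_def inner_add_left inner_commute[of n e])
  then have cx: "(dist c x)\<^sup>2 = a\<^sup>2 + d\<^sup>2"
    using plane_norm_sq[OF f(2-4), of "c - x"] dist_sq_inner[of x c] by (simp add: dist_commute)
  have dist_c: "(dist c w)\<^sup>2 = (dist c x)\<^sup>2 + (dist w x)\<^sup>2 - 2 * ((c - x) \<bullet> (w - x))" for w
    by (simp add: dist_sq_inner inner_diff_left inner_diff_right inner_commute)
  have "(c - x) \<bullet> (y - x) = a * dist x y"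
    unfolding f(1) c_def using f by (simp add: inner_simps inner_commute)
  then have cy: "(dist c y)\<^sup>2 = a\<^sup>2 + d\<^sup>2 - r1\<^sup>2 + r2\<^sup>2"
    unfolding dist_c[of y] cx using l by (simp add: a_def dist_commute power2_eq_square)
  have "(c - x) \<bullet> (z - x) = a * ((z - x) \<bullet> e) + d * ?h"
    using f(5) by (simp add: c_def inner_simps inner_commute)
  moreover have "d * ?h = ((dist z x)\<^sup>2 + r1\<^sup>2 - r3\<^sup>2) / 2 - a * ((z - x) \<bullet> e)"
    using h unfolding d_def by (metis nonzero_eq_divide_eq less_irrefl)
  ultimately have "(c - x) \<bullet> (z - x) = ((dist z x)\<^sup>2 + r1\<^sup>2 - r3\<^sup>2) / 2" by simp
  then have cz: "(dist c z)\<^sup>2 = a\<^sup>2 + d\<^sup>2 - r1\<^sup>2 + r3\<^sup>2"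
    unfolding dist_c[of z] cx by simp
  have "r1\<^sup>2 < a\<^sup>2" unfolding a_def using foot_gt_radius[OF assms(2-4)] assms(2) by (intro power_strict_mono) auto
  then have "0 < a\<^sup>2 + d\<^sup>2 - r1\<^sup>2" using zero_le_power2[of d] by linarith
  then have "orthogonal_circle x y z r1 r2 r3 c (sqrt (a\<^sup>2 + d\<^sup>2 - r1\<^sup>2))"
    unfolding orthogonal_circle_def using cx cy cz by simp
  then show ?thesis using that by blast
qed

lemma orthogonal_circle_unique:
  fixes x y z :: "real^2"
  assumes t: "triangle_ineqs (dist y z) (dist z x) (dist x y)"
    and 1: "orthogonal_circle x y z r1 r2 r3 c R" and 2: "orthogonal_circle x y z r1 r2 r3 c' R'"
  shows "c = c'" "R = R'"
proof -
  have y: "(c - c') \<bullet> (y - x) = 0"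
    using circle_inner[of c x R r1 y r2] circle_inner[of c' x R' r1 y r2] 1 2
    by (simp add: orthogonal_circle_def inner_diff_left)
  have z: "(c - c') \<bullet> (z - x) = 0"
    using circle_inner[of c x R r1 z r3] circle_inner[of c' x R' r1 z r3] 1 2
    by (simp add: orthogonal_circle_def inner_diff_left)
  obtain u v where "(c - c' + x) - x = u *\<^sub>R (y - x) + v *\<^sub>R (z - x)"
    using barycentric_exists[OF t] by blast
  then have "(c - c') \<bullet> (c - c') = (c - c') \<bullet> (u *\<^sub>R (y - x) + v *\<^sub>R (z - x))" by simp
  also have "\<dots> = 0" using y z by (simp add: inner_add_right)
  finally show c: "c = c'" by simp
  then have "R\<^sup>2 = R'\<^sup>2" "R > 0" "R' > 0" using 1 2 by (simp_all add: orthogonal_circle_def)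
  then show "R = R'" by (simp add: power2_eq_iff)
qed

lemma orthogonal_circle_rotate:
  "orthogonal_circle y z x r2 r3 r1 c R \<longleftrightarrow> orthogonal_circle x y z r1 r2 r3 c R"
  by (auto simp: orthogonal_circle_def)

text \<open>Comparing cosines yields only b < |pi - a - g| and a < |pi - b - g|. If both absolute
  values were taken of negative numbers, adding the two would give g > pi.\<close>

lemma corner_ineq:
  assumes "0 < g" "g < pi" "0 < a" "a < pi" "0 < b" "b < pi"
    and "sin a * sin g < cos b + cos a * cos g" "sin b * sin g < cos a + cos b * cos g"
  shows "g + a + b < pi"
proof -
  have less: "y < \<bar>pi - x - g\<bar>" if "sin x * sin g < cos y + cos x * cos g" "0 < x" "x < pi" "0 < y" "y < pi" for x y
  proof -
    have "cos \<bar>pi - x - g\<bar> = - cos (x + g)"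
      using cos_pi_minus[of "x + g"] cos_abs_real[of "pi - x - g"] by (simp add: algebra_simps)
    also have "\<dots> < cos y" using that by (simp add: cos_add)
    finally show ?thesis
      using cos_monotone_0_pi_le[of "\<bar>pi - x - g\<bar>" y] that assms(1,2) by fastforce
  qed
  have "b < \<bar>pi - a - g\<bar>" "a < \<bar>pi - b - g\<bar>" using less[of a b] less[of b a] assms by auto
  then show ?thesis using assms by linarith
qed

lemma corner_disc_foot: "(cos b + cos a * cos g)\<^sup>2 = corner_disc g a b + (sin a * sin g)\<^sup>2"
  unfolding corner_disc_def power_mult_distrib
  using sin_cos_squared_add[of a] sin_cos_squared_add[of b] sin_cos_squared_add[of g] by algebra

text \<open>X and Y are the oblique coordinates of the center along the two sides at the corner. So
  \<open>c\<close> is the law of cosines, X sin g and Y sin g are the signed distances from the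
  sides, and \<open>f\<close> speaks of the feet of the perpendiculars.\<close>

lemma corner_from_plane:
  fixes X Y R r g :: real
  assumes g: "0 < g" "g < pi" and R: "0 < R" "0 < r" and c: "X\<^sup>2 + Y\<^sup>2 + 2 * X * Y * cos g = R\<^sup>2 + r\<^sup>2"
    and f: "r < X + Y * cos g" "r < Y + X * cos g"
  defines "a \<equiv> arccos (Y * sin g / R)" and "b \<equiv> arccos (X * sin g / R)"
  shows "0 < a" "0 < b" "g + a + b < pi" "cos a = Y * sin g / R" "r = R * corner_rad g a b"
    "R * corner_foot g a b = X + Y * cos g" "R * corner_foot g b a = Y + X * cos g"
proof -
  have s: "0 < sin g" using g by (rule sin_gt_zero)
  have bound: "-1 < Q * sin g / R \<and> Q * sin g / R < 1"
    if "P\<^sup>2 + Q\<^sup>2 + 2 * P * Q * cos g = R\<^sup>2 + r\<^sup>2" "r < P + Q * cos g" for P Q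
  proof -
    have "(P + Q * cos g)\<^sup>2 + (Q * sin g)\<^sup>2 = P\<^sup>2 + Q\<^sup>2 * ((sin g)\<^sup>2 + (cos g)\<^sup>2) + 2 * P * Q * cos g"
      by (simp only: power2_eq_square distrib_left distrib_right) simp
    then have "(P + Q * cos g)\<^sup>2 + (Q * sin g)\<^sup>2 = R\<^sup>2 + r\<^sup>2" using that(1) by simp
    moreover have "r\<^sup>2 < (P + Q * cos g)\<^sup>2" using that(2) R by (intro power_strict_mono) auto
    ultimately have "(Q * sin g)\<^sup>2 < R\<^sup>2" by simp
    then have "\<bar>Q * sin g\<bar> < R" using R by (intro power2_less_imp_less[of "\<bar>_\<bar>"]) auto
    then show ?thesis using R by (auto simp: field_simps abs_less_iff)
  qed
  have Ya: "-1 < Y * sin g / R" "Y * sin g / R < 1" using bound[OF c f(1)] by auto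
  have Xb: "-1 < X * sin g / R" "X * sin g / R < 1"
    using bound[of Y X] c f(2) by (auto simp: algebra_simps)
  show ca: "cos a = Y * sin g / R" using Ya by (simp add: a_def)
  have cb: "cos b = X * sin g / R" using Xb by (simp add: b_def)
  have a: "0 < a" "a < pi" using arccos_lt_bounded[OF Ya] by (simp_all add: a_def)
  have b: "0 < b" "b < pi" using arccos_lt_bounded[OF Xb] by (simp_all add: b_def)
  show "0 < a" "0 < b" using a b by auto
  have "corner_disc g a b = (X\<^sup>2 + Y\<^sup>2 + 2 * X * Y * cos g) * (sin g)\<^sup>2 / R\<^sup>2 - (sin g)\<^sup>2"
    unfolding corner_disc_def ca cb using R by (simp add: field_simps power2_eq_square)
  also have "\<dots> = (r * sin g / R)\<^sup>2" unfolding c using R by (simp add: field_simps power2_eq_square)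
  finally have disc: "corner_disc g a b = (r * sin g / R)\<^sup>2" .
  then have "sqrt (corner_disc g a b) = r * sin g / R" using R s by simp
  then show "r = R * corner_rad g a b" using R s by (simp add: corner_rad_def)
  show fa: "R * corner_foot g a b = X + Y * cos g" and fb: "R * corner_foot g b a = Y + X * cos g"
    using R s unfolding corner_foot_def ca cb by (simp_all add: field_simps)
  have pos: "0 < cos b + cos a * cos g" "0 < cos a + cos b * cos g"
  proof -
    have "cos b + cos a * cos g = (X + Y * cos g) * (sin g / R)" "cos a + cos b * cos g = (Y + X * cos g) * (sin g / R)"
      unfolding ca cb using R by (simp_all add: field_simps)
    moreover have "0 < X + Y * cos g" "0 < Y + X * cos g" "0 < sin g / R" using f R s by auto
    ultimately show "0 < cos b + cos a * cos g" "0 < cos a + cos b * cos g"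
      by (simp_all only: mult_pos_pos)
  qed
  have dpos: "0 < corner_disc g a b" unfolding disc using R s by simp
  have "(sin a * sin g)\<^sup>2 < (cos b + cos a * cos g)\<^sup>2" using corner_disc_foot[of b a g] dpos by simp
  then have 1: "sin a * sin g < cos b + cos a * cos g"
    using pos(1) by (intro power2_less_imp_less[of "sin a * sin g"]) auto
  have "(sin b * sin g)\<^sup>2 < (cos a + cos b * cos g)\<^sup>2"
    using corner_disc_foot[of a b g] dpos corner_disc_commute[of g a b] by simp
  then have 2: "sin b * sin g < cos a + cos b * cos g"
    using pos(2) by (intro power2_less_imp_less[of "sin b * sin g"]) auto
  show "g + a + b < pi" using corner_ineq[OF g a b 1 2] .
qed

lemma corner_from_layout:
  fixes x y z :: "real^2"
  assumes t: "triangle_ineqs (dist y z) (dist z x) (dist x y)"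
    and c: "c - x = u *\<^sub>R (y - x) + v *\<^sub>R (z - x)"
    and r: "0 < r1" "0 < r2" "0 < r3" "r1 + r2 < dist x y" "r1 + r3 < dist z x"
    and circ: "orthogonal_circle x y z r1 r2 r3 c R"
  defines "g \<equiv> opp_angle (dist y z) (dist z x) (dist x y)"
    and "a \<equiv> arccos (signed_dist (affine hull {x, y}) z c / R)"
    and "b \<equiv> arccos (signed_dist (affine hull {z, x}) y c / R)"
  shows "0 < a" "0 < b" "g + a + b < pi" "r1 = R * corner_rad g a b"
    "R * corner_foot g a b = ((dist x y)\<^sup>2 + r1\<^sup>2 - r2\<^sup>2) / (2 * dist x y)"
    "R * corner_foot g b a = ((dist z x)\<^sup>2 + r1\<^sup>2 - r3\<^sup>2) / (2 * dist z x)"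
proof -
  let ?l1 = "dist y z" and ?l2 = "dist z x" and ?l3 = "dist x y"
  note pos = triangle_ineqs_pos[OF t]
  have t': "triangle_ineqs (dist z y) (dist y x) (dist x z)"
    using t by (auto simp: triangle_ineqs_def dist_commute)
  note gf = opp_angle_facts[OF t]
  have R: "0 < R" "(dist c x)\<^sup>2 = R\<^sup>2 + r1\<^sup>2" "(dist c y)\<^sup>2 = R\<^sup>2 + r2\<^sup>2" "(dist c z)\<^sup>2 = R\<^sup>2 + r3\<^sup>2"
    using circ by (simp_all add: orthogonal_circle_def)
  define X where "X = u * ?l3"
  define Y where "Y = v * ?l2"
  have inner: "(y - x) \<bullet> (z - x) = ?l2 * ?l3 * cos g"
    unfolding g_def gf(1) inner_sides using pos by (simp add: field_simps)
  have yy: "(y - x) \<bullet> (y - x) = ?l3\<^sup>2" "(z - x) \<bullet> (z - x) = ?l2\<^sup>2"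
    using dist_sq_inner[of x y] dist_sq_inner[of x z] by (simp_all add: dist_commute)
  have "(dist c x)\<^sup>2 = (c - x) \<bullet> (c - x)" using dist_sq_inner[of x c] by (simp add: dist_commute)
  also have "\<dots> = X\<^sup>2 + Y\<^sup>2 + 2 * X * Y * cos g"
    unfolding c inner_add_left inner_add_right inner_scaleR_left inner_scaleR_right yy
      inner inner_commute[of "z - x" "y - x"] X_def Y_def
    by (simp add: power2_eq_square algebra_simps)
  finally have eq: "X\<^sup>2 + Y\<^sup>2 + 2 * X * Y * cos g = R\<^sup>2 + r1\<^sup>2" using R by simp
  have "(c - x) \<bullet> (y - x) = ?l3 * (X + Y * cos g)"
    unfolding c inner_add_left inner_scaleR_left yy inner inner_commute[of "z - x" "y - x"] X_def Y_def
    by (simp add: power2_eq_square algebra_simps)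
  then have f1: "X + Y * cos g = (?l3\<^sup>2 + r1\<^sup>2 - r2\<^sup>2) / (2 * ?l3)"
    using circle_inner[OF R(2,3)] pos by (simp add: field_simps)
  have "(c - x) \<bullet> (z - x) = ?l2 * (Y + X * cos g)"
    unfolding c inner_add_left inner_scaleR_left yy inner X_def Y_def
    by (simp add: power2_eq_square algebra_simps)
  then have f2: "Y + X * cos g = (?l2\<^sup>2 + r1\<^sup>2 - r3\<^sup>2) / (2 * ?l2)"
    using circle_inner[OF R(2,4)] pos by (simp add: field_simps dist_commute)
  have heron: "heron ?l1 ?l2 ?l3 = ?l2 * ?l3 * sin g" unfolding g_def gf(2) using pos by simp
  have "signed_dist (affine hull {x, y}) z c = Y * sin g"
    unfolding signed_dist_barycentric[OF t c] heron Y_def using pos by simp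
  then have a: "a = arccos (Y * sin g / R)" by (simp add: a_def)
  have c': "c - x = v *\<^sub>R (z - x) + u *\<^sub>R (y - x)" using c by simp
  have "heron (dist z y) (dist y x) (dist x z) = heron ?l1 ?l2 ?l3"
    by (simp add: heron_def dist_commute add.commute mult.commute mult.left_commute)
  then have "signed_dist (affine hull {z, x}) y c = X * sin g"
    using signed_dist_barycentric[OF t' c'] heron pos
    by (simp add: X_def insert_commute dist_commute)
  then have b: "b = arccos (X * sin g / R)" by (simp add: b_def)
  have "r1 < X + Y * cos g" "r1 < Y + X * cos g"
    unfolding f1 f2 using foot_gt_radius r by auto
  note * = corner_from_plane[OF _ _ R(1) r(1) eq this, folded a b]
  have g: "0 < g" "g < pi" using gf(3,4) by (simp_all add: g_def)
  show "0 < a" "0 < b" "g + a + b < pi" "r1 = R * corner_rad g a b"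
    "R * corner_foot g a b = ((dist x y)\<^sup>2 + r1\<^sup>2 - r2\<^sup>2) / (2 * dist x y)"
    "R * corner_foot g b a = ((dist z x)\<^sup>2 + r1\<^sup>2 - r3\<^sup>2) / (2 * dist z x)"
    using *[OF g] f1 f2 by auto
qed

lemma angles_of_decorated_triangle:
  fixes x y z :: "real^2"
  assumes t: "triangle_ineqs (dist y z) (dist z x) (dist x y)"
    and r: "0 < r1" "0 < r2" "0 < r3" "r1 + r2 < dist x y" "r2 + r3 < dist y z" "r3 + r1 < dist z x"
    and circ: "orthogonal_circle x y z r1 r2 r3 c R"
  defines "g1 \<equiv> opp_angle (dist y z) (dist z x) (dist x y)"
    and "g2 \<equiv> opp_angle (dist z x) (dist x y) (dist y z)"
    and "g3 \<equiv> opp_angle (dist x y) (dist y z) (dist z x)"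
    and "a12 \<equiv> arccos (signed_dist (affine hull {x, y}) z c / R)"
    and "a23 \<equiv> arccos (signed_dist (affine hull {y, z}) x c / R)"
    and "a31 \<equiv> arccos (signed_dist (affine hull {z, x}) y c / R)"
  shows "(a12, a23, a31, g1, g2, g3) \<in> Delta"
    "r1 = R * corner_rad g1 a12 a31" "r2 = R * corner_rad g2 a23 a12" "r3 = R * corner_rad g3 a31 a23"
    "dist x y = R * (corner_foot g1 a12 a31 + corner_foot g2 a12 a23)"
    "dist y z = R * (corner_foot g2 a23 a12 + corner_foot g3 a23 a31)"
    "dist z x = R * (corner_foot g3 a31 a23 + corner_foot g1 a31 a12)"
proof -
  obtain u v where c1: "c - x = u *\<^sub>R (y - x) + v *\<^sub>R (z - x)"
    using barycentric_exists[OF t] by blast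
  have c2: "c - y = v *\<^sub>R (z - y) + (1 - u - v) *\<^sub>R (x - y)"
    and c3: "c - z = (1 - u - v) *\<^sub>R (x - z) + u *\<^sub>R (y - z)"
    using c1 by (simp_all add: algebra_simps)
  note t2 = triangle_ineqs_rotate[THEN iffD2, OF t]
  note t3 = triangle_ineqs_rotate[THEN iffD2, OF t2]
  note circ2 = orthogonal_circle_rotate[THEN iffD2, OF circ]
  note circ3 = orthogonal_circle_rotate[THEN iffD2, OF circ2]
  have r': "r2 + r1 < dist x y" "r3 + r2 < dist y z" "r1 + r3 < dist z x" using r by auto
  note k1 = corner_from_layout[OF t c1 r(1,2,3) r(4) r'(3) circ, folded g1_def a12_def a31_def]
  note k2 = corner_from_layout[OF t2 c2 r(2,3,1) r(5) r'(1) circ2, folded g2_def a12_def a23_def]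
  note k3 = corner_from_layout[OF t3 c3 r(3,1,2) r(6) r'(2) circ3, folded g3_def a23_def a31_def]
  have "g1 + g2 + g3 = pi" unfolding g1_def g2_def g3_def by (rule opp_angle_sum[OF t])
  moreover have "0 < g1" "0 < g2" "0 < g3"
    unfolding g1_def g2_def g3_def using opp_angle_facts(3) t t2 t3 by auto
  ultimately show "(a12, a23, a31, g1, g2, g3) \<in> Delta"
    unfolding Delta_iff using k1 k2 k3 by auto
  show "r1 = R * corner_rad g1 a12 a31" "r2 = R * corner_rad g2 a23 a12" "r3 = R * corner_rad g3 a31 a23"
    using k1 k2 k3 by auto
  \<comment> \<open>The distances of the foot from the two ends of the side add up to the
    side.\<close>
  have split: "(l\<^sup>2 + p\<^sup>2 - q\<^sup>2) / (2 * l) + (l\<^sup>2 + q\<^sup>2 - p\<^sup>2) / (2 * l) = l" if "0 < l" for l p q :: real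
    using that by (simp add: field_simps power2_eq_square)
  note pos = triangle_ineqs_pos[OF t]
  show "dist x y = R * (corner_foot g1 a12 a31 + corner_foot g2 a12 a23)"
    "dist y z = R * (corner_foot g2 a23 a12 + corner_foot g3 a23 a31)"
    "dist z x = R * (corner_foot g3 a31 a23 + corner_foot g1 a31 a12)"
    unfolding distrib_left k1(5,6) k2(5,6) k3(5,6) using split pos by simp_all
qed

section \<open>From angles back to lengths, radii and circles\<close>

lemma Delta_foot_sums:
  assumes D: "(a12, a23, a31, g1, g2, g3) \<in> Delta"
  shows "corner_foot g1 a12 a31 + corner_foot g2 a12 a23 = cos_sum a12 a23 a31 g1 g2 g3 / (sin g1 * sin g2)"
    "corner_foot g2 a23 a12 + corner_foot g3 a23 a31 = cos_sum a12 a23 a31 g1 g2 g3 / (sin g2 * sin g3)"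
    "corner_foot g3 a31 a23 + corner_foot g1 a31 a12 = cos_sum a12 a23 a31 g1 g2 g3 / (sin g3 * sin g1)"
proof -
  note c = Delta_corners[OF D]
  have s: "sin g1 \<noteq> 0" "sin g2 \<noteq> 0" "sin g3 \<noteq> 0" using corner_sin_pos(1) c by (metis less_irrefl)+
  have sum: "g1 + g2 + g3 = pi" "g2 + g3 + g1 = pi" "g3 + g1 + g2 = pi" using D by (auto simp: Delta_iff)
  show "corner_foot g1 a12 a31 + corner_foot g2 a12 a23 = cos_sum a12 a23 a31 g1 g2 g3 / (sin g1 * sin g2)"
    using corner_foot_sum[OF sum(1)] s by simp
  show "corner_foot g2 a23 a12 + corner_foot g3 a23 a31 = cos_sum a12 a23 a31 g1 g2 g3 / (sin g2 * sin g3)"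
    using corner_foot_sum[OF sum(2)] s cos_sum_rotate[of a23 a31 a12] by simp
  show "corner_foot g3 a31 a23 + corner_foot g1 a31 a12 = cos_sum a12 a23 a31 g1 g2 g3 / (sin g3 * sin g1)"
    using corner_foot_sum[OF sum(3)] s cos_sum_rotate[of a23 a31 a12] cos_sum_rotate[of a31 a12 a23] by simp
qed

lemma lengths_from_angles:
  assumes D: "(a12, a23, a31, g1, g2, g3) \<in> Delta" and R: "0 < R"
    and l: "l12 = R * (corner_foot g1 a12 a31 + corner_foot g2 a12 a23)"
      "l23 = R * (corner_foot g2 a23 a12 + corner_foot g3 a23 a31)"
      "l31 = R * (corner_foot g3 a31 a23 + corner_foot g1 a31 a12)"
  shows "triangle_ineqs l23 l31 l12"
    "opp_angle l23 l31 l12 = g1"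
    "R * corner_rad g1 a12 a31 + R * corner_rad g2 a23 a12 < l12"
proof -
  note c = Delta_corners[OF D]
  have s: "sin g1 > 0" "sin g2 > 0" "sin g3 > 0" using corner_sin_pos(1) c by blast+
  have sum: "g1 + g2 + g3 = pi" "g2 + g3 + g1 = pi" "g3 + g1 + g2 = pi" using D by (auto simp: Delta_iff)
  \<comment> \<open>The circumdiameter, by the law of sines.\<close>
  define k where "k = R * cos_sum a12 a23 a31 g1 g2 g3 / (sin g1 * sin g2 * sin g3)"
  have k: "0 < k" using R cos_sum_pos[OF D] s by (simp add: k_def)
  have l': "l12 = k * sin g3" "l23 = k * sin g1" "l31 = k * sin g2"
    using s unfolding l k_def Delta_foot_sums[OF D] by (simp_all add: field_simps)
  have sin_lt: "sin p < sin q + sin w" if "p + q + w = pi" "0 < q" "0 < w" "0 < p" for p q w :: real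
  proof -
    have "p = pi - (q + w)" using that by simp
    then have p: "sin p = sin q * cos w + cos q * sin w" by (simp only: sin_pi_minus sin_add)
    have "cos w < 1" "cos q < 1" using cos_monotone_0_pi[of 0] that by auto
    moreover have "0 < sin q" "0 < sin w" using that by (auto intro!: sin_gt_zero)
    ultimately have "sin q * cos w < sin q * 1" "cos q * sin w < 1 * sin w" by auto
    then show ?thesis unfolding p by linarith
  qed
  have g: "0 < g1" "0 < g2" "0 < g3" using D by (auto simp: Delta_iff)
  have "sin g1 < sin g2 + sin g3" "sin g2 < sin g3 + sin g1" "sin g3 < sin g1 + sin g2"
    using sin_lt[of g1 g2 g3] sin_lt[of g2 g3 g1] sin_lt[of g3 g1 g2] sum g by auto
  then show t: "triangle_ineqs l23 l31 l12"
    unfolding triangle_ineqs_def l' using k by (simp_all flip: distrib_left)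
  have "g3 = pi - (g1 + g2)" using sum by simp
  then have c3: "sin g3 = sin g1 * cos g2 + cos g1 * sin g2" "cos g3 = sin g1 * sin g2 - cos g1 * cos g2"
    by (simp_all only: sin_pi_minus cos_pi_minus sin_add cos_add minus_diff_eq)
  have law: "(sin g2)\<^sup>2 + (sin g3)\<^sup>2 - (sin g1)\<^sup>2 = 2 * sin g2 * sin g3 * cos g1"
    unfolding c3(1) using sin_cos_squared_add[of g1] sin_cos_squared_add[of g2] by algebra
  have "l31\<^sup>2 + l12\<^sup>2 - l23\<^sup>2 = k\<^sup>2 * ((sin g2)\<^sup>2 + (sin g3)\<^sup>2 - (sin g1)\<^sup>2)"
    unfolding l' power_mult_distrib by (simp add: algebra_simps)
  also have "\<dots> = 2 * l31 * l12 * cos g1"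
    unfolding law l' by (simp add: power2_eq_square)
  finally have "l31\<^sup>2 + l12\<^sup>2 - l23\<^sup>2 = 2 * l31 * l12 * cos g1" .
  then have "(l31\<^sup>2 + l12\<^sup>2 - l23\<^sup>2) / (2 * l31 * l12) = cos g1"
    using k s by (simp add: l')
  then show "opp_angle l23 l31 l12 = g1"
    unfolding opp_angle_def using g sum by (simp add: arccos_cos)
  have "corner_rad g1 a12 a31 < corner_foot g1 a12 a31" "corner_rad g2 a23 a12 < corner_foot g2 a12 a23"
  proof -
    \<comment> \<open>The squares differ by (sin a)^2; positive side angles keep neighbouring
      vertex-circles apart.\<close>
    have "corner_rad g a b < corner_foot g a b" if c: "hyperideal_corner g a b" and a: "0 < a" for g a b
    proof -
      have "0 < sin a" using c a by (auto simp: hyperideal_corner_def intro!: sin_gt_zero)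
      then have "(corner_rad g a b)\<^sup>2 < (corner_foot g a b)\<^sup>2" by (simp add: corner_foot_sq[OF c])
      then show ?thesis using corner_foot_pos[OF c] by (intro power2_less_imp_less[of "corner_rad g a b"]) auto
    qed
    then show "corner_rad g1 a12 a31 < corner_foot g1 a12 a31" "corner_rad g2 a23 a12 < corner_foot g2 a12 a23"
      using c D by (auto simp: Delta_iff corner_rad_commute[of g2 a23])
  qed
  then show "R * corner_rad g1 a12 a31 + R * corner_rad g2 a23 a12 < l12"
    unfolding l using R by (simp flip: distrib_left)
qed

text \<open>The center of the face-circle has barycentric coordinates proportional to the side
  lengths times the signed distances, i.e. to \<open>sin \<gamma>\<^sub>i cos \<alpha>\<^sub>j\<^sub>k\<close>.\<close>

lemma circle_from_angles:
  fixes x y z :: "real^2"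
  assumes D: "(a12, a23, a31, g1, g2, g3) \<in> Delta" and R: "0 < R"
    and l: "dist x y = R * (corner_foot g1 a12 a31 + corner_foot g2 a12 a23)"
      "dist y z = R * (corner_foot g2 a23 a12 + corner_foot g3 a23 a31)"
      "dist z x = R * (corner_foot g3 a31 a23 + corner_foot g1 a31 a12)"
  obtains c where
    "orthogonal_circle x y z (R * corner_rad g1 a12 a31) (R * corner_rad g2 a23 a12) (R * corner_rad g3 a31 a23) c R"
    "signed_dist (affine hull {x, y}) z c = R * cos a12"
    "signed_dist (affine hull {y, z}) x c = R * cos a23"
    "signed_dist (affine hull {z, x}) y c = R * cos a31"
proof -
  note D2 = Delta_rotate[OF D]
  note D3 = Delta_rotate[OF D2]
  note c = Delta_corners[OF D]
  let ?N = "cos_sum a12 a23 a31 g1 g2 g3"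
  have N: "?N > 0" by (rule cos_sum_pos[OF D])
  have s: "sin g1 > 0" "sin g2 > 0" "sin g3 > 0" using corner_sin_pos(1) c by blast+
  note t = lengths_from_angles(1,2)[OF D R l]
  have ang: "opp_angle (dist y z) (dist z x) (dist x y) = g1" "opp_angle (dist z x) (dist x y) (dist y z) = g2"
    "opp_angle (dist x y) (dist y z) (dist z x) = g3"
    using lengths_from_angles(2)[OF D R l] lengths_from_angles(2)[OF D2 R l(2,3,1)]
      lengths_from_angles(2)[OF D3 R l(3,1,2)] by auto
  have t1: "triangle_ineqs (dist y z) (dist z x) (dist x y)" by (rule t)
  note t2 = triangle_ineqs_rotate[THEN iffD2, OF t1]
  note t3 = triangle_ineqs_rotate[THEN iffD2, OF t2]
  have l': "dist x y = R * ?N / (sin g1 * sin g2)" "dist y z = R * ?N / (sin g2 * sin g3)"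
    "dist z x = R * ?N / (sin g3 * sin g1)"
    unfolding l Delta_foot_sums[OF D] by simp_all
  define m1 where "m1 = sin g1 * cos a23 / ?N"
  define m2 where "m2 = sin g2 * cos a31 / ?N"
  define m3 where "m3 = sin g3 * cos a12 / ?N"
  have m: "m1 + m2 + m3 = 1"
  proof -
    have "sin g1 * cos a23 + sin g2 * cos a31 + sin g3 * cos a12 = ?N" by (simp add: cos_sum_def)
    then show ?thesis
      using N unfolding m1_def m2_def m3_def by (simp flip: add_divide_distrib)
  qed
  define c where "c = x + m2 *\<^sub>R (y - x) + m3 *\<^sub>R (z - x)"
  have c1: "c - x = m2 *\<^sub>R (y - x) + m3 *\<^sub>R (z - x)" by (simp add: c_def)
  have m1: "m1 = 1 - m2 - m3" using m by simp
  have c2: "c - y = m3 *\<^sub>R (z - y) + m1 *\<^sub>R (x - y)" and c3: "c - z = m1 *\<^sub>R (x - z) + m2 *\<^sub>R (y - z)"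
    unfolding m1 c_def by (simp_all add: algebra_simps)
  \<comment> \<open>u and v times the adjacent side lengths are the oblique coordinates of the
    center at p; the law of cosines turns them into \<open>corner_disc\<close>.\<close>
  have circ: "(dist d p)\<^sup>2 = R\<^sup>2 + (R * corner_rad g a b)\<^sup>2"
    if d: "d - p = u *\<^sub>R (q - p) + v *\<^sub>R (w - p)" and t: "triangle_ineqs (dist q w) (dist w p) (dist p q)"
      and g: "opp_angle (dist q w) (dist w p) (dist p q) = g" and corner: "hyperideal_corner g a b"
      and u: "u * dist p q = R * cos b / sin g" and v: "v * dist w p = R * cos a / sin g"
    for d p q w :: "real^2" and u v g a b
  proof -
    note pos = triangle_ineqs_pos[OF t] corner_sin_pos(1)[OF corner]
    have inner: "(q - p) \<bullet> (w - p) = dist w p * dist p q * cos g"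
      unfolding g[symmetric] opp_angle_facts(1)[OF t] inner_sides using pos by (simp add: field_simps)
    have qq: "(q - p) \<bullet> (q - p) = (dist p q)\<^sup>2" "(w - p) \<bullet> (w - p) = (dist w p)\<^sup>2"
      using dist_sq_inner[of p q] dist_sq_inner[of p w] by (simp_all add: dist_commute)
    have "(dist d p)\<^sup>2 = (d - p) \<bullet> (d - p)" using dist_sq_inner[of p d] by (simp add: dist_commute)
    also have "\<dots> = (u * dist p q)\<^sup>2 + (v * dist w p)\<^sup>2 + 2 * (u * dist p q) * (v * dist w p) * cos g"
      unfolding d inner_add_left inner_add_right inner_scaleR_left inner_scaleR_right qq
        inner inner_commute[of "w - p" "q - p"]
      by (simp add: power2_eq_square algebra_simps)
    also have "\<dots> * (sin g)\<^sup>2 = R\<^sup>2 * (corner_disc g a b + (sin g)\<^sup>2)"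
      unfolding u v corner_disc_def using pos by (simp add: power2_eq_square field_simps)
    also have "\<dots> = (R\<^sup>2 + (R * corner_rad g a b)\<^sup>2) * (sin g)\<^sup>2"
      unfolding corner_rad_sq[OF corner, symmetric] by (simp add: power_mult_distrib algebra_simps)
    finally show ?thesis using pos by simp
  qed
  note k = Delta_corners[OF D]
  have "(dist c x)\<^sup>2 = R\<^sup>2 + (R * corner_rad g1 a12 a31)\<^sup>2"
    by (rule circ[OF c1 t1 ang(1) k(1)]) (use N s in \<open>simp_all add: l' m2_def m3_def\<close>)
  moreover have "(dist c y)\<^sup>2 = R\<^sup>2 + (R * corner_rad g2 a23 a12)\<^sup>2"
    by (rule circ[OF c2 t2 ang(2) k(3)]) (use N s in \<open>simp_all add: l' m3_def m1_def\<close>)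
  moreover have "(dist c z)\<^sup>2 = R\<^sup>2 + (R * corner_rad g3 a31 a23)\<^sup>2"
    by (rule circ[OF c3 t3 ang(3) k(5)]) (use N s in \<open>simp_all add: l' m1_def m2_def\<close>)
  ultimately have "orthogonal_circle x y z (R * corner_rad g1 a12 a31) (R * corner_rad g2 a23 a12)
      (R * corner_rad g3 a31 a23) c R"
    using R by (simp add: orthogonal_circle_def)
  moreover have dist_eq: "signed_dist (affine hull {p, q}) w c = R * cos al"
    if d: "c - p = u *\<^sub>R (q - p) + (sin g' * cos al / ?N) *\<^sub>R (w - p)"
      and t: "triangle_ineqs (dist q w) (dist w p) (dist p q)"
      and g: "opp_angle (dist q w) (dist w p) (dist p q) = g" and w: "dist w p = R * ?N / (sin g' * sin g)"
      and s: "0 < sin g" "0 < sin g'"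
    for p q w :: "real^2" and u g g' al
  proof -
    note pos = triangle_ineqs_pos[OF t]
    have "heron (dist q w) (dist w p) (dist p q) = sin g * (dist w p * dist p q)"
      using opp_angle_facts(2)[OF t] pos unfolding g by simp
    then have "heron (dist q w) (dist w p) (dist p q) / dist p q = sin g * dist w p"
      using pos by simp
    also have "\<dots> = R * ?N / sin g'" unfolding w using s by simp
    finally have h: "heron (dist q w) (dist w p) (dist p q) / dist p q = R * ?N / sin g'" .
    show ?thesis unfolding signed_dist_barycentric[OF t d] h using s N by simp
  qed
  moreover have "signed_dist (affine hull {x, y}) z c = R * cos a12"
    by (rule dist_eq[OF c1[unfolded m3_def] t1 ang(1) l'(3) s(1,3)])
  moreover have "signed_dist (affine hull {y, z}) x c = R * cos a23"
    by (rule dist_eq[OF c2[unfolded m1_def] t2 ang(2) l'(1) s(2,1)])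
  moreover have "signed_dist (affine hull {z, x}) y c = R * cos a31"
    by (rule dist_eq[OF c3[unfolded m2_def] t3 ang(3) l'(2) s(3,2)])
  ultimately show ?thesis using that by blast
qed

text \<open>Along the side, l = r cosh p + r' cosh q, while r sinh p and r' sinh q are the same half
  chord R sin a. The two sides of the claim differ by the square of the difference of the half
  chords.\<close>

lemma cosh_law:
  assumes c: "hyperideal_corner g a b" and c': "hyperideal_corner g' a b'"
    and l: "l = R * (corner_foot g a b + corner_foot g' a b')"
    and r: "r = R * corner_rad g a b" "r' = R * corner_rad g' a b'"
  shows "l\<^sup>2 = r\<^sup>2 + r'\<^sup>2 + 2 * r * r' * cosh (half_len g a b + half_len g' a b')"
proof -
  let ?p = "half_len g a b" and ?q = "half_len g' a b'"
  have l': "l = r * cosh ?p + r' * cosh ?q"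
    unfolding l r corner_foot_cosh[OF c] corner_foot_cosh[OF c'] by (simp add: algebra_simps)
  have s: "r * sinh ?p = R * sin a" "r' * sinh ?q = R * sin a"
    unfolding r mult.assoc corner_rad_sinh[OF c] corner_rad_sinh[OF c'] by auto
  have "l\<^sup>2 - (r\<^sup>2 + r'\<^sup>2 + 2 * r * r' * cosh (?p + ?q)) = (r * sinh ?p)\<^sup>2 + (r' * sinh ?q)\<^sup>2 - 2 * (r * sinh ?p) * (r' * sinh ?q)"
    unfolding l' cosh_add using cosh_square_eq[of ?p] cosh_square_eq[of ?q] by algebra
  then show ?thesis unfolding s by (simp add: power2_eq_square)
qed

text \<open>Both face-circles are orthogonal to the vertex-circles at x and y, so their centers lie
  on the radical axis of these, at heights d and -d' over xy. The angle condition means d / R >= -d'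
  / R'. Since u / sqrt (u^2 + h) increases with u, this gives d + d' >= 0, and the powers of q with
  respect to the two circles differ by a nonnegative multiple of d + d'.\<close>

lemma delaunay_plane:
  fixes x y z q :: "real^2"
  assumes t: "triangle_ineqs (dist y z) (dist z x) (dist x y)"
    and t': "triangle_ineqs (dist y q) (dist q x) (dist x y)"
    and r: "0 < r1" "0 < r2" "r1 + r2 < dist x y"
    and c: "orthogonal_circle x y z r1 r2 r3 c R" and c': "orthogonal_circle x y q r1 r2 r4 c' R'"
    and opp: "signed_dist (affine hull {x, y}) z q < 0"
    and le: "arccos (signed_dist (affine hull {x, y}) z c / R) + arccos (signed_dist (affine hull {x, y}) q c' / R') \<le> pi"
  shows "(dist c q)\<^sup>2 \<ge> R\<^sup>2 + r4\<^sup>2"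
proof -
  note pos = triangle_ineqs_pos[OF t]
  obtain e n where f: "y - x = dist x y *\<^sub>R e" "e \<bullet> e = 1" "n \<bullet> n = 1" "e \<bullet> n = 0"
    "\<And>c. signed_dist (affine hull {x, y}) z c = (c - x) \<bullet> n"
    using triangle_frame[OF t] by metis
  obtain e' m where f': "y - x = dist x y *\<^sub>R e'" "m \<bullet> m = 1" "e' \<bullet> m = 0"
    "(q - x) \<bullet> m = heron (dist y q) (dist q x) (dist x y) / dist x y"
    "\<And>c. signed_dist (affine hull {x, y}) q c = (c - x) \<bullet> m"
    using triangle_frame[OF t'] by metis
  have ee: "e' = e" using f(1) f'(1) pos by simp
  have mn: "m = (m \<bullet> n) *\<^sub>R n" using plane_expand[OF f(2-4), of m] f'(3) ee by (simp add: inner_commute)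
  have "(m \<bullet> n)\<^sup>2 = 1" using plane_norm_sq[OF f(2-4), of m] f'(2,3) ee by (simp add: inner_commute)
  then have pm: "m \<bullet> n = 1 \<or> m \<bullet> n = -1" by (simp add: power2_eq_1_iff)
  have qn: "(q - x) \<bullet> n < 0" using opp f(5) by simp
  have qm: "(q - x) \<bullet> m > 0" using heron_pos(2)[OF t'] pos f'(4) by simp
  \<comment> \<open>q lies across the line from z, so the two frames have opposite normals.\<close>
  have m: "m = - n"
    using pm
  proof
    assume "m \<bullet> n = 1"
    then have "m = n" using mn by simp
    then show ?thesis using qn qm by simp
  next
    assume "m \<bullet> n = -1"
    then show ?thesis using mn by simp
  qed
  have R: "0 < R" "(dist c x)\<^sup>2 = R\<^sup>2 + r1\<^sup>2" "(dist c y)\<^sup>2 = R\<^sup>2 + r2\<^sup>2"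
    using c by (simp_all add: orthogonal_circle_def)
  have R': "0 < R'" "(dist c' x)\<^sup>2 = R'\<^sup>2 + r1\<^sup>2" "(dist c' y)\<^sup>2 = R'\<^sup>2 + r2\<^sup>2" "(dist c' q)\<^sup>2 = R'\<^sup>2 + r4\<^sup>2"
    using c' by (simp_all add: orthogonal_circle_def)
  define a where "a = ((dist x y)\<^sup>2 + r1\<^sup>2 - r2\<^sup>2) / (2 * dist x y)"
  define d where "d = (c - x) \<bullet> n"
  define d' where "d' = (c' - x) \<bullet> m"
  have ce: "(c - x) \<bullet> e = a" "(c' - x) \<bullet> e = a"
    using circle_inner[OF R(2,3)] circle_inner[OF R'(2,3)] pos unfolding f(1) a_def
    by (simp_all add: field_simps)
  have ar: "r1\<^sup>2 < a\<^sup>2" unfolding a_def using foot_gt_radius[OF r] r(1) by (intro power_strict_mono) auto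
  define h where "h = a\<^sup>2 - r1\<^sup>2"
  have h: "h > 0" using ar by (simp add: h_def)
  have cd: "c - x = a *\<^sub>R e + d *\<^sub>R n" "c' - x = a *\<^sub>R e - d' *\<^sub>R n"
    using plane_expand[OF f(2-4), of "c - x"] plane_expand[OF f(2-4), of "c' - x"] ce
    by (simp_all add: d_def d'_def m)
  have "(dist c x)\<^sup>2 = a\<^sup>2 + d\<^sup>2"
    using plane_norm_sq[OF f(2-4), of "c - x"] ce dist_sq_inner[of x c] by (simp add: dist_commute d_def)
  then have Rd: "R\<^sup>2 = d\<^sup>2 + h" using R by (simp add: h_def)
  have "(dist c' x)\<^sup>2 = a\<^sup>2 + d'\<^sup>2"
    using plane_norm_sq[OF f(2-4), of "c' - x"] ce dist_sq_inner[of x c'] by (simp add: dist_commute d'_def m)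
  then have Rd': "R'\<^sup>2 = d'\<^sup>2 + h" using R' by (simp add: h_def)
  have bound: "-1 \<le> u / S \<and> u / S \<le> 1" if "S\<^sup>2 = u\<^sup>2 + h" "0 < S" for u S
  proof -
    have "\<bar>u\<bar> \<le> S" using abs_le_square_iff[of u S] that h by simp
    then show ?thesis using that by (auto simp: field_simps)
  qed
  have "- (d' / R') \<le> d / R"
  proof -
    have "arccos (d / R) \<le> pi - arccos (d' / R')" using le f(5) f'(5) by (simp add: d_def d'_def)
    also have "\<dots> = arccos (- (d' / R'))" using bound[OF Rd' R'(1)] by (simp add: arccos_minus)
    finally show ?thesis
      using bound[OF Rd R(1)] bound[OF Rd' R'(1)] by (subst (asm) arccos_le_mono) (auto simp: abs_le_iff)
  qed
  then have "(- d') * R \<le> d * R'" using R(1) R'(1) by (simp add: field_simps)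
  \<comment> \<open>Monotonicity of u / sqrt (u^2 + h) with cleared denominators; S and T stand for
    the roots.\<close>
  moreover have mono: "p < u \<Longrightarrow> p * S < u * T" if "S\<^sup>2 = u\<^sup>2 + h" "T\<^sup>2 = p\<^sup>2 + h" "0 < S" "0 < T" for p u S T
  proof -
    assume "p < u"
    have pos_case: "p * S < u * T" if "0 \<le> p" "p < u" "S\<^sup>2 = u\<^sup>2 + h" "T\<^sup>2 = p\<^sup>2 + h" "0 < S" "0 < T" for p u S T
    proof -
      have "p\<^sup>2 < u\<^sup>2" using that by (intro power_strict_mono) auto
      then have "p\<^sup>2 * h < u\<^sup>2 * h" using h by simp
      then have "(p * S)\<^sup>2 < (u * T)\<^sup>2" unfolding power_mult_distrib that by (simp add: algebra_simps)
      then show ?thesis using that by (intro power2_less_imp_less[of "p * S"]) auto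
    qed
    consider "0 \<le> p" | "p < 0" "0 \<le> u" | "u < 0" by linarith
    then show ?thesis
    proof cases
      case 1
      then show ?thesis using pos_case[of p u S T] that \<open>p < u\<close> by simp
    next
      case 2
      then have "p * S < 0" "0 \<le> u * T" using that by (auto simp: mult_neg_pos)
      then show ?thesis by simp
    next
      case 3
      then show ?thesis using pos_case[of "- u" "- p" T S] that \<open>p < u\<close> by simp
    qed
  qed
  ultimately have dd: "0 \<le> d + d'"
    using mono[of R d R' "- d'"] Rd Rd' R(1) R'(1)
      mono[of R' "- d'" R d] by (smt (verit) power2_minus)
  have dist_q: "(dist w q)\<^sup>2 = (dist w x)\<^sup>2 + (dist q x)\<^sup>2 - 2 * ((w - x) \<bullet> (q - x))" for w
    by (simp add: dist_sq_inner inner_diff_left inner_diff_right inner_commute)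
  have "(dist c q)\<^sup>2 = R\<^sup>2 + r4\<^sup>2 - 2 * ((d + d') * ((q - x) \<bullet> n))"
    using dist_q[of c] dist_q[of c'] R(2) R'(2,4) unfolding cd
    by (simp add: inner_add_left inner_diff_left inner_commute algebra_simps)
  moreover have "(d + d') * ((q - x) \<bullet> n) \<le> 0" using dd qn by (simp add: mult_nonneg_nonpos)
  ultimately show ?thesis by linarith
qed

section \<open>Asymptotics of the volume\<close>

text \<open>The contribution of one corner to twice the volume of the tetrahedron.\<close>

definition corner_vol :: "real \<Rightarrow> real \<Rightarrow> real \<Rightarrow> real" where
  "corner_vol g a b = lob g + lob ((pi + a + b - g) / 2) + lob ((pi - a - b - g) / 2)
     + lob ((pi + a - b - g) / 2) + lob ((pi - a + b - g) / 2)"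

text \<open>\<open>corner_end\<close> is the coefficient of \<open>- s ln s\<close> in the expansion of \<open>corner_vol\<close> at \<open>s = 0\<close> along
  the direction \<open>(z, x, y)\<close>, and \<open>corner_slope\<close> is the coefficient of \<open>s\<close>.\<close>

definition corner_end :: "real \<Rightarrow> real \<Rightarrow> real \<Rightarrow> real \<Rightarrow> real \<Rightarrow> real \<Rightarrow> real" where
  "corner_end g a b z x y = at_end g * z
     + at_end ((pi + a + b - g) / 2) * ((x + y - z) / 2) + at_end ((pi - a - b - g) / 2) * ((- x - y - z) / 2)
     + at_end ((pi + a - b - g) / 2) * ((x - y - z) / 2) + at_end ((pi - a + b - g) / 2) * ((- x + y - z) / 2)"

definition corner_slope :: "real \<Rightarrow> real \<Rightarrow> real \<Rightarrow> real \<Rightarrow> real \<Rightarrow> real \<Rightarrow> real" where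
  "corner_slope g a b z x y = lob_slope g z
     + lob_slope ((pi + a + b - g) / 2) ((x + y - z) / 2) + lob_slope ((pi - a - b - g) / 2) ((- x - y - z) / 2)
     + lob_slope ((pi + a - b - g) / 2) ((x - y - z) / 2) + lob_slope ((pi - a + b - g) / 2) ((- x + y - z) / 2)"

definition closed_corner :: "real \<Rightarrow> real \<Rightarrow> real \<Rightarrow> bool" where
  "closed_corner g a b \<longleftrightarrow> 0 \<le> g \<and> 0 \<le> a \<and> 0 \<le> b \<and> g + a + b \<le> pi"

lemma closed_corner_arguments:
  assumes "closed_corner g a b"
  shows "0 \<le> g" "g \<le> pi" "0 \<le> (pi + a + b - g) / 2" "(pi + a + b - g) / 2 \<le> pi"
    "0 \<le> (pi - a - b - g) / 2" "(pi - a - b - g) / 2 \<le> pi"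
    "0 \<le> (pi + a - b - g) / 2" "(pi + a - b - g) / 2 \<le> pi"
    "0 \<le> (pi - a + b - g) / 2" "(pi - a + b - g) / 2 \<le> pi"
  using assms by (simp_all add: closed_corner_def)

lemma continuous_corner_vol:
  fixes G A B :: "'a::topological_space \<Rightarrow> real"
  assumes "continuous_on S G" "continuous_on S A" "continuous_on S B"
    and "\<And>x. x \<in> S \<Longrightarrow> closed_corner (G x) (A x) (B x)"
  shows "continuous_on S (\<lambda>x. corner_vol (G x) (A x) (B x))"
  unfolding corner_vol_def
  by (intro continuous_intros continuous_on_compose2[OF continuous_on_lob] assms image_subsetI)
     (use assms(4) in \<open>auto simp: closed_corner_def dest: assms(4)\<close>)

lemma log_slope_corner_vol:
  assumes c: "closed_corner g a b" and c': "closed_corner (g + e * z) (a + e * x) (b + e * y)" and e: "0 < e"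
  shows "log_slope (\<lambda>s. corner_vol (g + s * z) (a + s * x) (b + s * y))
    (corner_end g a b z x y) (corner_slope g a b z x y)"
proof -
  have dir: "(u = 0 \<longrightarrow> 0 \<le> d) \<and> (u = pi \<longrightarrow> d \<le> 0)" if "0 \<le> u + e * d" "u + e * d \<le> pi" for u d
    using that e by (auto simp: zero_le_mult_iff mult_le_0_iff)
  have lob_arg: "log_slope (\<lambda>s. lob (u + s * d)) (at_end u * d) (lob_slope u d)"
    if "0 \<le> u" "u \<le> pi" "0 \<le> u + e * d" "u + e * d \<le> pi" for u d
    using log_slope_lob[of u d] dir[OF that(3,4)] that by blast
  have "log_slope (\<lambda>s. lob (g + s * z) + lob ((pi + a + b - g) / 2 + s * ((x + y - z) / 2))
     + lob ((pi - a - b - g) / 2 + s * ((- x - y - z) / 2))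
     + lob ((pi + a - b - g) / 2 + s * ((x - y - z) / 2)) + lob ((pi - a + b - g) / 2 + s * ((- x + y - z) / 2)))
    (corner_end g a b z x y) (corner_slope g a b z x y)"
    unfolding corner_end_def corner_slope_def
  proof (intro log_slope_add lob_arg)
    have shift: "(pi + a + b - g) / 2 + e * ((x + y - z) / 2) = (pi + (a + e * x) + (b + e * y) - (g + e * z)) / 2"
      "(pi - a - b - g) / 2 + e * ((- x - y - z) / 2) = (pi - (a + e * x) - (b + e * y) - (g + e * z)) / 2"
      "(pi + a - b - g) / 2 + e * ((x - y - z) / 2) = (pi + (a + e * x) - (b + e * y) - (g + e * z)) / 2"
      "(pi - a + b - g) / 2 + e * ((- x + y - z) / 2) = (pi - (a + e * x) + (b + e * y) - (g + e * z)) / 2"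
      by (simp_all add: add_divide_distrib diff_divide_distrib algebra_simps)
    note closed_corner_arguments[OF c'] closed_corner_arguments[OF c]
    then show "0 \<le> (pi + a + b - g) / 2 + e * ((x + y - z) / 2)" "(pi + a + b - g) / 2 + e * ((x + y - z) / 2) \<le> pi"
      "0 \<le> (pi - a - b - g) / 2 + e * ((- x - y - z) / 2)" "(pi - a - b - g) / 2 + e * ((- x - y - z) / 2) \<le> pi"
      "0 \<le> (pi + a - b - g) / 2 + e * ((x - y - z) / 2)" "(pi + a - b - g) / 2 + e * ((x - y - z) / 2) \<le> pi"
      "0 \<le> (pi - a + b - g) / 2 + e * ((- x + y - z) / 2)" "(pi - a + b - g) / 2 + e * ((- x + y - z) / 2) \<le> pi"
      unfolding shift by auto
  qed (use closed_corner_arguments[OF c'] closed_corner_arguments[OF c] in auto)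
  also have "(\<lambda>s. lob (g + s * z) + lob ((pi + a + b - g) / 2 + s * ((x + y - z) / 2))
     + lob ((pi - a - b - g) / 2 + s * ((- x - y - z) / 2))
     + lob ((pi + a - b - g) / 2 + s * ((x - y - z) / 2)) + lob ((pi - a + b - g) / 2 + s * ((- x + y - z) / 2)))
     = (\<lambda>s. corner_vol (g + s * z) (a + s * x) (b + s * y))"
    by (rule ext) (simp add: corner_vol_def add_divide_distrib diff_divide_distrib algebra_simps)
  finally show ?thesis .
qed

lemma at_end_arguments:
  assumes c: "closed_corner g a b"
  shows "at_end ((pi + a + b - g) / 2) = (if g = pi \<or> (g = 0 \<and> a + b = pi) then 1 else 0)"
    "at_end ((pi - a - b - g) / 2) = (if g + a + b = pi then 1 else 0)"
    "at_end ((pi + a - b - g) / 2) = (if (a = 0 \<and> b + g = pi) \<or> a = pi then 1 else 0)"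
    "at_end ((pi - a + b - g) / 2) = (if (b = 0 \<and> a + g = pi) \<or> b = pi then 1 else 0)"
proof -
  note c = c[unfolded closed_corner_def]
  have half: "u / 2 = 0 \<longleftrightarrow> u = 0" "u / 2 = pi \<longleftrightarrow> u = 2 * pi" for u :: real by auto
  have "(pi + a + b - g) / 2 = 0 \<or> (pi + a + b - g) / 2 = pi \<longleftrightarrow> g = pi \<or> (g = 0 \<and> a + b = pi)"
    unfolding half using c pi_gt_zero by argo
  then show "at_end ((pi + a + b - g) / 2) = (if g = pi \<or> (g = 0 \<and> a + b = pi) then 1 else 0)"
    by (simp only: at_end_def)
  have "(pi - a - b - g) / 2 = 0 \<or> (pi - a - b - g) / 2 = pi \<longleftrightarrow> g + a + b = pi"
    unfolding half using c pi_gt_zero by argo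
  then show "at_end ((pi - a - b - g) / 2) = (if g + a + b = pi then 1 else 0)"
    by (simp only: at_end_def)
  have "(pi + a - b - g) / 2 = 0 \<or> (pi + a - b - g) / 2 = pi \<longleftrightarrow> (a = 0 \<and> b + g = pi) \<or> a = pi"
    unfolding half using c pi_gt_zero by argo
  then show "at_end ((pi + a - b - g) / 2) = (if (a = 0 \<and> b + g = pi) \<or> a = pi then 1 else 0)"
    by (simp only: at_end_def)
  have "(pi - a + b - g) / 2 = 0 \<or> (pi - a + b - g) / 2 = pi \<longleftrightarrow> (b = 0 \<and> a + g = pi) \<or> b = pi"
    unfolding half using c pi_gt_zero by argo
  then show "at_end ((pi - a + b - g) / 2) = (if (b = 0 \<and> a + g = pi) \<or> b = pi then 1 else 0)"
    by (simp only: at_end_def)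
qed

lemma corner_end_eq:
  assumes c: "closed_corner g a b"
  shows "corner_end g a b z x y = (if g = 0 \<or> g = pi then z else 0)
    + (if g = pi \<or> (g = 0 \<and> a + b = pi) then (x + y - z) / 2 else 0)
    - (if g + a + b = pi then (x + y + z) / 2 else 0)
    + (if (a = 0 \<and> b + g = pi) \<or> a = pi then (x - y - z) / 2 else 0)
    + (if (b = 0 \<and> a + g = pi) \<or> b = pi then (y - x - z) / 2 else 0)"
  unfolding corner_end_def at_end_arguments[OF c] at_end_def[of g] by (simp add: field_simps)

lemma corner_end_hyperideal: "hyperideal_corner g a b \<Longrightarrow> corner_end g a b z x y = 0"
  by (subst corner_end_eq) (auto simp: hyperideal_corner_def closed_corner_def)

text \<open>Added over the corners of a collapsed triangle, these coefficients give minus the change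
  of the angle sum.\<close>

lemma corner_end_collapsed:
  assumes "closed_corner g a b" "a = pi \<or> b = pi \<or> g = pi"
  shows "corner_end g a b z x y = - z"
proof -
  have "(g = 0 \<and> a = pi \<and> b = 0) \<or> (g = 0 \<and> a = 0 \<and> b = pi) \<or> (g = pi \<and> a = 0 \<and> b = 0)"
    using assms by (auto simp: closed_corner_def)
  then show ?thesis unfolding corner_end_eq[OF assms(1)] by (auto simp: field_simps)
qed

text \<open>The direction leads to a corner with strict inequalities. On each boundary face the
  coefficient is a positive combination of the rates at which the attained inequalities are relaxed.
  The exception is the flat corner g = 0, a + b = pi, where everything cancels.\<close>

lemma corner_end_inward:
  assumes c: "closed_corner g a b" and "a \<noteq> pi" "b \<noteq> pi"
    and q: "0 < g + z" "0 < a + x" "0 < b + y" "g + z + a + x + b + y < pi"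
  shows "0 \<le> corner_end g a b z x y"
    and "corner_end g a b z x y = 0 \<Longrightarrow> hyperideal_corner g a b \<or> (g = 0 \<and> a + b = pi)"
proof -
  note c' = c[unfolded closed_corner_def]
  consider (1) "hyperideal_corner g a b" | (2) "g = 0" "a + b < pi" | (3) "g = 0" "a + b = pi"
    | (4) "g > 0" "g + a + b = pi" "a > 0" "b > 0" | (5) "0 < g" "g < pi" "g + a + b = pi" "a = 0"
    | (6) "0 < g" "g < pi" "g + a + b = pi" "b = 0" "a > 0" | (7) "g = pi"
    using c' unfolding hyperideal_corner_def by argo
  then have "0 \<le> corner_end g a b z x y \<and>
    (corner_end g a b z x y = 0 \<longrightarrow> hyperideal_corner g a b \<or> (g = 0 \<and> a + b = pi))"
  proof cases
    case 1
    then show ?thesis using corner_end_hyperideal by simp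
  next
    case 2
    then have "corner_end g a b z x y = z" using c' assms(2,3) unfolding corner_end_eq[OF c] by auto
    then show ?thesis using q 2 by simp
  next
    case 3
    then have "corner_end g a b z x y = 0" using c' assms(2,3) unfolding corner_end_eq[OF c]
      by (auto simp: field_simps)
    then show ?thesis using 3 by simp
  next
    case 4
    then have "corner_end g a b z x y = - (x + y + z) / 2" using c' assms(2,3) unfolding corner_end_eq[OF c]
      by (auto simp: minus_divide_left)
    then show ?thesis using q 4 by simp
  next
    case 5
    then have "corner_end g a b z x y = - y - z" using c' assms(2,3) unfolding corner_end_eq[OF c]
      by (auto simp: field_simps)
    then show ?thesis using q 5 by simp
  next
    case 6
    then have "corner_end g a b z x y = - x - z" using c' assms(2,3) unfolding corner_end_eq[OF c]
      by (auto simp: field_simps)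
    then show ?thesis using q 6 by simp
  next
    case 7
    then have "corner_end g a b z x y = - z" using corner_end_collapsed[OF c] by simp
    then show ?thesis using q 7 c' by simp
  qed
  then show "0 \<le> corner_end g a b z x y"
    "corner_end g a b z x y = 0 \<Longrightarrow> hyperideal_corner g a b \<or> (g = 0 \<and> a + b = pi)" by auto
qed

text \<open>The radius times \<open>exp (half_len g a b)\<close> is the foot plus sin a, a product
  of two sines over sin g. The logarithms that result are the ones in the derivative of
  \<open>corner_vol\<close> with respect to a.\<close>

lemma half_len_ln:
  assumes c: "hyperideal_corner g a b"
  shows "half_len g a b = (ln (2 * sin ((pi + a + b - g) / 2)) + ln (2 * sin ((pi + a - b - g) / 2))
    - ln (2 * sin ((pi - a - b - g) / 2)) - ln (2 * sin ((pi - a + b - g) / 2))) / 2"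
proof -
  let ?p = "sin ((pi + a + b - g) / 2)" and ?q = "sin ((pi - a - b - g) / 2)"
    and ?r = "sin ((pi + a - b - g) / 2)" and ?s = "sin ((pi - a + b - g) / 2)"
  note arg = corner_arguments[OF c]
  have pos: "0 < ?p" "0 < ?q" "0 < ?r" "0 < ?s" using arg by (auto intro!: sin_gt_zero)
  note sg = corner_sin_pos(1)[OF c]
  have half: "sin ((pi + u) / 2) = cos (u / 2)" for u :: real
    by (simp add: sin_add add_divide_distrib)
  have "2 * (?p * ?r) = cos (a - g) + cos b"
    using half[of "a + b - g"] half[of "a - b - g"] cos_plus_cos[of "a - g" b] by (simp add: algebra_simps)
  then have "corner_foot g a b + sin a = 2 * (?p * ?r) / sin g"
    unfolding cos_diff corner_foot_def using sg by (simp add: field_simps)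
  moreover have rad: "corner_rad g a b = 2 * sqrt (?p * ?q * ?r * ?s) / sin g"
    unfolding corner_rad_def corner_disc_eq_prod by (simp add: real_sqrt_mult mult.assoc)
  moreover have "corner_rad g a b * exp (half_len g a b) = corner_foot g a b + sin a"
    using corner_foot_cosh[OF c] corner_rad_sinh[OF c] cosh_plus_sinh[of "half_len g a b"]
    by (metis distrib_left)
  ultimately have "2 * sqrt (?p * ?q * ?r * ?s) / sin g * exp (half_len g a b) = 2 * (?p * ?r) / sin g" by simp
  then have "sqrt (?p * ?q * ?r * ?s) * exp (half_len g a b) = ?p * ?r" using sg by (simp add: field_simps)
  then have "ln (sqrt (?p * ?q * ?r * ?s) * exp (half_len g a b)) = ln (?p * ?r)" by simp
  then have "(ln ?p + ln ?q + ln ?r + ln ?s) / 2 + half_len g a b = ln ?p + ln ?r"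
    using pos by (simp add: ln_mult ln_sqrt)
  then show ?thesis using pos by (simp add: ln_mult field_simps)
qed

lemma corner_rad_ln:
  assumes c: "hyperideal_corner g a b"
  shows "ln (corner_rad g a b) = (ln (2 * sin ((pi + a + b - g) / 2)) + ln (2 * sin ((pi + a - b - g) / 2))
    + ln (2 * sin ((pi - a - b - g) / 2)) + ln (2 * sin ((pi - a + b - g) / 2))) / 2 - ln (2 * sin g)"
proof -
  let ?p = "sin ((pi + a + b - g) / 2)" and ?q = "sin ((pi - a - b - g) / 2)"
    and ?r = "sin ((pi + a - b - g) / 2)" and ?s = "sin ((pi - a + b - g) / 2)"
  have pos: "0 < ?p" "0 < ?q" "0 < ?r" "0 < ?s" using corner_arguments[OF c] by (auto intro!: sin_gt_zero)
  note sg = corner_sin_pos(1)[OF c]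
  have rad: "corner_rad g a b = 2 * sqrt (?p * ?q * ?r * ?s) / sin g"
    unfolding corner_rad_def corner_disc_eq_prod by (simp add: real_sqrt_mult mult.assoc)
  show ?thesis unfolding rad using pos sg by (simp add: ln_mult ln_div ln_sqrt field_simps)
qed

text \<open>The gradient of \<open>corner_vol\<close>, a formula of Schlaefli type. It explains the
  choice of arguments in \<open>corner_vol\<close>.\<close>

lemma corner_slope_hyperideal:
  assumes c: "hyperideal_corner g a b"
  shows "corner_slope g a b z x y = ln (corner_rad g a b) * z - half_len g a b * x - half_len g b a * y"
proof -
  note arg = corner_arguments[OF c]
  have g: "0 < g" "g < pi" using c by (auto simp: hyperideal_corner_def)
  have slope: "lob_slope u d = - (d * ln (2 * sin u))" if "0 < u" "u < pi" for u d
    using that by (simp add: lob_slope_def)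
  have swap: "pi + b + a - g = pi + a + b - g" "pi + b - a - g = pi - a + b - g"
    "pi - b - a - g = pi - a - b - g" "pi - b + a - g = pi + a - b - g" by auto
  show ?thesis
    unfolding corner_slope_def corner_rad_ln[OF c] half_len_ln[OF c]
      half_len_ln[OF hyperideal_corner_commute[THEN iffD1, OF c]] swap
      slope[OF g] slope[OF arg(1,2)] slope[OF arg(3,4)] slope[OF arg(5,6)] slope[OF arg(7,8)]
    by (simp add: field_simps)
qed

lemma half_len_0: "half_len g 0 b = 0"
  by (simp add: half_len_def)

lemma half_len_pos: "hyperideal_corner g a b \<Longrightarrow> 0 < a \<Longrightarrow> 0 < half_len g a b"
  using corner_rad_pos[of g a b] by (auto simp: half_len_def hyperideal_corner_def sin_gt_zero)

text \<open>The coefficient of \<open>- k ln k\<close> in the slope along the direction \<open>(z0, x0, y0) + k (z, x, y)\<close>.\<close>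

definition corner_end2 :: "real \<Rightarrow> real \<Rightarrow> real \<Rightarrow> real \<Rightarrow> real \<Rightarrow> real \<Rightarrow> real \<Rightarrow> real \<Rightarrow> real \<Rightarrow> real" where
  "corner_end2 g a b z0 x0 y0 z x y = (if z0 = 0 then at_end g * z else 0)
     + (if (x0 + y0 - z0) / 2 = 0 then at_end ((pi + a + b - g) / 2) * ((x + y - z) / 2) else 0)
     + (if (- x0 - y0 - z0) / 2 = 0 then at_end ((pi - a - b - g) / 2) * ((- x - y - z) / 2) else 0)
     + (if (x0 - y0 - z0) / 2 = 0 then at_end ((pi + a - b - g) / 2) * ((x - y - z) / 2) else 0)
     + (if (- x0 + y0 - z0) / 2 = 0 then at_end ((pi - a + b - g) / 2) * ((- x + y - z) / 2) else 0)"

text \<open>The logarithmic coefficient will be positive where this is applied and then decides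
  alone, so the linear one is left existential.\<close>

lemma log_slope_corner_slope:
  "\<exists>d. log_slope (\<lambda>k. corner_slope g a b (z0 + k * z) (x0 + k * x) (y0 + k * y))
     (corner_end2 g a b z0 x0 y0 z x y) d"
proof -
  let ?D = "\<lambda>u c d. if c = 0 \<or> (u \<noteq> 0 \<and> u \<noteq> pi) then lob_slope u d else - (d * ln (2 * \<bar>c\<bar>))"
  have "log_slope (\<lambda>k. lob_slope g (z0 + k * z)
     + lob_slope ((pi + a + b - g) / 2) ((x0 + y0 - z0) / 2 + k * ((x + y - z) / 2))
     + lob_slope ((pi - a - b - g) / 2) ((- x0 - y0 - z0) / 2 + k * ((- x - y - z) / 2))
     + lob_slope ((pi + a - b - g) / 2) ((x0 - y0 - z0) / 2 + k * ((x - y - z) / 2))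
     + lob_slope ((pi - a + b - g) / 2) ((- x0 + y0 - z0) / 2 + k * ((- x + y - z) / 2)))
    (corner_end2 g a b z0 x0 y0 z x y)
    (?D g z0 z + ?D ((pi + a + b - g) / 2) ((x0 + y0 - z0) / 2) ((x + y - z) / 2)
     + ?D ((pi - a - b - g) / 2) ((- x0 - y0 - z0) / 2) ((- x - y - z) / 2)
     + ?D ((pi + a - b - g) / 2) ((x0 - y0 - z0) / 2) ((x - y - z) / 2)
     + ?D ((pi - a + b - g) / 2) ((- x0 + y0 - z0) / 2) ((- x + y - z) / 2))"
    unfolding corner_end2_def by (intro log_slope_add log_slope_lob_slope)
  also have "(\<lambda>k. lob_slope g (z0 + k * z)
     + lob_slope ((pi + a + b - g) / 2) ((x0 + y0 - z0) / 2 + k * ((x + y - z) / 2))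
     + lob_slope ((pi - a - b - g) / 2) ((- x0 - y0 - z0) / 2 + k * ((- x - y - z) / 2))
     + lob_slope ((pi + a - b - g) / 2) ((x0 - y0 - z0) / 2 + k * ((x - y - z) / 2))
     + lob_slope ((pi - a + b - g) / 2) ((- x0 + y0 - z0) / 2 + k * ((- x + y - z) / 2)))
    = (\<lambda>k. corner_slope g a b (z0 + k * z) (x0 + k * x) (y0 + k * y))"
    by (rule ext) (simp add: corner_slope_def add_divide_distrib diff_divide_distrib algebra_simps)
  finally show ?thesis by blast
qed

lemma corner_end2_0: "corner_end2 g a b 0 0 0 z x y = corner_end g a b z x y"
  by (simp add: corner_end2_def corner_end_def)

lemma corner_end2_hyperideal:
  "hyperideal_corner g a b \<Longrightarrow> corner_end2 g a b z0 x0 y0 z x y = 0"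
  using corner_arguments[of g a b]
  by (auto simp: corner_end2_def at_end_def hyperideal_corner_def)

lemma corner_slope_zero: "corner_slope g a b 0 0 0 = 0"
  by (simp add: corner_slope_def lob_slope_def)

text \<open>The direction lowers a side angle equal to \<open>pi\<close> at rate 1, seen from the
  corners at the two ends of that side. Four arguments of \<open>lob\<close> leave their ends at
  rates 1/2 and -1/2, and their slopes cancel. The corner angle has rate 0, so it alone yields a
  logarithm at the next stage.\<close>

lemma collapse_direction:
  "corner_end2 0 pi 0 0 (- 1) 0 z x y = z" "corner_end2 0 0 pi 0 0 (- 1) z x y = z"
  "corner_slope 0 pi 0 0 (- 1) 0 = 0" "corner_slope 0 0 pi 0 0 (- 1) = 0"
  by (simp_all add: corner_end2_def corner_slope_def at_end_def lob_slope_def)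

section \<open>Triangles of a triangulated surface\<close>

lemma labels_rotate: "labels X t i j k a b c \<Longrightarrow> labels X t j k i b c a"
  by (auto simp: labels_def)

lemma labels_reflect: "labels X t i j k a b c \<Longrightarrow> labels X t j i k a c b"
  by (auto simp: labels_def)

context
  fixes X :: "('v, 'e, 't) cells"
  assumes surface: "surface_triangulation X"
begin

lemma surface_finite: "finite (vertices X)" "finite (edges X)" "finite (triangles X)"
  using surface by (auto simp: surface_triangulation_def)

lemma sides_edges: "t \<in> triangles X \<Longrightarrow> sides X t \<subseteq> edges X"
  using surface by (auto simp: surface_triangulation_def)

lemma labels_distinct:
  assumes "t \<in> triangles X" "labels X t i j k a b c"
  shows "i \<noteq> j" "j \<noteq> k" "k \<noteq> i" "a \<noteq> b" "b \<noteq> c" "c \<noteq> a"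
proof -
  have "card {i, j, k} = 3" "card {a, b, c} = 3"
    using assms surface by (auto simp: labels_def surface_triangulation_def)
  then show "i \<noteq> j" "j \<noteq> k" "k \<noteq> i" "a \<noteq> b" "b \<noteq> c" "c \<noteq> a"
    by (auto simp: card_insert_if split: if_splits)
qed

lemma labels_exist:
  assumes t: "t \<in> triangles X" and e: "e \<in> sides X t"
  obtains i j k b c where "labels X t i j k e b c"
proof -
  have s3: "card (sides X t) = 3" and c3: "card (corners X t) = 3" and inj: "inj_on (ends X) (sides X t)"
    using surface t by (auto simp: surface_triangulation_def)
  have fin: "finite (sides X t)" using s3 by (intro card_ge_0_finite) simp
  have "card (sides X t - {e}) = 2" using e s3 fin by simp
  then obtain b c where bc: "sides X t - {e} = {b, c}" "b \<noteq> c" by (auto simp: card_2_iff)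
  have sides: "sides X t = {e, b, c}" "e \<noteq> b" "e \<noteq> c" using bc e by auto
  have ends2: "card (ends X f) = 2" if "f \<in> {e, b, c}" for f
    using surface t that sides by (auto simp: surface_triangulation_def)
  obtain i j where ij: "ends X e = {i, j}" "i \<noteq> j" using ends2[of e] by (auto simp: card_2_iff)
  have sub: "ends X f \<subseteq> corners X t" if "f \<in> {e, b, c}" for f
    using that sides by (auto simp: corners_def)
  have finc: "finite (corners X t)" using c3 by (intro card_ge_0_finite) simp
  have "card (corners X t - {i, j}) = 1"
    using c3 sub[of e] ij finc by (subst card_Diff_subset) auto
  then obtain k where "corners X t - {i, j} = {k}" by (auto simp: card_1_singleton_iff)
  then have cor: "corners X t = {i, j, k}" "k \<noteq> i" "k \<noteq> j" using sub[of e] ij by auto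
  have opt: "ends X f = {j, k} \<or> ends X f = {k, i}" if f: "f \<in> {b, c}" for f
  proof -
    obtain p q where pq: "ends X f = {p, q}" "p \<noteq> q" using ends2[of f] f by (auto simp: card_2_iff)
    have "ends X f \<noteq> {i, j}"
      using inj_onD[OF inj, of f e] f sides ij by auto
    then show ?thesis using sub[of f] f pq cor by auto
  qed
  have "ends X b \<noteq> ends X c" using inj_onD[OF inj, of b c] sides bc(2) by auto
  then consider "ends X b = {j, k}" "ends X c = {k, i}" | "ends X b = {k, i}" "ends X c = {j, k}"
    using opt[of b] opt[of c] by auto
  then show ?thesis
  proof cases
    case 1
    then have "labels X t i j k e b c" using cor sides ij by (simp add: labels_def)
    then show ?thesis using that by blast
  next
    case 2
    then have "labels X t i j k e c b" using cor sides ij by (auto simp: labels_def)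
    then show ?thesis using that by blast
  qed
qed

lemma labels_exist_corner:
  assumes t: "t \<in> triangles X" and i: "i \<in> corners X t"
  obtains j k a b c where "labels X t i j k a b c"
proof -
  obtain e where "e \<in> sides X t" "i \<in> ends X e" using i by (auto simp: corners_def)
  then obtain p q k b c where l: "labels X t p q k e b c" using labels_exist[OF t] by metis
  then have "i = p \<or> i = q" using \<open>i \<in> ends X e\<close> by (auto simp: labels_def)
  then show ?thesis using that l labels_reflect[OF l] by blast
qed

lemma labels_exist_any:
  assumes "t \<in> triangles X"
  obtains i j k a b c where "labels X t i j k a b c"
proof -
  have "card (sides X t) = 3" using assms surface by (auto simp: surface_triangulation_def)
  then obtain e where "e \<in> sides X t" by fastforce
  then show ?thesis using labels_exist[OF assms] that by metis
qed

text \<open>Once the first corner is fixed only a reflection remains, because the corners determine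
  the sides by injectivity of \<open>ends X\<close> on a triangle.\<close>

lemma labels_unique:
  assumes t: "t \<in> triangles X" and l: "labels X t i j k a b c" and l': "labels X t i j' k' a' b' c'"
  shows "(j' = j \<and> k' = k \<and> a' = a \<and> b' = b \<and> c' = c) \<or> (j' = k \<and> k' = j \<and> a' = c \<and> b' = b \<and> c' = a)"
proof -
  note d = labels_distinct[OF t l] and d' = labels_distinct[OF t l']
  have jk: "{j', k'} = {j, k}" using l l' d d' by (auto simp: labels_def)
  have "inj_on (ends X) (sides X t)" using surface t by (auto simp: surface_triangulation_def)
  then have inj: "inj_on (ends X) {a, b, c}" using l by (simp add: labels_def)
  have mem: "a' \<in> {a, b, c}" "b' \<in> {a, b, c}" "c' \<in> {a, b, c}" using l l' by (auto simp: labels_def)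
  have ends: "ends X a = {i, j}" "ends X b = {j, k}" "ends X c = {k, i}"
    "ends X a' = {i, j'}" "ends X b' = {j', k'}" "ends X c' = {k', i}" using l l' by (auto simp: labels_def)
  have eq: "f = f'" if "f \<in> {a, b, c}" "f' \<in> {a, b, c}" "ends X f = ends X f'" for f f'
    using inj_onD[OF inj] that by blast
  from jk consider "j' = j" "k' = k" | "j' = k" "k' = j" by (auto simp: doubleton_eq_iff)
  then show ?thesis
  proof cases
    case 1
    then show ?thesis using eq[of a' a] eq[of b' b] eq[of c' c] ends mem by auto
  next
    case 2
    then show ?thesis using eq[of a' c] eq[of b' b] eq[of c' a] ends mem by (auto simp: insert_commute)
  qed
qed

lemma opposite_corner_eq:
  assumes "t \<in> triangles X" "labels X t i j k a b c"
  shows "opposite_corner X t a = k"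
proof -
  have "corners X t - ends X a = {k}" using assms labels_distinct[OF assms] by (auto simp: labels_def)
  then show ?thesis by (simp add: opposite_corner_def)
qed

lemma is_layout_iff:
  assumes "t \<in> triangles X" "labels X t i j k a b c"
  shows "is_layout X l t p \<longleftrightarrow> dist (p i) (p j) = l a \<and> dist (p j) (p k) = l b \<and> dist (p k) (p i) = l c"
  using assms(2) labels_distinct[OF assms]
  by (auto simp: is_layout_def labels_def doubleton_eq_iff dist_commute)

lemma layout_exists:
  assumes t: "t \<in> triangles X" and l: "labels X t i j k a b c" and tri: "triangle_ineqs (l b) (l c) (l a)"
  shows "is_layout X l t (layout X l t)"
proof -
  note pos = triangle_ineqs_pos[OF tri] and d = labels_distinct[OF t l]
  define g where "g = opp_angle (l b) (l c) (l a)"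
  define q :: "real^2" where "q = (\<chi> n. if n = 1 then l c * cos g else l c * sin g)"
  define s :: "real^2" where "s = (\<chi> n. if n = 1 then l a else 0)"
  define p where "p = (\<lambda>v. if v = i then 0 else if v = j then s else q)"
  have p: "p i = 0" "p j = s" "p k = q" using d by (auto simp: p_def)
  have sq: "(norm v)\<^sup>2 = (v $ 1)\<^sup>2 + (v $ 2)\<^sup>2" for v :: "real^2"
    unfolding power2_norm_eq_inner inner_vec_def sum_2 by (simp add: power2_eq_square)
  have ns: "norm s = l a"
    using sq[of s] pos by (simp add: s_def power2_eq_iff_nonneg)
  have "(norm q)\<^sup>2 = (l c * cos g)\<^sup>2 + (l c * sin g)\<^sup>2" unfolding sq by (simp add: q_def)
  also have "\<dots> = (l c)\<^sup>2 * ((cos g)\<^sup>2 + (sin g)\<^sup>2)" by (simp only: power_mult_distrib distrib_left)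
  also have "\<dots> = (l c)\<^sup>2" by simp
  finally have lq: "(norm q)\<^sup>2 = (l c)\<^sup>2" .
  then have nq: "norm q = l c" using pos by (simp add: power2_eq_iff_nonneg)
  have cosg: "2 * l c * l a * cos g = (l c)\<^sup>2 + (l a)\<^sup>2 - (l b)\<^sup>2"
    unfolding g_def opp_angle_facts(1)[OF tri] using pos by simp
  have "(norm (s - q))\<^sup>2 = (l a - l c * cos g)\<^sup>2 + (l c * sin g)\<^sup>2"
    unfolding sq by (simp add: q_def s_def)
  also have "\<dots> = (l a)\<^sup>2 + ((l c * cos g)\<^sup>2 + (l c * sin g)\<^sup>2) - 2 * l c * l a * cos g"
    by (simp add: power2_eq_square algebra_simps)
  also have "\<dots> = (l a)\<^sup>2 + (l c)\<^sup>2 - 2 * l c * l a * cos g" using lq unfolding sq by (simp add: q_def)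
  also have "\<dots> = (l b)\<^sup>2" unfolding cosg by simp
  finally have "norm (s - q) = l b" using pos by (simp add: power2_eq_iff_nonneg)
  then have "is_layout X l t p"
    unfolding is_layout_iff[OF t l] p using ns nq by (simp add: dist_norm)
  then show ?thesis unfolding layout_def by (rule someI[where P = "is_layout X l t"])
qed

lemma corner_angle_eq:
  assumes t: "t \<in> triangles X" and l: "labels X t i j k a b c" and tri: "triangle_ineqs (l b) (l c) (l a)"
  shows "corner_angle X l t i = opp_angle (l b) (l c) (l a)"
proof -
  let ?p = "layout X l t"
  note d = labels_distinct[OF t l] and pos = triangle_ineqs_pos[OF tri]
  have lay: "dist (?p i) (?p j) = l a" "dist (?p j) (?p k) = l b" "dist (?p k) (?p i) = l c"
    using layout_exists[where l = l, OF t l tri] is_layout_iff[OF t l] by auto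
  have ne: "?p i \<noteq> ?p j" "?p i \<noteq> ?p k" using lay pos by auto
  have ang: "vec_angle (?p j - ?p i) (?p k - ?p i) = opp_angle (l b) (l c) (l a)"
    using vec_angle_opp_angle[OF ne] lay by simp
  have sym: "vec_angle u v = vec_angle v u" for u v :: "real^2"
    by (simp add: vec_angle_def inner_commute mult.commute)
  have cor: "corners X t = {i, j, k}" using l by (simp add: labels_def)
  have "(\<exists>j' k'. corners X t = {i, j', k'} \<and> x = vec_angle (?p j' - ?p i) (?p k' - ?p i)) \<longleftrightarrow>
      x = opp_angle (l b) (l c) (l a)" for x
  proof
    assume "\<exists>j' k'. corners X t = {i, j', k'} \<and> x = vec_angle (?p j' - ?p i) (?p k' - ?p i)"
    then obtain j' k' where jk: "corners X t = {i, j', k'}" "x = vec_angle (?p j' - ?p i) (?p k' - ?p i)"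
      by blast
    have "j \<in> {i, j', k'}" "k \<in> {i, j', k'}"
      unfolding jk(1)[symmetric] cor by simp_all
    then have "(j' = j \<and> k' = k) \<or> (j' = k \<and> k' = j)" using d by blast
    then show "x = opp_angle (l b) (l c) (l a)" using jk(2) ang sym by auto
  next
    assume "x = opp_angle (l b) (l c) (l a)"
    then show "\<exists>j' k'. corners X t = {i, j', k'} \<and> x = vec_angle (?p j' - ?p i) (?p k' - ?p i)"
      using ang cor by metis
  qed
  then show ?thesis by (simp add: corner_angle_def)
qed

lemma face_circle_eq:
  assumes l: "labels X t i j k a b c"
    and tri: "triangle_ineqs (dist (p j) (p k)) (dist (p k) (p i)) (dist (p i) (p j))"
    and circ: "orthogonal_circle (p i) (p j) (p k) (r i) (r j) (r k) c0 R0"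
  shows "face_circle (corners X t) p r = (c0, R0)"
proof -
  have iff: "is_face_circle (corners X t) p r c R \<longleftrightarrow> orthogonal_circle (p i) (p j) (p k) (r i) (r j) (r k) c R" for c R
    using l by (auto simp: is_face_circle_def orthogonal_circle_def labels_def)
  show ?thesis
    unfolding face_circle_def iff
  proof (rule the_equality)
    show "case (c0, R0) of (x, y) \<Rightarrow> orthogonal_circle (p i) (p j) (p k) (r i) (r j) (r k) x y"
      using circ by simp
    show "x = (c0, R0)" if "case x of (x, y) \<Rightarrow> orthogonal_circle (p i) (p j) (p k) (r i) (r j) (r k) x y" for x
      using orthogonal_circle_unique[OF tri _ circ] that by (cases x) auto
  qed
qed

lemma side_angle_eq:
  assumes t: "t \<in> triangles X" and l: "labels X t i j k a b c" and tri: "triangle_ineqs (l b) (l c) (l a)"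
    and circ: "orthogonal_circle (layout X l t i) (layout X l t j) (layout X l t k) (r i) (r j) (r k) c0 R0"
  shows "side_angle X l r t a =
    arccos (signed_dist (affine hull {layout X l t i, layout X l t j}) (layout X l t k) c0 / R0)"
proof -
  have lay: "dist (layout X l t i) (layout X l t j) = l a" "dist (layout X l t j) (layout X l t k) = l b"
    "dist (layout X l t k) (layout X l t i) = l c"
    using layout_exists[where l = l, OF t l tri] is_layout_iff[OF t l] by auto
  have "face_circle (corners X t) (layout X l t) r = (c0, R0)"
    by (rule face_circle_eq[OF l]) (use tri circ lay in auto)
  moreover have "layout X l t ` ends X a = {layout X l t i, layout X l t j}" using l by (auto simp: labels_def)
  ultimately show ?thesis unfolding side_angle_def by (simp add: Let_def opposite_corner_eq[OF t l])
qed

lemma pattern_triangle_ineqs: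
  assumes "hyperideal_circle_pattern X l r" "t \<in> triangles X" "labels X t i j k a b c"
  shows "triangle_ineqs (l b) (l c) (l a)" "0 < r i" "0 < r j" "0 < r k"
    "r i + r j < l a" "r j + r k < l b" "r k + r i < l c"
proof -
  note h = assms(1)[unfolded hyperideal_circle_pattern_def]
  have e: "a \<in> edges X" "b \<in> edges X" "c \<in> edges X"
    using assms(3) sides_edges[OF assms(2)] by (auto simp: labels_def)
  have "l a < l b + l c \<and> l b < l c + l a \<and> l c < l a + l b" using h assms(2,3) by blast
  then show "triangle_ineqs (l b) (l c) (l a)" by (auto simp: triangle_ineqs_def)
  have "ends X a \<subseteq> vertices X" "ends X b \<subseteq> vertices X" using e surface by (auto simp: surface_triangulation_def)
  then show "0 < r i" "0 < r j" "0 < r k" using h assms(3) by (auto simp: labels_def)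
  show "r i + r j < l a" "r j + r k < l b" "r k + r i < l c" using h e assms(3) by (auto simp: labels_def)
qed

text \<open>Says by formulas alone that t is a decorated triangle with angles \<alpha>, \<gamma> and
  face-circle radius R. It separates plane layouts from the variational argument:
  \<open>pattern_realizes\<close> leads into it, \<open>realizes_triangle\<close> and
  \<open>realizes_circle\<close> lead back.\<close>

definition realizes ::
  "('e \<Rightarrow> real) \<Rightarrow> ('v \<Rightarrow> real) \<Rightarrow> 't \<Rightarrow> real \<Rightarrow> ('e \<Rightarrow> real) \<Rightarrow> ('v \<Rightarrow> real) \<Rightarrow> bool" where
  "realizes l r t R \<alpha> \<gamma> \<longleftrightarrow> R > 0 \<and> (\<forall>i j k a b c. labels X t i j k a b c \<longrightarrow>
     (\<alpha> a, \<alpha> b, \<alpha> c, \<gamma> i, \<gamma> j, \<gamma> k) \<in> Delta \<and> r i = R * corner_rad (\<gamma> i) (\<alpha> a) (\<alpha> c) \<and>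
     l a = R * (corner_foot (\<gamma> i) (\<alpha> a) (\<alpha> c) + corner_foot (\<gamma> j) (\<alpha> a) (\<alpha> b)))"

lemma pattern_realizes:
  assumes h: "hyperideal_circle_pattern X l r" and t: "t \<in> triangles X"
  shows "\<exists>R. realizes l r t R (side_angle X l r t) (corner_angle X l t)"
proof -
  let ?p = "layout X l t"
  obtain i0 j0 k0 a0 b0 c0 where l0: "labels X t i0 j0 k0 a0 b0 c0" using labels_exist_any[OF t] by metis
  note tri0 = pattern_triangle_ineqs[OF h t l0]
  have lay: "is_layout X l t ?p" by (rule layout_exists[where l = l, OF t l0 tri0(1)])
  obtain c R where circ0: "orthogonal_circle (?p i0) (?p j0) (?p k0) (r i0) (r j0) (r k0) c R"
    using orthogonal_circle_exists[of "?p j0" "?p k0" "?p i0" "r i0" "r j0" "r k0"] tri0 lay is_layout_iff[OF t l0]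
    by (metis (no_types, lifting))
  have circ: "orthogonal_circle (?p i) (?p j) (?p k) (r i) (r j) (r k) c R" if "labels X t i j k a b c'" for i j k a b c'
  proof -
    have "i \<in> {i0, j0, k0}" "j \<in> {i0, j0, k0}" "k \<in> {i0, j0, k0}" using that l0 by (auto simp: labels_def)
    then show ?thesis using circ0 by (auto simp: orthogonal_circle_def)
  qed
  have "realizes l r t R (side_angle X l r t) (corner_angle X l t)"
    unfolding realizes_def
  proof (intro conjI allI impI)
    show "R > 0" using circ0 by (simp add: orthogonal_circle_def)
    fix i j k a b c' assume l: "labels X t i j k a b c'"
    note l2 = labels_rotate[OF l]
    note l3 = labels_rotate[OF l2]
    note tri = pattern_triangle_ineqs[OF h t l]
    note tri2 = pattern_triangle_ineqs(1)[OF h t l2] and tri3 = pattern_triangle_ineqs(1)[OF h t l3]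
    have d: "dist (?p i) (?p j) = l a" "dist (?p j) (?p k) = l b" "dist (?p k) (?p i) = l c'"
      using lay is_layout_iff[OF t l] by auto
    note sa = side_angle_eq[where l = l, OF t l tri(1) circ[OF l]] side_angle_eq[where l = l, OF t l2 tri2 circ[OF l2]]
      side_angle_eq[where l = l, OF t l3 tri3 circ[OF l3]]
    note ca = corner_angle_eq[where l = l, OF t l tri(1)] corner_angle_eq[where l = l, OF t l2 tri2]
      corner_angle_eq[where l = l, OF t l3 tri3]
    note res = angles_of_decorated_triangle[OF _ tri(2-4) _ _ _ circ[OF l], unfolded d, OF tri(1) tri(5-7),
      folded sa ca]
    show "(side_angle X l r t a, side_angle X l r t b, side_angle X l r t c', corner_angle X l t i,
        corner_angle X l t j, corner_angle X l t k) \<in> Delta"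
      "r i = R * corner_rad (corner_angle X l t i) (side_angle X l r t a) (side_angle X l r t c')"
      using res by auto
    show "l a = R * (corner_foot (corner_angle X l t i) (side_angle X l r t a) (side_angle X l r t c') +
        corner_foot (corner_angle X l t j) (side_angle X l r t a) (side_angle X l r t b))"
      using res by auto
  qed
  then show ?thesis by blast
qed

lemma realizes_labels:
  assumes "realizes l r t R \<alpha> \<gamma>" "labels X t i j k a b c"
  shows "0 < R" "(\<alpha> a, \<alpha> b, \<alpha> c, \<gamma> i, \<gamma> j, \<gamma> k) \<in> Delta" "r i = R * corner_rad (\<gamma> i) (\<alpha> a) (\<alpha> c)"
    "l a = R * (corner_foot (\<gamma> i) (\<alpha> a) (\<alpha> c) + corner_foot (\<gamma> j) (\<alpha> a) (\<alpha> b))"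
  using assms by (auto simp: realizes_def)

lemma realizes_triangle:
  assumes re: "realizes l r t R \<alpha> \<gamma>" and t: "t \<in> triangles X" and l: "labels X t i j k a b c"
  shows "triangle_ineqs (l b) (l c) (l a)" "r i + r j < l a" "0 < r i"
    "corner_angle X l t i = \<gamma> i"
proof -
  note l2 = labels_rotate[OF l]
  note l3 = labels_rotate[OF l2]
  note 1 = realizes_labels[OF re l] and 2 = realizes_labels[OF re l2] and 3 = realizes_labels[OF re l3]
  note len = lengths_from_angles[OF 1(2,1,4) 2(4) 3(4)]
  show tri: "triangle_ineqs (l b) (l c) (l a)" by (rule len)
  show "r i + r j < l a" using len(3) 1(3) 2(3) by simp
  show "0 < r i" using corner_rad_pos[OF Delta_corners(1)[OF 1(2)]] 1 by simp
  show "corner_angle X l t i = \<gamma> i" using corner_angle_eq[where l = l, OF t l tri] len(2) by simp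
qed

lemma realizes_circle:
  assumes re: "realizes l r t R \<alpha> \<gamma>" and t: "t \<in> triangles X" and l: "labels X t i j k a b c"
    and lay: "is_layout X l t p"
  obtains c0 where "orthogonal_circle (p i) (p j) (p k) (r i) (r j) (r k) c0 R"
    "signed_dist (affine hull {p i, p j}) (p k) c0 = R * cos (\<alpha> a)"
proof -
  note l2 = labels_rotate[OF l]
  note l3 = labels_rotate[OF l2]
  note 1 = realizes_labels[OF re l] and 2 = realizes_labels[OF re l2] and 3 = realizes_labels[OF re l3]
  have d: "dist (p i) (p j) = l a" "dist (p j) (p k) = l b" "dist (p k) (p i) = l c"
    using lay is_layout_iff[OF t l] by auto
  obtain c0 where "orthogonal_circle (p i) (p j) (p k) (R * corner_rad (\<gamma> i) (\<alpha> a) (\<alpha> c))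
      (R * corner_rad (\<gamma> j) (\<alpha> b) (\<alpha> a)) (R * corner_rad (\<gamma> k) (\<alpha> c) (\<alpha> b)) c0 R"
    "signed_dist (affine hull {p i, p j}) (p k) c0 = R * cos (\<alpha> a)"
    using circle_from_angles[OF 1(2,1) d(1)[unfolded 1(4)] d(2)[unfolded 2(4)] d(3)[unfolded 3(4)]] by blast
  then show ?thesis using that 1(3) 2(3) 3(3) by simp
qed

lemma realizes_side_angle:
  assumes re: "realizes l r t R \<alpha> \<gamma>" and t: "t \<in> triangles X" and a: "a \<in> sides X t"
  shows "side_angle X l r t a = \<alpha> a"
proof -
  obtain i j k b c where l: "labels X t i j k a b c" using labels_exist[OF t a] by metis
  note tri = realizes_triangle(1)[OF re t l] and 1 = realizes_labels[OF re l]
  obtain c0 where c0: "orthogonal_circle (layout X l t i) (layout X l t j) (layout X l t k) (r i) (r j) (r k) c0 R"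
    "signed_dist (affine hull {layout X l t i, layout X l t j}) (layout X l t k) c0 = R * cos (\<alpha> a)"
    using realizes_circle[OF re t l layout_exists[where l = l, OF t l tri]] by metis
  have "side_angle X l r t a = arccos (cos (\<alpha> a))"
    using side_angle_eq[where l = l, OF t l tri c0(1)] c0(2) 1(1) by simp
  also have "\<dots> = \<alpha> a" using 1(2) by (intro arccos_cos) (auto simp: Delta_iff)
  finally show ?thesis .
qed

end

lemma corner_end_commute: "corner_end g a b z x y = corner_end g b a z y x"
  and corner_slope_commute: "corner_slope g a b z x y = corner_slope g b a z y x"
  and corner_end2_commute: "corner_end2 g a b u p q z x y = corner_end2 g b a u q p z y x"
proof -
  have swap: "pi + b + a - g = pi + a + b - g" "pi - b - a - g = pi - a - b - g"
    "pi + b - a - g = pi - a + b - g" "pi - b + a - g = pi + a - b - g"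
    for a b g :: real by auto
  have swap2: "y + x - z = x + y - z" "- y - x - z = - x - y - z" "y - x - z = - x + y - z" "- y + x - z = x - y - z"
    for x y z :: real by auto
  show "corner_end g a b z x y = corner_end g b a z y x"
    unfolding corner_end_def swap[of b a] swap2[of y x] by simp
  show "corner_slope g a b z x y = corner_slope g b a z y x"
    unfolding corner_slope_def swap[of b a] swap2[of y x] by simp
  show "corner_end2 g a b u p q z x y = corner_end2 g b a u q p z y x"
    unfolding corner_end2_def swap[of b a] swap2[of y x] swap2[of q p] by simp
qed

lemma closed_corner_commute: "closed_corner g a b = closed_corner g b a"
  by (auto simp: closed_corner_def)

section \<open>Angle systems\<close>

text \<open>The two sides at a corner, in an arbitrary order.\<close>

definition corner_sides :: "('v, 'e, 't) cells \<Rightarrow> 't \<Rightarrow> 'v \<Rightarrow> 'e \<times> 'e" where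
  "corner_sides X t i = (SOME (a, c). \<exists>j k b. labels X t i j k a b c)"

definition side1 :: "('v, 'e, 't) cells \<Rightarrow> 't \<Rightarrow> 'v \<Rightarrow> 'e" where
  "side1 X t i = fst (corner_sides X t i)"

definition side2 :: "('v, 'e, 't) cells \<Rightarrow> 't \<Rightarrow> 'v \<Rightarrow> 'e" where
  "side2 X t i = snd (corner_sides X t i)"

text \<open>For functions symmetric in the two side angles the order chosen by
  \<open>corner_sides\<close> does not matter, see \<open>at_corner_labels\<close>.\<close>

definition at_corner ::
    "(real \<Rightarrow> real \<Rightarrow> real \<Rightarrow> 'a) \<Rightarrow> ('v, 'e, 't) cells \<Rightarrow> ('t \<Rightarrow> 'e \<Rightarrow> real) \<Rightarrow> ('t \<Rightarrow> 'v \<Rightarrow> real) \<Rightarrow> 't \<Rightarrow> 'v \<Rightarrow> 'a"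
  where "at_corner \<phi> X A G t i = \<phi> (G t i) (A t (side1 X t i)) (A t (side2 X t i))"

definition dir_corner ::
    "(real \<Rightarrow> real \<Rightarrow> real \<Rightarrow> real \<Rightarrow> real \<Rightarrow> real \<Rightarrow> 'a) \<Rightarrow> ('v, 'e, 't) cells \<Rightarrow>
     ('t \<Rightarrow> 'e \<Rightarrow> real) \<Rightarrow> ('t \<Rightarrow> 'v \<Rightarrow> real) \<Rightarrow> ('t \<Rightarrow> 'e \<Rightarrow> real) \<Rightarrow> ('t \<Rightarrow> 'v \<Rightarrow> real) \<Rightarrow> 't \<Rightarrow> 'v \<Rightarrow> 'a"
  where "dir_corner \<phi> X A G dA dG t i = \<phi> (G t i) (A t (side1 X t i)) (A t (side2 X t i))
    (dG t i) (dA t (side1 X t i)) (dA t (side2 X t i))"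

definition volume :: "('v, 'e, 't) cells \<Rightarrow> ('t \<Rightarrow> 'e \<Rightarrow> real) \<Rightarrow> ('t \<Rightarrow> 'v \<Rightarrow> real) \<Rightarrow> real" where
  "volume X A G = (\<Sum>t\<in>triangles X. \<Sum>i\<in>corners X t. at_corner corner_vol X A G t i)"

text \<open>A single sum over \<open>adj_triangles\<close> treats interior and boundary edges
  alike.\<close>

definition angle_eqs ::
    "('v, 'e, 't) cells \<Rightarrow> ('e \<Rightarrow> real) \<Rightarrow> ('v \<Rightarrow> real) \<Rightarrow> ('t \<Rightarrow> 'e \<Rightarrow> real) \<Rightarrow> ('t \<Rightarrow> 'v \<Rightarrow> real) \<Rightarrow> bool" where
  "angle_eqs X \<theta> \<Xi> A G \<longleftrightarrow>
     (\<forall>t\<in>triangles X. (\<Sum>i\<in>corners X t. G t i) = pi) \<and>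
     (\<forall>e\<in>edges X. (\<Sum>t\<in>adj_triangles X e. A t e) = pi - \<theta> e) \<and>
     (\<forall>i\<in>vertices X. (\<Sum>t\<in>star X i. G t i) = \<Xi> i)"

text \<open>The tangent vectors of the affine space cut out by \<open>angle_eqs\<close>.\<close>

definition null_direction ::
    "('v, 'e, 't) cells \<Rightarrow> ('t \<Rightarrow> 'e \<Rightarrow> real) \<Rightarrow> ('t \<Rightarrow> 'v \<Rightarrow> real) \<Rightarrow> bool" where
  "null_direction X A G \<longleftrightarrow>
     (\<forall>t\<in>triangles X. (\<Sum>i\<in>corners X t. G t i) = 0) \<and>
     (\<forall>e\<in>edges X. (\<Sum>t\<in>adj_triangles X e. A t e) = 0) \<and>
     (\<forall>i\<in>vertices X. (\<Sum>t\<in>star X i. G t i) = 0)"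

definition closed_system ::
    "('v, 'e, 't) cells \<Rightarrow> ('e \<Rightarrow> real) \<Rightarrow> ('v \<Rightarrow> real) \<Rightarrow> ('t \<Rightarrow> 'e \<Rightarrow> real) \<Rightarrow> ('t \<Rightarrow> 'v \<Rightarrow> real) \<Rightarrow> bool" where
  "closed_system X \<theta> \<Xi> A G \<longleftrightarrow> angle_eqs X \<theta> \<Xi> A G \<and>
     (\<forall>t\<in>triangles X. \<forall>i\<in>corners X t. at_corner closed_corner X A G t i)"

definition strict_system ::
    "('v, 'e, 't) cells \<Rightarrow> ('e \<Rightarrow> real) \<Rightarrow> ('v \<Rightarrow> real) \<Rightarrow> ('t \<Rightarrow> 'e \<Rightarrow> real) \<Rightarrow> ('t \<Rightarrow> 'v \<Rightarrow> real) \<Rightarrow> bool" where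
  "strict_system X \<theta> \<Xi> A G \<longleftrightarrow> angle_eqs X \<theta> \<Xi> A G \<and>
     (\<forall>t\<in>triangles X. (\<forall>e\<in>sides X t. 0 < A t e) \<and>
        (\<forall>i\<in>corners X t. at_corner hyperideal_corner X A G t i))"

lemma strict_closed: "strict_system X \<theta> \<Xi> A G \<Longrightarrow> closed_system X \<theta> \<Xi> A G"
  by (fastforce simp: strict_system_def closed_system_def at_corner_def hyperideal_corner_def closed_corner_def
      intro: less_imp_le)

abbreviation shift :: "('a \<Rightarrow> 'b \<Rightarrow> real) \<Rightarrow> real \<Rightarrow> ('a \<Rightarrow> 'b \<Rightarrow> real) \<Rightarrow> 'a \<Rightarrow> 'b \<Rightarrow> real" where
  "shift A s dA \<equiv> \<lambda>x y. A x y + s * dA x y"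

lemma angle_eqs_shift:
  "angle_eqs X \<theta> \<Xi> A G \<Longrightarrow> null_direction X dA dG \<Longrightarrow> angle_eqs X \<theta> \<Xi> (shift A s dA) (shift G s dG)"
  by (simp add: angle_eqs_def null_direction_def sum.distrib flip: sum_distrib_left)

lemma null_direction_diff:
  "angle_eqs X \<theta> \<Xi> A G \<Longrightarrow> angle_eqs X \<theta> \<Xi> B H \<Longrightarrow> null_direction X (\<lambda>t e. B t e - A t e) (\<lambda>t i. H t i - G t i)"
  by (simp add: angle_eqs_def null_direction_def sum_subtractf)

lemma null_direction_shift:
  "null_direction X A G \<Longrightarrow> null_direction X dA dG \<Longrightarrow> null_direction X (shift A s dA) (shift G s dG)"
  by (simp add: null_direction_def sum.distrib flip: sum_distrib_left)

section \<open>Convexity, feasible directions and compactness\<close>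

lemma closed_corner_convex:
  assumes "closed_corner g a b" "closed_corner (g + e * z) (a + e * x) (b + e * y)" "0 \<le> s" "s \<le> e"
  shows "closed_corner (g + s * z) (a + s * x) (b + s * y)"
proof (cases "e = 0")
  case True
  then show ?thesis using assms by simp
next
  case False
  then have e: "e > 0" using assms by simp
  define u where "u = s / e"
  have u: "0 \<le> u" "u \<le> 1" "s = u * e" using e assms by (auto simp: u_def)
  have conv: "p + s * w = (1 - u) * p + u * (p + e * w)" for p w
    unfolding u(3) by (simp add: algebra_simps)
  have pos: "0 \<le> p + s * w" if "0 \<le> p" "0 \<le> p + e * w" for p w
    unfolding conv
    by (rule add_nonneg_nonneg[OF mult_nonneg_nonneg mult_nonneg_nonneg]) (use u that in auto)
  have "0 \<le> (pi - g - a - b) + s * (- z - x - y)"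
    by (rule pos) (use assms(1,2) in \<open>auto simp: closed_corner_def algebra_simps\<close>)
  moreover have "0 \<le> g + s * z" "0 \<le> a + s * x" "0 \<le> b + s * y"
    using assms(1,2) by (auto simp: closed_corner_def intro!: pos)
  ultimately show ?thesis unfolding closed_corner_def by (simp add: algebra_simps)
qed

lemma closed_system_shift_convex:
  assumes "closed_system X \<theta> \<Xi> A G" "closed_system X \<theta> \<Xi> (shift A e dA) (shift G e dG)"
    and "null_direction X dA dG" "0 \<le> s" "s \<le> e"
  shows "closed_system X \<theta> \<Xi> (shift A s dA) (shift G s dG)"
  using assms closed_corner_convex[OF _ _ assms(4,5)] angle_eqs_shift[OF _ assms(3)]
  by (simp add: closed_system_def at_corner_def)

lemma closed_corner_eventually:
  assumes c: "hyperideal_corner g a b" and "a = 0 \<Longrightarrow> 0 \<le> x" "b = 0 \<Longrightarrow> 0 \<le> y"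
  shows "eventually (\<lambda>s. closed_corner (g + s * z) (a + s * x) (b + s * y)) (at_right 0)"
proof -
  have lim: "((\<lambda>s. p + s * d) \<longlongrightarrow> p) (at_right 0)" for p d :: real
    by (auto intro!: tendsto_eq_intros)
  have ev: "eventually (\<lambda>s. 0 \<le> p + s * d) (at_right 0)" if "0 < p" for p d :: real
    using order_tendstoD(1)[OF lim[of p d] that] by (rule eventually_mono) simp
  have ev0: "eventually (\<lambda>s. 0 \<le> p + s * d) (at_right 0)" if "0 \<le> p" "p = 0 \<Longrightarrow> 0 \<le> d" for p d :: real
  proof (cases "p = 0")
    case True
    then show ?thesis using that(2) eventually_at_right_less[of 0] by (auto elim!: eventually_mono)
  qed (use ev that in auto)
  have "eventually (\<lambda>s. 0 \<le> g + s * z) (at_right 0)" "eventually (\<lambda>s. 0 \<le> a + s * x) (at_right 0)"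
    "eventually (\<lambda>s. 0 \<le> b + s * y) (at_right 0)"
    "eventually (\<lambda>s. 0 \<le> (pi - g - a - b) + s * (- z - x - y)) (at_right 0)"
    using c assms(2,3) by (auto simp: hyperideal_corner_def intro!: ev0)
  then show ?thesis by eventually_elim (auto simp: closed_corner_def algebra_simps)
qed

text \<open>Tychonoff's theorem: angle systems are functions on whole types, so the box that
  contains them is compact in the product topology.\<close>

lemma compact_fun:
  fixes S :: "'a \<Rightarrow> 'b::topological_space set"
  assumes "\<And>x. compact (S x)"
  shows "compact {f. \<forall>x. f x \<in> S x}"
proof -
  have "compactin (product_topology (\<lambda>_. euclidean) UNIV) (PiE UNIV S)"
    unfolding compactin_PiE using assms by simp
  then have "compact (PiE UNIV S)" by (simp add: euclidean_product_topology)
  moreover have "PiE UNIV S = {f. \<forall>x. f x \<in> S x}" by (auto simp: PiE_def Pi_def)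
  ultimately show ?thesis by simp
qed

lemma continuous_coordinate: "continuous_on UNIV (\<lambda>f::'a \<Rightarrow> 'b \<Rightarrow> real. f x y)"
  using continuous_on_compose2[OF continuous_on_product_coordinates[of y] continuous_on_product_coordinates[of x]]
  by simp

lemma continuous_coordinate_fst:
  "continuous_on S (\<lambda>p::('a \<Rightarrow> 'b \<Rightarrow> real) \<times> 'c::topological_space. fst p x y)"
  by (rule continuous_on_compose2[OF continuous_coordinate continuous_on_fst[OF continuous_on_id]]) simp

lemma continuous_coordinate_snd:
  "continuous_on S (\<lambda>p::'c::topological_space \<times> ('a \<Rightarrow> 'b \<Rightarrow> real). snd p x y)"
  by (rule continuous_on_compose2[OF continuous_coordinate continuous_on_snd[OF continuous_on_id]]) simp

context
  fixes X :: "('v, 'e, 't) cells"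
  assumes surface: "surface_triangulation X"
begin

lemma corner_sides_labels:
  assumes t: "t \<in> triangles X" and l: "labels X t i j k a b c"
  shows "(side1 X t i = a \<and> side2 X t i = c) \<or> (side1 X t i = c \<and> side2 X t i = a)"
proof -
  have "\<exists>x. case x of (a, c) \<Rightarrow> \<exists>j k b. labels X t i j k a b c"
    by (rule exI[of _ "(a, c)"]) (use l in auto)
  from someI_ex[OF this] have "case corner_sides X t i of (a, c) \<Rightarrow> \<exists>j k b. labels X t i j k a b c"
    unfolding corner_sides_def .
  then have "\<exists>j k b. labels X t i j k (side1 X t i) b (side2 X t i)"
    by (cases "corner_sides X t i") (simp add: side1_def side2_def)
  then show ?thesis using labels_unique[OF surface t l] by blast
qed

lemma at_corner_labels:
  assumes "t \<in> triangles X" "labels X t i j k a b c" and "\<And>g x y. \<phi> g x y = \<phi> g y x"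
  shows "at_corner \<phi> X A G t i = \<phi> (G t i) (A t a) (A t c)"
  using corner_sides_labels[OF assms(1,2)] assms(3) by (auto simp: at_corner_def)

lemma dir_corner_labels:
  assumes "t \<in> triangles X" "labels X t i j k a b c" and "\<And>g p q z x y. \<phi> g p q z x y = \<phi> g q p z y x"
  shows "dir_corner \<phi> X A G dA dG t i = \<phi> (G t i) (A t a) (A t c) (dG t i) (dA t a) (dA t c)"
  using corner_sides_labels[OF assms(1,2)] assms(3) by (auto simp: dir_corner_def)

lemmas closed_labels = at_corner_labels[where \<phi> = closed_corner, OF _ _ closed_corner_commute]
lemmas hyperideal_labels = at_corner_labels[where \<phi> = hyperideal_corner, OF _ _ hyperideal_corner_commute]
lemmas end_labels = dir_corner_labels[where \<phi> = corner_end, OF _ _ corner_end_commute]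
lemmas slope_labels = dir_corner_labels[where \<phi> = corner_slope, OF _ _ corner_slope_commute]

lemma closed_system_corner:
  assumes "closed_system X \<theta> \<Xi> A G" "t \<in> triangles X" "labels X t i j k a b c"
  shows "closed_corner (G t i) (A t a) (A t c)"
proof -
  have "i \<in> corners X t" using assms(3) by (simp add: labels_def)
  then show ?thesis using assms(1,2) unfolding closed_labels[OF assms(2,3), symmetric] closed_system_def by blast
qed

lemma strict_system_corner:
  assumes "strict_system X \<theta> \<Xi> A G" "t \<in> triangles X" "labels X t i j k a b c"
  shows "hyperideal_corner (G t i) (A t a) (A t c)"
proof -
  have "i \<in> corners X t" using assms(3) by (simp add: labels_def)
  then show ?thesis using assms(1,2) unfolding hyperideal_labels[OF assms(2,3), symmetric] strict_system_def by blast
qed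

lemma sum_corners:
  assumes "t \<in> triangles X" "labels X t i j k a b c"
  shows "(\<Sum>v\<in>corners X t. f v) = f i + f j + (f k :: 'a::comm_monoid_add)"
  using assms(2) labels_distinct[OF surface assms] by (auto simp: labels_def add.assoc)

lemma sum_sides:
  assumes "t \<in> triangles X" "labels X t i j k a b c"
  shows "(\<Sum>e\<in>sides X t. f e) = f a + f b + (f c :: 'a::comm_monoid_add)"
  using assms(2) labels_distinct[OF surface assms] by (auto simp: labels_def add.assoc)

lemma finite_corners: "t \<in> triangles X \<Longrightarrow> finite (corners X t)"
  using surface card_ge_0_finite[of "corners X t"] by (auto simp: surface_triangulation_def)

lemma finite_sides: "t \<in> triangles X \<Longrightarrow> finite (sides X t)"
  using surface card_ge_0_finite[of "sides X t"] by (auto simp: surface_triangulation_def)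

lemma corners_vertices: "t \<in> triangles X \<Longrightarrow> corners X t \<subseteq> vertices X"
  using surface by (fastforce simp: surface_triangulation_def corners_def)

lemma sum_sides_swap:
  "(\<Sum>t\<in>triangles X. \<Sum>e\<in>sides X t. f t e) = (\<Sum>e\<in>edges X. \<Sum>t\<in>adj_triangles X e. f t (e::'e) :: real)"
proof -
  have "(\<Sum>t\<in>triangles X. \<Sum>e\<in>sides X t. f t e) = (\<Sum>t\<in>triangles X. \<Sum>e\<in>{e\<in>edges X. e \<in> sides X t}. f t e)"
    using sides_edges[OF surface] by (intro sum.cong) auto
  also have "\<dots> = (\<Sum>e\<in>edges X. \<Sum>t\<in>{t\<in>triangles X. e \<in> sides X t}. f t e)"
    using surface_finite[OF surface] by (intro sum.swap_restrict)
  finally show ?thesis by (simp add: adj_triangles_def)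
qed

lemma sum_corners_swap:
  "(\<Sum>t\<in>triangles X. \<Sum>i\<in>corners X t. f t i) = (\<Sum>i\<in>vertices X. \<Sum>t\<in>star X i. f t (i::'v) :: real)"
proof -
  have "(\<Sum>t\<in>triangles X. \<Sum>i\<in>corners X t. f t i) = (\<Sum>t\<in>triangles X. \<Sum>i\<in>{i\<in>vertices X. i \<in> corners X t}. f t i)"
    using corners_vertices by (intro sum.cong) auto
  also have "\<dots> = (\<Sum>i\<in>vertices X. \<Sum>t\<in>{t\<in>triangles X. i \<in> corners X t}. f t i)"
    using surface_finite[OF surface] by (intro sum.swap_restrict)
  finally show ?thesis by (simp add: star_def)
qed

lemma corner_sides_exist:
  assumes "t \<in> triangles X" "i \<in> corners X t"
  obtains j k b where "labels X t i j k (side1 X t i) b (side2 X t i)"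
proof -
  obtain j k a b c where l: "labels X t i j k a b c" using labels_exist_corner[OF surface assms] by metis
  have l': "labels X t i k j c b a" using labels_rotate[OF labels_reflect[OF labels_rotate[OF labels_rotate[OF l]]]]
    by (auto simp: labels_def insert_commute)
  show ?thesis using corner_sides_labels[OF assms(1) l] that l l' by auto
qed

lemma sides_of_corner:
  assumes "t \<in> triangles X" "i \<in> corners X t"
  shows "side1 X t i \<in> sides X t" "side2 X t i \<in> sides X t"
  using corner_sides_exist[OF assms] by (metis labels_def insertCI)+

lemma corner_of_side:
  assumes t: "t \<in> triangles X" and e: "e \<in> sides X t"
  obtains i where "i \<in> corners X t" "e = side1 X t i \<or> e = side2 X t i"
proof -
  obtain i j k b c where l: "labels X t i j k e b c" using labels_exist[OF surface t e] by metis
  then show ?thesis using that[of i] corner_sides_labels[OF t l] by (auto simp: labels_def)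
qed

lemma closed_system_bounds:
  assumes c: "closed_system X \<theta> \<Xi> A G" and t: "t \<in> triangles X"
  shows "e \<in> sides X t \<Longrightarrow> A t e \<in> {0..pi}" "i \<in> corners X t \<Longrightarrow> G t i \<in> {0..pi}"
proof -
  have cc: "closed_corner (G t i) (A t (side1 X t i)) (A t (side2 X t i))" if "i \<in> corners X t" for i
    using c t that by (auto simp: closed_system_def at_corner_def)
  show "A t e \<in> {0..pi}" if es: "e \<in> sides X t"
  proof -
    obtain i where "i \<in> corners X t" "e = side1 X t i \<or> e = side2 X t i" using corner_of_side[OF t es] by blast
    then show ?thesis using cc[of i] by (auto simp: closed_corner_def)
  qed
  show "G t i \<in> {0..pi}" if "i \<in> corners X t" using cc[OF that] by (auto simp: closed_corner_def)
qed

lemma angle_eqs_cong: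
  assumes "\<And>t e. t \<in> triangles X \<Longrightarrow> e \<in> sides X t \<Longrightarrow> A t e = B t e"
    and "\<And>t i. t \<in> triangles X \<Longrightarrow> i \<in> corners X t \<Longrightarrow> G t i = H t i"
  shows "angle_eqs X \<theta> \<Xi> A G \<longleftrightarrow> angle_eqs X \<theta> \<Xi> B H"
proof -
  have "(\<Sum>t\<in>adj_triangles X e. A t e) = (\<Sum>t\<in>adj_triangles X e. B t e)" for e
    by (rule sum.cong) (auto simp: adj_triangles_def assms)
  moreover have "(\<Sum>t\<in>star X i. G t i) = (\<Sum>t\<in>star X i. H t i)" for i
    by (rule sum.cong) (auto simp: star_def assms)
  moreover have "(\<Sum>i\<in>corners X t. G t i) = (\<Sum>i\<in>corners X t. H t i)" if "t \<in> triangles X" for t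
    by (rule sum.cong) (auto simp: that assms)
  ultimately show ?thesis by (simp add: angle_eqs_def)
qed

lemma volume_max_exists:
  assumes ex: "closed_system X \<theta> \<Xi> A0 G0"
  obtains A G where "closed_system X \<theta> \<Xi> A G"
    "\<And>B H. closed_system X \<theta> \<Xi> B H \<Longrightarrow> volume X B H \<le> volume X A G"
proof -
  let ?Box = "{A :: 't \<Rightarrow> 'e \<Rightarrow> real. \<forall>t. A t \<in> {f. \<forall>e. f e \<in> {0..pi}}} \<times>
    {G :: 't \<Rightarrow> 'v \<Rightarrow> real. \<forall>t. G t \<in> {f. \<forall>e. f e \<in> {0..pi}}}"
  let ?C = "{p. closed_system X \<theta> \<Xi> (fst p) (snd p)}"
  have box: "compact ?Box" by (intro compact_Times compact_fun compact_Icc)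
  note ci = continuous_coordinate_fst continuous_coordinate_snd
  have closed: "closed ?C"
    unfolding closed_system_def angle_eqs_def at_corner_def closed_corner_def Ball_def
    by (intro closed_Collect_conj closed_Collect_all closed_Collect_imp closed_Collect_eq closed_Collect_le
        continuous_intros ci) auto
  have comp: "compact (?Box \<inter> ?C)" using box closed by (rule compact_Int_closed)
  \<comment> \<open>Values at pairs that are not incident are unconstrained, so the closed systems
    do not form a compact set. Setting these values to 0 moves a system into the box and leaves its
    volume unchanged.\<close>
  define clip where "clip = (\<lambda>(A :: 't \<Rightarrow> 'e \<Rightarrow> real, G :: 't \<Rightarrow> 'v \<Rightarrow> real).
    (\<lambda>t e. if t \<in> triangles X \<and> e \<in> sides X t then A t e else 0,
     \<lambda>t i. if t \<in> triangles X \<and> i \<in> corners X t then G t i else 0))"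
  have clip_corner: "at_corner \<phi> X (fst (clip (A, G))) (snd (clip (A, G))) t i = at_corner \<phi> X A G t i"
    if "t \<in> triangles X" "i \<in> corners X t" for \<phi> :: "real \<Rightarrow> real \<Rightarrow> real \<Rightarrow> 'z" and A G t i
    using that sides_of_corner by (simp add: at_corner_def clip_def)
  have clip_vol: "volume X (fst (clip (A, G))) (snd (clip (A, G))) = volume X A G" for A G
    unfolding volume_def by (intro sum.cong refl clip_corner)
  have clip_in: "clip (A, G) \<in> ?Box \<inter> ?C" if c: "closed_system X \<theta> \<Xi> A G" for A G
  proof -
    have "angle_eqs X \<theta> \<Xi> (fst (clip (A, G))) (snd (clip (A, G)))"
      using c angle_eqs_cong[of "fst (clip (A, G))" A "snd (clip (A, G))" G]
      by (simp add: closed_system_def clip_def)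
    then have "closed_system X \<theta> \<Xi> (fst (clip (A, G))) (snd (clip (A, G)))"
      using c clip_corner unfolding closed_system_def by metis
    moreover have "clip (A, G) \<in> ?Box"
      using closed_system_bounds[OF c] by (auto simp: clip_def)
    ultimately show ?thesis by simp
  qed
  have cont: "continuous_on (?Box \<inter> ?C) (\<lambda>p. volume X (fst p) (snd p))"
    unfolding volume_def at_corner_def
    by (intro continuous_on_sum continuous_corner_vol ci) (auto simp: closed_system_def at_corner_def)
  define K where "K = ?Box \<inter> ?C"
  have K: "K \<noteq> {}" using clip_in[OF ex] unfolding K_def[symmetric] by blast
  from continuous_attains_sup[OF comp[folded K_def] K cont[folded K_def]]
  obtain p where p: "p \<in> K" "\<forall>q\<in>K. volume X (fst q) (snd q) \<le> volume X (fst p) (snd p)" by blast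
  show ?thesis
  proof (rule that[of "fst p" "snd p"])
    show "closed_system X \<theta> \<Xi> (fst p) (snd p)" using p(1) by (simp add: K_def)
    show "volume X B H \<le> volume X (fst p) (snd p)" if c: "closed_system X \<theta> \<Xi> B H" for B H
      using p(2) clip_in[OF c, folded K_def] clip_vol[of B H] by metis
  qed
qed

text \<open>By convexity the whole segment up to e consists of closed systems, so
  \<open>log_slope_not_max\<close> applies to the volume along it.\<close>

lemma max_slope:
  assumes c: "closed_system X \<theta> \<Xi> A G"
    and max: "\<And>B H. closed_system X \<theta> \<Xi> B H \<Longrightarrow> volume X B H \<le> volume X A G"
    and null: "null_direction X dA dG" and e: "0 < e"
    and ce: "closed_system X \<theta> \<Xi> (shift A e dA) (shift G e dG)"
    and C: "C = (\<Sum>t\<in>triangles X. \<Sum>i\<in>corners X t. dir_corner corner_end X A G dA dG t i)"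
    and D: "D = (\<Sum>t\<in>triangles X. \<Sum>i\<in>corners X t. dir_corner corner_slope X A G dA dG t i)"
  shows "C \<le> 0" "C = 0 \<Longrightarrow> D \<le> 0"
proof -
  have slope: "log_slope (\<lambda>s. volume X (shift A s dA) (shift G s dG)) C D"
    unfolding volume_def C D at_corner_def dir_corner_def
    by (intro log_slope_sum log_slope_corner_vol[OF _ _ e])
       (use c ce in \<open>auto simp: closed_system_def at_corner_def\<close>)
  have "eventually (\<lambda>s. s < e) (at_right 0)"
    using eventually_at_right[of 0 e "\<lambda>s. s < e"] e by (metis eventually_at_right_field)
  then have "eventually (\<lambda>s. volume X (shift A s dA) (shift G s dG) \<le> volume X (shift A 0 dA) (shift G 0 dG)) (at_right 0)"
    using eventually_at_right_less[of 0]
  proof eventually_elim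
    case (elim s)
    then have "closed_system X \<theta> \<Xi> (shift A s dA) (shift G s dG)"
      by (intro closed_system_shift_convex[OF c ce null]) auto
    then show ?case using max by simp
  qed
  then have "\<not> (C > 0 \<or> (C = 0 \<and> D > 0))" using log_slope_not_max[OF slope] by blast
  then show "C \<le> 0" "C = 0 \<Longrightarrow> D \<le> 0" by auto
qed

lemma feasible_direction:
  assumes c: "closed_system X \<theta> \<Xi> A G" and null: "null_direction X dA dG"
    and ev: "\<And>t i. t \<in> triangles X \<Longrightarrow> i \<in> corners X t \<Longrightarrow>
      eventually (\<lambda>s. at_corner closed_corner X (shift A s dA) (shift G s dG) t i) (at_right 0)"
  obtains e where "0 < e" "closed_system X \<theta> \<Xi> (shift A e dA) (shift G e dG)"
proof -
  have "eventually (\<lambda>s. \<forall>t\<in>triangles X. \<forall>i\<in>corners X t. at_corner closed_corner X (shift A s dA) (shift G s dG) t i) (at_right 0)"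
    using surface_finite[OF surface] finite_corners ev by (intro eventually_ball_finite ballI) auto
  then have "eventually (\<lambda>s. 0 < s \<and> closed_system X \<theta> \<Xi> (shift A s dA) (shift G s dG)) (at_right 0)"
    using eventually_at_right_less[of 0]
    by eventually_elim (use c angle_eqs_shift[OF _ null] in \<open>auto simp: closed_system_def\<close>)
  from eventually_happens[OF this] show ?thesis using that by (auto simp: trivial_limit_at_right_real)
qed

text \<open>A side angle \<open>pi\<close> forces all other angles of the triangle. By the last
  claim a null direction does not see such a triangle at the order s ln s.\<close>

lemma collapsed_triangle:
  assumes c: "closed_system X \<theta> \<Xi> A G" and t: "t \<in> triangles X" and l: "labels X t i j k a b d" and a: "A t a = pi"
  shows "G t i = 0" "G t j = 0" "G t k = pi" "A t b = 0" "A t d = 0"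
    "(\<Sum>v\<in>corners X t. dir_corner corner_end X A G dA dG t v) = - (\<Sum>v\<in>corners X t. dG t v)"
proof -
  note l2 = labels_rotate[OF l]
  note l3 = labels_rotate[OF l2]
  have cc: "closed_corner (G t i) (A t a) (A t d)" "closed_corner (G t j) (A t b) (A t a)"
    "closed_corner (G t k) (A t d) (A t b)"
    using closed_system_corner[OF c t] l l2 l3 by blast+
  have sum: "G t i + G t j + G t k = pi"
    using c t sum_corners[OF t l, of "G t"] by (auto simp: closed_system_def angle_eqs_def)
  show z: "G t i = 0" "G t j = 0" "A t b = 0" "A t d = 0"
    using cc a by (auto simp: closed_corner_def)
  then show k: "G t k = pi" using sum by simp
  show "(\<Sum>v\<in>corners X t. dir_corner corner_end X A G dA dG t v) = - (\<Sum>v\<in>corners X t. dG t v)"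
    unfolding sum_corners[OF t l] end_labels[OF t l]
      end_labels[OF t l2] end_labels[OF t l3]
    using corner_end_collapsed[OF cc(1)] corner_end_collapsed[OF cc(2)] corner_end_collapsed[OF cc(3)] a k by simp
qed

text \<open>The direction to the strict system is inward at each corner, so
  \<open>corner_end_inward\<close> makes each term nonnegative. If they add up to 0, each corner is
  hyperideal or flat.\<close>

lemma uncollapsed_triangle:
  assumes c: "closed_system X \<theta> \<Xi> A G" and q: "strict_system X \<theta> \<Xi> B H" and t: "t \<in> triangles X"
    and ne: "\<And>e. e \<in> sides X t \<Longrightarrow> A t e \<noteq> pi"
  defines "C \<equiv> (\<Sum>v\<in>corners X t. dir_corner corner_end X A G (\<lambda>t e. B t e - A t e) (\<lambda>t i. H t i - G t i) t v)"
  shows "0 \<le> C" "C = 0 \<Longrightarrow> i \<in> corners X t \<Longrightarrow> at_corner hyperideal_corner X A G t i"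
proof -
  obtain i j k a b d where l: "labels X t i j k a b d" using labels_exist_any[OF surface t] by metis
  note l2 = labels_rotate[OF l]
  note l3 = labels_rotate[OF l2]
  have cor: "corners X t = {i, j, k}" using l by (auto simp: labels_def)
  have sid: "sides X t = {a, b, d}" using l by (auto simp: labels_def)
  have cc: "closed_corner (G t i) (A t a) (A t d)" "closed_corner (G t j) (A t b) (A t a)"
    "closed_corner (G t k) (A t d) (A t b)"
    using closed_system_corner[OF c t] l l2 l3 by blast+
  have hc: "hyperideal_corner (H t i) (B t a) (B t d)" "hyperideal_corner (H t j) (B t b) (B t a)"
    "hyperideal_corner (H t k) (B t d) (B t b)"
    using strict_system_corner[OF q t] l l2 l3 by blast+
  have Bpos: "0 < B t a" "0 < B t b" "0 < B t d" using q t sid by (auto simp: strict_system_def)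
  have npi: "A t a \<noteq> pi" "A t b \<noteq> pi" "A t d \<noteq> pi" using ne sid by auto
  have sum: "G t i + G t j + G t k = pi"
    using c t sum_corners[OF t l, of "G t"] by (auto simp: closed_system_def angle_eqs_def)
  let ?e1 = "corner_end (G t i) (A t a) (A t d) (H t i - G t i) (B t a - A t a) (B t d - A t d)"
  let ?e2 = "corner_end (G t j) (A t b) (A t a) (H t j - G t j) (B t b - A t b) (B t a - A t a)"
  let ?e3 = "corner_end (G t k) (A t d) (A t b) (H t k - G t k) (B t d - A t d) (B t b - A t b)"
  have C: "C = ?e1 + ?e2 + ?e3"
    unfolding C_def sum_corners[OF t l] end_labels[OF t l]
      end_labels[OF t l2] end_labels[OF t l3] ..
  have e1: "0 \<le> ?e1" "?e1 = 0 \<Longrightarrow> hyperideal_corner (G t i) (A t a) (A t d) \<or> (G t i = 0 \<and> A t a + A t d = pi)"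
    using corner_end_inward[OF cc(1) npi(1,3), of "H t i - G t i" "B t a - A t a" "B t d - A t d"] hc(1) Bpos
    by (auto simp: hyperideal_corner_def)
  have e2: "0 \<le> ?e2" "?e2 = 0 \<Longrightarrow> hyperideal_corner (G t j) (A t b) (A t a) \<or> (G t j = 0 \<and> A t b + A t a = pi)"
    using corner_end_inward[OF cc(2) npi(2,1), of "H t j - G t j" "B t b - A t b" "B t a - A t a"] hc(2) Bpos
    by (auto simp: hyperideal_corner_def)
  have e3: "0 \<le> ?e3" "?e3 = 0 \<Longrightarrow> hyperideal_corner (G t k) (A t d) (A t b) \<or> (G t k = 0 \<and> A t d + A t b = pi)"
    using corner_end_inward[OF cc(3) npi(3,2), of "H t k - G t k" "B t d - A t d" "B t b - A t b"] hc(3) Bpos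
    by (auto simp: hyperideal_corner_def)
  show "0 \<le> C" using C e1(1) e2(1) e3(1) by simp
  assume "C = 0"
  then have "?e1 = 0" "?e2 = 0" "?e3 = 0" using C e1(1) e2(1) e3(1) by linarith+
  then have h: "hyperideal_corner (G t i) (A t a) (A t d) \<or> (G t i = 0 \<and> A t a + A t d = pi)"
    "hyperideal_corner (G t j) (A t b) (A t a) \<or> (G t j = 0 \<and> A t b + A t a = pi)"
    "hyperideal_corner (G t k) (A t d) (A t b) \<or> (G t k = 0 \<and> A t d + A t b = pi)"
    using e1(2) e2(2) e3(2) by blast+
  \<comment> \<open>A flat corner, say G t i = 0 with A t a + A t d = pi, cannot occur: adding the
    inequalities at j and k gives A t b = 0 and G t j + A t a = pi. Then j is not hyperideal, and it
    is not flat because A t a differs from pi.\<close>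
  have "hyperideal_corner (G t i) (A t a) (A t d) \<and> hyperideal_corner (G t j) (A t b) (A t a) \<and>
    hyperideal_corner (G t k) (A t d) (A t b)"
    using h sum cc npi unfolding hyperideal_corner_def closed_corner_def by argo
  then have "\<forall>i\<in>corners X t. at_corner hyperideal_corner X A G t i"
    unfolding cor using hyperideal_labels[OF t l]
      hyperideal_labels[OF t l2] hyperideal_labels[OF t l3] by simp
  then show "i \<in> corners X t \<Longrightarrow> at_corner hyperideal_corner X A G t i" for i by blast
qed

lemma adj_cases:
  assumes "t \<in> triangles X" "e \<in> sides X t"
  obtains "adj_triangles X e = {t}" | t' where "t' \<in> triangles X" "e \<in> sides X t'" "t' \<noteq> t" "adj_triangles X e = {t, t'}"
proof -
  have mem: "t \<in> adj_triangles X e" using assms by (simp add: adj_triangles_def)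
  have "e \<in> edges X" using assms sides_edges[OF surface] by blast
  then consider "card (adj_triangles X e) = 1" | "card (adj_triangles X e) = 2"
    using surface by (auto simp: surface_triangulation_def)
  then show ?thesis
  proof cases
    case 1
    then show ?thesis using mem that(1) by (auto simp: card_1_singleton_iff)
  next
    case 2
    then obtain p q where pq: "adj_triangles X e = {p, q}" "p \<noteq> q" by (auto simp: card_2_iff)
    define t' where "t' = (if t = p then q else p)"
    have "adj_triangles X e = {t, t'}" "t' \<noteq> t" using pq mem by (auto simp: t'_def)
    moreover from this have "t' \<in> adj_triangles X e" by blast
    ultimately show ?thesis using that(2)[of t'] by (auto simp: adj_triangles_def)
  qed
qed

end

section \<open>The maximum of the volume\<close>

definition other_side :: "('v, 'e, 't) cells \<Rightarrow> 't \<Rightarrow> 'v \<Rightarrow> 'e \<Rightarrow> 'e" where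
  "other_side X t i e = (if e = side1 X t i then side2 X t i else side1 X t i)"

text \<open>The \<open>\<lambda>\<^sub>i\<^sub>j\<close> of the edge e as seen from the triangle
  t.\<close>

definition edge_len ::
    "('v, 'e, 't) cells \<Rightarrow> ('t \<Rightarrow> 'e \<Rightarrow> real) \<Rightarrow> ('t \<Rightarrow> 'v \<Rightarrow> real) \<Rightarrow> 't \<Rightarrow> 'e \<Rightarrow> real" where
  "edge_len X A G t e = (\<Sum>i\<in>ends X e. half_len (G t i) (A t e) (A t (other_side X t i e)))"

context
  fixes X :: "('v, 'e, 't) cells"
  assumes surface: "surface_triangulation X"
begin

lemma edge_len_labels:
  assumes t: "t \<in> triangles X" and l: "labels X t i j k a b c"
  shows "edge_len X A G t a = half_len (G t i) (A t a) (A t c) + half_len (G t j) (A t a) (A t b)"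
proof -
  note d = labels_distinct[OF surface t l]
  have "other_side X t i a = c" "other_side X t j a = b"
    using corner_sides_labels[OF surface t l] corner_sides_labels[OF surface t labels_rotate[OF l]] d
    by (auto simp: other_side_def)
  moreover have "ends X a = {i, j}" using l by (simp add: labels_def)
  ultimately show ?thesis using d by (simp add: edge_len_def)
qed

text \<open>The gradient of the volume on one triangle; each edge length collects the half lengths
  from the corners at its two ends.\<close>

lemma triangle_slope:
  assumes t: "t \<in> triangles X" and h: "\<And>i. i \<in> corners X t \<Longrightarrow> at_corner hyperideal_corner X A G t i"
  shows "(\<Sum>i\<in>corners X t. dir_corner corner_slope X A G dA dG t i) =
    (\<Sum>i\<in>corners X t. ln (at_corner corner_rad X A G t i) * dG t i) - (\<Sum>e\<in>sides X t. edge_len X A G t e * dA t e)"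
proof -
  obtain i j k a b c where l: "labels X t i j k a b c" using labels_exist_any[OF surface t] by metis
  note l2 = labels_rotate[OF l]
  note l3 = labels_rotate[OF l2]
  have "i \<in> corners X t" "j \<in> corners X t" "k \<in> corners X t" using l by (auto simp: labels_def)
  then have hc: "hyperideal_corner (G t i) (A t a) (A t c)" "hyperideal_corner (G t j) (A t b) (A t a)"
    "hyperideal_corner (G t k) (A t c) (A t b)"
    using h unfolding hyperideal_labels[OF surface t l, symmetric] hyperideal_labels[OF surface t l2, symmetric]
      hyperideal_labels[OF surface t l3, symmetric] by blast+
  note rad = at_corner_labels[where \<phi> = corner_rad, OF surface t _ corner_rad_commute]
  show ?thesis
    unfolding sum_corners[OF surface t l] sum_sides[OF surface t l]
      slope_labels[OF surface t l] slope_labels[OF surface t l2] slope_labels[OF surface t l3]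
      rad[OF l] rad[OF l2] rad[OF l3]
      edge_len_labels[OF t l] edge_len_labels[OF t l2] edge_len_labels[OF t l3]
      corner_slope_hyperideal[OF hc(1)] corner_slope_hyperideal[OF hc(2)] corner_slope_hyperideal[OF hc(3)]
    by (simp add: algebra_simps)
qed

text \<open>Moves side angle at e from t' to t.\<close>

definition edge_direction :: "'e \<Rightarrow> 't \<Rightarrow> 't \<Rightarrow> 't \<Rightarrow> 'e \<Rightarrow> real" where
  "edge_direction e t t' s f = (if f = e then (if s = t then 1 else if s = t' then - 1 else 0) else 0)"

lemma null_edge_direction:
  assumes "adj_triangles X e = {t, t'}" "t \<noteq> t'"
  shows "null_direction X (edge_direction e t t') (\<lambda>_ _. 0)"
proof -
  have "(\<Sum>s\<in>adj_triangles X f. edge_direction e t t' s f) = 0" for f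
    using assms by (cases "f = e") (auto simp: edge_direction_def)
  then show ?thesis by (simp add: null_direction_def)
qed

lemma edge_direction_slope:
  assumes h: "\<And>t i. t \<in> triangles X \<Longrightarrow> i \<in> corners X t \<Longrightarrow> at_corner hyperideal_corner X A G t i"
    and adj: "adj_triangles X e = {t, t'}" "t \<noteq> t'" and e: "e \<in> edges X"
  shows "(\<Sum>s\<in>triangles X. \<Sum>i\<in>corners X s. dir_corner corner_slope X A G (edge_direction e t t') (\<lambda>_ _. 0) s i)
    = edge_len X A G t' e - edge_len X A G t e"
proof -
  have "(\<Sum>s\<in>triangles X. \<Sum>i\<in>corners X s. dir_corner corner_slope X A G (edge_direction e t t') (\<lambda>_ _. 0) s i)
    = - (\<Sum>s\<in>triangles X. \<Sum>f\<in>sides X s. edge_len X A G s f * edge_direction e t t' s f)"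
    using triangle_slope h by (simp add: sum_negf)
  also have "\<dots> = - (\<Sum>f\<in>edges X. \<Sum>s\<in>adj_triangles X f. edge_len X A G s f * edge_direction e t t' s f)"
    unfolding sum_sides_swap[OF surface] ..
  also have "(\<Sum>f\<in>edges X. \<Sum>s\<in>adj_triangles X f. edge_len X A G s f * edge_direction e t t' s f) =
      (\<Sum>f\<in>edges X. if f = e then edge_len X A G t e - edge_len X A G t' e else 0)"
    using adj by (intro sum.cong) (auto simp: edge_direction_def)
  also have "\<dots> = edge_len X A G t e - edge_len X A G t' e"
    using e surface_finite[OF surface] by simp
  finally show ?thesis by simp
qed

lemma edge_len_pos:
  assumes t: "t \<in> triangles X" and e: "e \<in> sides X t" and pos: "0 < A t e"
    and h: "\<And>i. i \<in> corners X t \<Longrightarrow> at_corner hyperideal_corner X A G t i"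
  shows "0 < edge_len X A G t e"
proof -
  obtain i j k b c where l: "labels X t i j k e b c" using labels_exist[OF surface t e] by metis
  note l2 = labels_rotate[OF l]
  have "i \<in> corners X t" "j \<in> corners X t" using l by (auto simp: labels_def)
  then have "hyperideal_corner (G t i) (A t e) (A t c)" "hyperideal_corner (G t j) (A t b) (A t e)"
    using h unfolding hyperideal_labels[OF surface t l, symmetric] hyperideal_labels[OF surface t l2, symmetric] by blast+
  then show ?thesis
    unfolding edge_len_labels[OF t l] using half_len_pos pos hyperideal_corner_commute by (meson add_pos_pos)
qed

lemma edge_len_0:
  assumes t: "t \<in> triangles X" and e: "e \<in> sides X t" and "A t e = 0"
  shows "edge_len X A G t e = 0"
  unfolding edge_len_def using assms by (simp add: half_len_0)

context
  fixes \<theta> :: "'e \<Rightarrow> real" and \<Xi> :: "'v \<Rightarrow> real" and A :: "'t \<Rightarrow> 'e \<Rightarrow> real" and G :: "'t \<Rightarrow> 'v \<Rightarrow> real"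
  assumes closed: "closed_system X \<theta> \<Xi> A G"
    and max: "\<And>B H. closed_system X \<theta> \<Xi> B H \<Longrightarrow> volume X B H \<le> volume X A G"
begin

text \<open>Moving side angle from t' to t is feasible as soon as t' has some to give, even if
  \<open>A t e = 0\<close>. This one-sided form excludes zero side angles in
  \<open>max_strict\<close>; applied both ways it gives \<open>max_edge_len\<close>.\<close>

lemma max_edge:
  assumes h: "\<And>t i. t \<in> triangles X \<Longrightarrow> i \<in> corners X t \<Longrightarrow> at_corner hyperideal_corner X A G t i"
    and adj: "adj_triangles X e = {t, t'}" "t \<noteq> t'" and e: "e \<in> edges X" and pos: "0 < A t' e"
  shows "edge_len X A G t' e \<le> edge_len X A G t e"
proof -
  note null = null_edge_direction[OF adj]
  have "eventually (\<lambda>s. at_corner closed_corner X (shift A s (edge_direction e t t')) (shift G s (\<lambda>_ _. 0)) u i) (at_right 0)"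
    if u: "u \<in> triangles X" "i \<in> corners X u" for u i
    unfolding at_corner_def
    by (rule closed_corner_eventually)
       (use h[OF u] pos in \<open>auto simp: at_corner_def edge_direction_def split: if_splits\<close>)
  from feasible_direction[OF surface closed null this] obtain s where
    s: "0 < s" "closed_system X \<theta> \<Xi> (shift A s (edge_direction e t t')) (shift G s (\<lambda>_ _. 0))" by blast
  have "(\<Sum>u\<in>triangles X. \<Sum>i\<in>corners X u. dir_corner corner_end X A G (edge_direction e t t') (\<lambda>_ _. 0) u i) = 0"
    using h by (intro sum.neutral ballI) (simp add: dir_corner_def at_corner_def corner_end_hyperideal)
  with max_slope(2)[OF surface closed max null s refl refl] edge_direction_slope[OF h adj e]
  show ?thesis by simp
qed

text \<open>At hyperideal corners the corner angles may move both ways, so the inequality for dG and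
  -dG becomes an equation in \<open>log_radii_split\<close>.\<close>

lemma max_radius:
  assumes h: "\<And>t i. t \<in> triangles X \<Longrightarrow> i \<in> corners X t \<Longrightarrow> at_corner hyperideal_corner X A G t i"
    and null: "null_direction X (\<lambda>_ _. 0) dG"
  shows "(\<Sum>t\<in>triangles X. \<Sum>i\<in>corners X t. ln (at_corner corner_rad X A G t i) * dG t i) \<le> 0"
proof -
  have "eventually (\<lambda>s. at_corner closed_corner X (shift A s (\<lambda>_ _. 0)) (shift G s dG) u i) (at_right 0)"
    if u: "u \<in> triangles X" "i \<in> corners X u" for u i
    unfolding at_corner_def by (rule closed_corner_eventually) (use h[OF u] in \<open>auto simp: at_corner_def\<close>)
  from feasible_direction[OF surface closed null this] obtain s where
    s: "0 < s" "closed_system X \<theta> \<Xi> (shift A s (\<lambda>_ _. 0)) (shift G s dG)" by blast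
  have "(\<Sum>u\<in>triangles X. \<Sum>i\<in>corners X u. dir_corner corner_end X A G (\<lambda>_ _. 0) dG u i) = 0"
    using h by (intro sum.neutral ballI) (simp add: dir_corner_def at_corner_def corner_end_hyperideal)
  with max_slope(2)[OF surface closed max null s refl refl] show ?thesis
    using triangle_slope h by simp
qed

context
  fixes B :: "'t \<Rightarrow> 'e \<Rightarrow> real" and H :: "'t \<Rightarrow> 'v \<Rightarrow> real"
  assumes strict: "strict_system X \<theta> \<Xi> B H" and theta: "\<And>e. e \<in> edges X \<Longrightarrow> 0 \<le> \<theta> e \<and> \<theta> e < pi"
begin

lemma eqsA: "angle_eqs X \<theta> \<Xi> A G" and eqsB: "angle_eqs X \<theta> \<Xi> B H"
  using closed strict by (auto simp: closed_system_def strict_system_def)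

lemma edge_sums:
  assumes "e \<in> edges X"
  shows "(\<Sum>t\<in>adj_triangles X e. A t e) = pi - \<theta> e" "(\<Sum>t\<in>adj_triangles X e. B t e) = pi - \<theta> e"
  using eqsA eqsB assms by (simp_all add: angle_eqs_def)

lemma inward_null: "null_direction X (\<lambda>t e. B t e - A t e) (\<lambda>t i. H t i - G t i)"
  using null_direction_diff[OF eqsA eqsB] .

text \<open>Towards the strict system each triangle contributes a nonnegative coefficient, the
  collapsed ones 0. Maximality bounds the sum by 0, so every contribution vanishes.\<close>

lemma hyperideal_or_collapsed:
  assumes t: "t \<in> triangles X" and ne: "\<And>e. e \<in> sides X t \<Longrightarrow> A t e \<noteq> pi" and i: "i \<in> corners X t"
  shows "at_corner hyperideal_corner X A G t i"
proof -
  define C where "C = (\<lambda>t. \<Sum>v\<in>corners X t. dir_corner corner_end X A G (\<lambda>t e. B t e - A t e) (\<lambda>t i. H t i - G t i) t v)"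
  have nonneg: "0 \<le> C t" if t: "t \<in> triangles X" for t
  proof (cases "\<exists>e\<in>sides X t. A t e = pi")
    case True
    then obtain e where e: "e \<in> sides X t" "A t e = pi" by blast
    obtain i j k b d where l: "labels X t i j k e b d" using labels_exist[OF surface t e(1)] by metis
    have "C t = - (\<Sum>v\<in>corners X t. H t v - G t v)"
      unfolding C_def by (rule collapsed_triangle(6)[OF surface closed t l e(2)])
    also have "\<dots> = 0" using inward_null t by (simp add: null_direction_def)
    finally show ?thesis by simp
  next
    case False
    then show ?thesis unfolding C_def using uncollapsed_triangle(1)[OF surface closed strict t] by blast
  qed
  have sh: "shift A 1 (\<lambda>t e. B t e - A t e) = B" "shift G 1 (\<lambda>t i. H t i - G t i) = H" by (auto simp: fun_eq_iff)
  have "closed_system X \<theta> \<Xi> (shift A 1 (\<lambda>t e. B t e - A t e)) (shift G 1 (\<lambda>t i. H t i - G t i))"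
    unfolding sh by (rule strict_closed[OF strict])
  from max_slope(1)[OF surface closed max inward_null zero_less_one this refl refl]
  have "(\<Sum>t\<in>triangles X. C t) \<le> 0" unfolding C_def .
  then have "(\<Sum>t\<in>triangles X. C t) = 0" using sum_nonneg[of "triangles X" C] nonneg by force
  then have "C t = 0"
    using sum_nonneg_eq_0_iff[OF surface_finite(3)[OF surface], of C] nonneg t by blast
  then show ?thesis using uncollapsed_triangle(2)[OF surface closed strict t ne _ i] unfolding C_def by blast
qed

text \<open>A collapsed triangle with side angle \<open>\<pi>\<close> at \<open>e\<close> has a neighbour across \<open>e\<close>, and the
  angle at \<open>e\<close> of the neighbour is \<open>0\<close>.  Choose the collapsed triangle for which the strict
  system has the least angle at \<open>e\<close>; then the neighbour is not collapsed.\<close>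

lemma extremal_collapsed:
  assumes "t0 \<in> triangles X" "e0 \<in> sides X t0" "A t0 e0 = pi"
  obtains t t' e where "t \<in> triangles X" "t' \<in> triangles X" "t \<noteq> t'" "e \<in> sides X t" "e \<in> sides X t'"
    "adj_triangles X e = {t, t'}" "A t e = pi" "A t' e = 0"
    "\<And>f. f \<in> sides X t' \<Longrightarrow> A t' f \<noteq> pi"
proof -
  define P where "P = {p \<in> Sigma (triangles X) (sides X). A (fst p) (snd p) = pi}"
  have "finite (Sigma (triangles X) (sides X))"
    using surface_finite[OF surface] finite_sides[OF surface] by (intro finite_SigmaI) auto
  then have fin: "finite P" unfolding P_def by simp
  have "(t0, e0) \<in> P" using assms by (simp add: P_def)
  then have ne: "P \<noteq> {}" by blast
  define p where "p = arg_min_on (\<lambda>p. B (fst p) (snd p)) P"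
  have p: "p \<in> P" "\<And>q. q \<in> P \<Longrightarrow> B (fst p) (snd p) \<le> B (fst q) (snd q)"
    using arg_min_if_finite[OF fin ne, of "\<lambda>p. B (fst p) (snd p)"] by (auto simp: p_def not_less)
  obtain t e where te: "p = (t, e)" by (cases p)
  have t: "t \<in> triangles X" and e: "e \<in> sides X t" and A: "A t e = pi" using p(1) te by (auto simp: P_def)
  have edge: "e \<in> edges X" using sides_edges[OF surface t] e by blast
  obtain i j k b d where l: "labels X t i j k e b d" using labels_exist[OF surface t e] by metis
  have lt: "B t e < pi"
    using strict_system_corner[OF surface strict t l] by (auto simp: hyperideal_corner_def)
  show ?thesis
  proof (rule adj_cases[OF surface t e])
    assume "adj_triangles X e = {t}"
    then have "A t e = B t e" using edge_sums[OF edge] by simp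
    then show ?thesis using A lt by simp
  next
    fix t' assume t': "t' \<in> triangles X" "e \<in> sides X t'" "t' \<noteq> t" and adj: "adj_triangles X e = {t, t'}"
    have sums: "A t e + A t' e = pi - \<theta> e" "B t e + B t' e = pi - \<theta> e"
      using edge_sums[OF edge] adj t'(3) by simp_all
    have "0 \<le> A t' e" using closed_system_bounds(1)[OF surface closed t'(1,2)] by simp
    then have th: "A t' e = 0" "\<theta> e = 0" using sums A theta[OF edge] by auto
    obtain i j k b d where l': "labels X t' i j k e b d" using labels_exist[OF surface t'(1,2)] by metis
    have "A t' f \<noteq> pi" if f: "f \<in> sides X t'" for f
    proof
      \<comment> \<open>Minimality gives B t e <= B t' f, which is incompatible with B t e + B t' e
        = pi and B t' e + B t' f < pi.\<close>
      assume pi: "A t' f = pi"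
      then have "f \<noteq> e" using th by auto
      then have "f = b \<or> f = d" using f l' by (auto simp: labels_def)
      then have "B t' e + B t' f < pi"
        using strict_system_corner[OF surface strict t'(1) l'] strict_system_corner[OF surface strict t'(1) labels_rotate[OF l']]
        by (auto simp: hyperideal_corner_def)
      moreover have "B t e \<le> B t' f" using p(2)[of "(t', f)"] te t'(1) f pi by (auto simp: P_def)
      ultimately show False using sums th by simp
    qed
    then show ?thesis using that[of t t' e] t t' e adj A th by auto
  qed
qed

text \<open>D \<kappa> is the slope at the maximum in the direction \<open>dA\<close> plus \<kappa>
  times the direction to the strict system, so D \<kappa> <= 0 for \<kappa> > 0, while D 0 = 0. Yet
  D has a positive coefficient at -\<kappa> ln \<kappa>; the contradiction is
  \<open>log_slope_not_max\<close>, applied to D in place of the volume.\<close>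

lemma not_collapsed:
  assumes "t0 \<in> triangles X" "e0 \<in> sides X t0"
  shows "A t0 e0 \<noteq> pi"
proof
  assume "A t0 e0 = pi"
  then obtain t t' e where t: "t \<in> triangles X" and t': "t' \<in> triangles X" and tt': "t \<noteq> t'"
    and e: "e \<in> sides X t" "e \<in> sides X t'" and adj: "adj_triangles X e = {t, t'}"
    and Ae: "A t e = pi" "A t' e = 0" and nc: "\<And>f. f \<in> sides X t' \<Longrightarrow> A t' f \<noteq> pi"
    using extremal_collapsed[OF assms] by metis
  obtain i j k b d where l: "labels X t i j k e b d" using labels_exist[OF surface t e(1)] by metis
  note l2 = labels_rotate[OF l]
  note l3 = labels_rotate[OF l2]
  note dist = labels_distinct[OF surface t l]
  note col = collapsed_triangle(1-5)[OF surface closed t l Ae(1)]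
  note ht' = hyperideal_or_collapsed[OF t' nc]
  define dA where "dA = edge_direction e t' t"
  have dA: "dA t e = - 1" "dA t' e = 1" "\<And>s f. f \<noteq> e \<Longrightarrow> dA s f = 0" "\<And>s f. s \<noteq> t \<Longrightarrow> s \<noteq> t' \<Longrightarrow> dA s f = 0"
    using tt' by (auto simp: dA_def edge_direction_def)
  have null: "null_direction X dA (\<lambda>_ _. 0)"
    unfolding dA_def by (rule null_edge_direction) (use adj tt' in auto)
  have ev: "eventually (\<lambda>s. at_corner closed_corner X (shift A s dA) (shift G s (\<lambda>_ _. 0)) u v) (at_right 0)"
    if u: "u \<in> triangles X" "v \<in> corners X u" for u v
  proof -
    have base: "at_corner closed_corner X A G u v" using closed u by (auto simp: closed_system_def)
    consider "u = t" | "u = t'" | "u \<noteq> t" "u \<noteq> t'" by blast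
    then show ?thesis
    proof cases
      case 1
      have "eventually (\<lambda>s. s < pi) (at_right (0::real))"
        using eventually_at_right_field[of "\<lambda>s. s < pi" 0] pi_gt_zero by blast
      then show ?thesis
        using eventually_at_right_less[of 0]
      proof eventually_elim
        case (elim s)
        have "v = i \<or> v = j \<or> v = k" using u(2) l 1 by (auto simp: labels_def)
        then show ?case
          using closed_labels[OF surface t l] closed_labels[OF surface t l2] closed_labels[OF surface t l3]
            elim col Ae dist dA 1 by (auto simp: closed_corner_def)
      qed
    next
      case 2
      show ?thesis
        unfolding at_corner_def
        by (rule closed_corner_eventually)
           (use ht' u 2 tt' in \<open>auto simp: at_corner_def dA_def edge_direction_def\<close>)
    next
      case 3
      then show ?thesis using base dA(4)[OF 3] by (simp add: at_corner_def)
    qed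
  qed
  obtain p where p: "0 < p" "closed_system X \<theta> \<Xi> (shift A p dA) (shift G p (\<lambda>_ _. 0))"
    using feasible_direction[OF surface closed null ev] by blast
  define dB where "dB = (\<lambda>t e. B t e - A t e)"
  define dH where "dH = (\<lambda>t i. H t i - G t i)"
  note inull = inward_null[folded dB_def dH_def]
  define D where "D = (\<lambda>\<kappa>. \<Sum>s\<in>triangles X. \<Sum>v\<in>corners X s.
    dir_corner corner_slope X A G (shift dA \<kappa> dB) (shift (\<lambda>_ _. 0) \<kappa> dH) s v)"
  have Dle: "D \<kappa> \<le> 0" if k: "0 < \<kappa>" for \<kappa>
  proof -
    \<comment> \<open>Going p along \<open>dA\<close> and then the fraction u of the way to the
      strict system amounts to going q along the combined direction, because (1 - u) p = q and u = q
      \<kappa>. Convexity therefore makes the combined direction feasible.\<close>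
    define q where "q = p / (1 + p * \<kappa>)"
    define u where "u = p * \<kappa> / (1 + p * \<kappa>)"
    have pos: "1 + p * \<kappa> > 0" using p(1) k by (simp add: add_pos_pos)
    have q: "0 < q" and u: "0 \<le> u" "u \<le> 1" "q * \<kappa> = u" "p - u * p = q"
      using p(1) k pos by (auto simp: q_def u_def field_simps)
    have n1: "null_direction X (\<lambda>t e. B t e - shift A p dA t e) (\<lambda>t i. H t i - shift G p (\<lambda>_ _. 0) t i)"
      using null_direction_diff[OF _ eqsB] p(2) by (simp add: closed_system_def)
    have sh1: "shift (shift A p dA) 1 (\<lambda>t e. B t e - shift A p dA t e) = B"
      "shift (shift G p (\<lambda>_ _. 0)) 1 (\<lambda>t i. H t i - shift G p (\<lambda>_ _. 0) t i) = H" by (auto simp: fun_eq_iff)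
    have "closed_system X \<theta> \<Xi> (shift (shift A p dA) u (\<lambda>t e. B t e - shift A p dA t e))
       (shift (shift G p (\<lambda>_ _. 0)) u (\<lambda>t i. H t i - shift G p (\<lambda>_ _. 0) t i))"
      by (rule closed_system_shift_convex[OF p(2) _ n1 u(1,2)]) (unfold sh1, rule strict_closed[OF strict])
    note cu = this
    have mix: "a + p * d + u * (b - (a + p * d)) = a + q * (d + \<kappa> * (b - a))" for a b d
    proof -
      have "a + p * d + u * (b - (a + p * d)) = a + ((p - u * p) * d + u * (b - a))" by (simp add: algebra_simps)
      also have "\<dots> = a + (q * d + (q * \<kappa>) * (b - a))" unfolding u(3,4) ..
      finally show ?thesis by (simp add: algebra_simps)
    qed
    have "shift (shift A p dA) u (\<lambda>t e. B t e - shift A p dA t e) = shift A q (shift dA \<kappa> dB)"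
      unfolding dB_def mix ..
    moreover have "shift (shift G p (\<lambda>_ _. 0)) u (\<lambda>t i. H t i - shift G p (\<lambda>_ _. 0) t i) = shift G q (shift (\<lambda>_ _. 0) \<kappa> dH)"
      unfolding dH_def mix ..
    ultimately have cq: "closed_system X \<theta> \<Xi> (shift A q (shift dA \<kappa> dB)) (shift G q (shift (\<lambda>_ _. 0) \<kappa> dH))"
      using cu by (simp only:)
    \<comment> \<open>At the order s ln s nothing happens: a collapsed triangle sees only the change
      of its angle sum, and all other corners are hyperideal.\<close>
    have C0: "(\<Sum>v\<in>corners X s. dir_corner corner_end X A G (shift dA \<kappa> dB) (shift (\<lambda>_ _. 0) \<kappa> dH) s v) = 0"
      if s: "s \<in> triangles X" for s
    proof (cases "\<exists>f\<in>sides X s. A s f = pi")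
      case True
      then obtain f where f: "f \<in> sides X s" "A s f = pi" by blast
      obtain i j k b d where l: "labels X s i j k f b d" using labels_exist[OF surface s f(1)] by metis
      have "(\<Sum>v\<in>corners X s. dH s v) = 0" using inull s by (simp add: null_direction_def)
      then show ?thesis
        unfolding collapsed_triangle(6)[OF surface closed s l f(2)] by (simp flip: sum_distrib_left)
    next
      case False
      then show ?thesis
        using hyperideal_or_collapsed[OF s]
        by (intro sum.neutral ballI) (auto simp: dir_corner_def at_corner_def corner_end_hyperideal)
    qed
    have "(\<Sum>s\<in>triangles X. \<Sum>v\<in>corners X s.
        dir_corner corner_end X A G (shift dA \<kappa> dB) (shift (\<lambda>_ _. 0) \<kappa> dH) s v) = 0"
      by (intro sum.neutral ballI C0)
    from max_slope(2)[OF surface closed max null_direction_shift[OF null inull] q cq refl refl this]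
    show ?thesis unfolding D_def .
  qed
  define E where "E = (\<lambda>s v. corner_end2 (G s v) (A s (side1 X s v)) (A s (side2 X s v))
    0 (dA s (side1 X s v)) (dA s (side2 X s v)) (dH s v) (dB s (side1 X s v)) (dB s (side2 X s v)))"
  let ?S = "\<lambda>s v \<kappa>. dir_corner corner_slope X A G (shift dA \<kappa> dB) (shift (\<lambda>_ _. 0) \<kappa> dH) s v"
  define d' where "d' = (\<lambda>s v. SOME d. log_slope (?S s v) (E s v) d)"
  have d': "log_slope (?S s v) (E s v) (d' s v)" for s v
    unfolding d'_def by (rule someI_ex) (unfold dir_corner_def E_def, rule log_slope_corner_slope)
  have slope: "log_slope D (\<Sum>s\<in>triangles X. \<Sum>v\<in>corners X s. E s v) (\<Sum>s\<in>triangles X. \<Sum>v\<in>corners X s. d' s v)"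
    unfolding D_def by (intro log_slope_sum d')
  \<comment> \<open>Along \<open>dA\<close> alone, the singular terms of t cancel by
    \<open>collapse_direction\<close>, and the slope of t' is minus its edge length at e, which is 0
    because \<open>A t' e = 0\<close>.\<close>
  have D0: "D 0 = 0"
    unfolding D_def
  proof (rule sum.neutral, rule ballI)
    fix s assume s: "s \<in> triangles X"
    have simps: "shift dA 0 dB = dA" "shift (\<lambda>_ _. 0) 0 dH = (\<lambda>_ _. 0)" by (auto simp: fun_eq_iff)
    consider "s = t" | "s = t'" | "s \<noteq> t" "s \<noteq> t'" by blast
    then show "(\<Sum>v\<in>corners X s. dir_corner corner_slope X A G (shift dA 0 dB) (shift (\<lambda>_ _. 0) 0 dH) s v) = 0"
      unfolding simps
    proof cases
      case 1
      show "(\<Sum>v\<in>corners X s. dir_corner corner_slope X A G dA (\<lambda>_ _. 0) s v) = 0"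
        unfolding 1 sum_corners[OF surface t l] slope_labels[OF surface t l] slope_labels[OF surface t l2] slope_labels[OF surface t l3]
        using col Ae dA dist collapse_direction corner_slope_zero by simp
    next
      case 2
      have "edge_len X A G t' f * dA t' f = 0" if "f \<in> sides X t'" for f
        using edge_len_0[where A = A, OF t' e(2) Ae(2)] dA(3) by (cases "f = e") auto
      then have "(\<Sum>f\<in>sides X t'. edge_len X A G t' f * dA t' f) = 0" by (intro sum.neutral) blast
      then show "(\<Sum>v\<in>corners X s. dir_corner corner_slope X A G dA (\<lambda>_ _. 0) s v) = 0"
        unfolding 2 using triangle_slope[OF t' ht'] by simp
    next
      case 3
      then show "(\<Sum>v\<in>corners X s. dir_corner corner_slope X A G dA (\<lambda>_ _. 0) s v) = 0"
        using dA(4) by (simp add: dir_corner_def corner_slope_zero)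
    qed
  qed
  have E_labels: "E s v = corner_end2 (G s v) (A s a) (A s c) 0 (dA s a) (dA s c) (dH s v) (dB s a) (dB s c)"
    if "s \<in> triangles X" "labels X s v v' v'' a b c" for s v v' v'' a b c
    using corner_sides_labels[OF surface that] corner_end2_commute unfolding E_def by fastforce
  have "0 < (\<Sum>s\<in>triangles X. \<Sum>v\<in>corners X s. E s v)"
  proof (rule sum_pos2[OF surface_finite(3)[OF surface] t])
    \<comment> \<open>\<open>dA\<close> vanishes at the sides of k, so this corner contributes as in
      \<open>corner_end_collapsed\<close>. The three changes add up to 0, so the total is 2 (dH t i
      + dH t j), positive because these two angles are 0 here and positive in the strict
      system.\<close>
    have "(\<Sum>v\<in>corners X t. E t v) = dH t i + dH t j - dH t k"
      unfolding sum_corners[OF surface t l] E_labels[OF t l] E_labels[OF t l2] E_labels[OF t l3]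
      using col Ae dA dist collapse_direction(1,2) by (simp add: corner_end2_0 corner_end_collapsed closed_corner_def)
    moreover have "dH t i + dH t j + dH t k = 0"
      using inull t sum_corners[OF surface t l, of "dH t"] by (simp add: null_direction_def)
    moreover have "0 < dH t i" "0 < dH t j"
      using strict_system_corner[OF surface strict t l] strict_system_corner[OF surface strict t l2] col
      by (simp_all add: dH_def hyperideal_corner_def)
    ultimately show "0 < (\<Sum>v\<in>corners X t. E t v)" by linarith
    fix s assume s: "s \<in> triangles X"
    show "0 \<le> (\<Sum>v\<in>corners X s. E s v)"
    proof (cases "\<exists>f\<in>sides X s. A s f = pi")
      case False
      then have "(\<Sum>v\<in>corners X s. E s v) = 0"
        using hyperideal_or_collapsed[OF s] unfolding E_def
        by (intro sum.neutral ballI) (auto simp: at_corner_def corner_end2_hyperideal)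
      then show ?thesis by simp
    next
      case True
      then obtain f where f: "f \<in> sides X s" "A s f = pi" by blast
      have "s \<noteq> t'" using f nc by blast
      show ?thesis
      proof (cases "s = t")
        case True
        then show ?thesis using \<open>0 < (\<Sum>v\<in>corners X t. E t v)\<close> by simp
      next
        case False
        obtain i j k b d where l: "labels X s i j k f b d" using labels_exist[OF surface s f(1)] by metis
        \<comment> \<open>In other collapsed triangles \<open>dA\<close> is 0, so E is the
          coefficient of the direction to the strict system alone.\<close>
        have "(\<Sum>v\<in>corners X s. E s v) = (\<Sum>v\<in>corners X s. dir_corner corner_end X A G dB dH s v)"
          using dA(4)[OF False \<open>s \<noteq> t'\<close>] by (simp add: E_def dir_corner_def corner_end2_0)
        also have "\<dots> = 0"
          unfolding collapsed_triangle(6)[OF surface closed s l f(2)] using inull s by (simp add: null_direction_def)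
        finally show ?thesis by simp
      qed
    qed
  qed
  moreover have "eventually (\<lambda>\<kappa>. D \<kappa> \<le> D 0) (at_right 0)"
    using eventually_at_right_less[of 0] by eventually_elim (use Dle D0 in simp)
  ultimately show False using log_slope_not_max[OF slope] by blast
qed

lemma max_hyperideal: "t \<in> triangles X \<Longrightarrow> i \<in> corners X t \<Longrightarrow> at_corner hyperideal_corner X A G t i"
  using hyperideal_or_collapsed not_collapsed by blast

lemma max_strict: "strict_system X \<theta> \<Xi> A G"
proof -
  have "0 < A t e" if t: "t \<in> triangles X" and e: "e \<in> sides X t" for t e
  proof (rule ccontr)
    assume "\<not> 0 < A t e"
    then have A: "A t e = 0" using closed_system_bounds(1)[OF surface closed t e] by simp
    have edge: "e \<in> edges X" using sides_edges[OF surface t] e by blast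
    show False
    proof (rule adj_cases[OF surface t e])
      assume "adj_triangles X e = {t}"
      then show False using edge_sums(1)[OF edge] A theta[OF edge] by simp
    next
      fix t' assume t': "t' \<in> triangles X" "e \<in> sides X t'" "t' \<noteq> t" and adj: "adj_triangles X e = {t, t'}"
      have pos: "0 < A t' e" using edge_sums(1)[OF edge] adj t'(3) A theta[OF edge] by simp
      have "edge_len X A G t' e \<le> edge_len X A G t e"
        by (rule max_edge[OF max_hyperideal adj _ edge pos]) (use t' in auto)
      moreover have "edge_len X A G t e = 0" by (rule edge_len_0[where A = A, OF t e A])
      moreover have "0 < edge_len X A G t' e" by (rule edge_len_pos[OF t'(1,2) pos max_hyperideal[OF t'(1)]])
      ultimately show False by simp
    qed
  qed
  then show ?thesis using eqsA max_hyperideal by (simp add: strict_system_def)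
qed

lemma max_edge_len:
  assumes "e \<in> edges X" "t \<in> adj_triangles X e" "t' \<in> adj_triangles X e"
  shows "edge_len X A G t e = edge_len X A G t' e"
proof (cases "t = t'")
  case False
  have t: "t \<in> triangles X" "e \<in> sides X t" "t' \<in> triangles X" "e \<in> sides X t'" using assms by (auto simp: adj_triangles_def)
  have adj: "adj_triangles X e = {t, t'}"
    by (rule adj_cases[OF surface t(1,2)]) (use assms False in auto)
  have pos: "0 < A t e" "0 < A t' e" using max_strict t by (auto simp: strict_system_def)
  have "edge_len X A G t' e \<le> edge_len X A G t e"
    by (rule max_edge[OF max_hyperideal adj False assms(1) pos(2)])
  moreover have "edge_len X A G t e \<le> edge_len X A G t' e"
    by (rule max_edge[OF max_hyperideal _ _ assms(1) pos(1)]) (use adj False in auto)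
  ultimately show ?thesis by simp
qed simp

end

end

end

text \<open>Supplies Lagrange multipliers. In the induction, either some w in the kernel of the
  functionals in K is not annihilated by \<open>g k\<close>, and subtracting a multiple of
  \<open>g k\<close> from f makes it vanish at w; or \<open>g k\<close> already vanishes on that
  kernel.\<close>

lemma functional_span:
  fixes f :: "'x \<Rightarrow> real" and g :: "'k \<Rightarrow> 'x \<Rightarrow> real"
  assumes "finite K" "finite I"
    and "\<And>v. (\<And>k. k \<in> K \<Longrightarrow> (\<Sum>x\<in>I. g k x * v x) = 0) \<Longrightarrow> (\<Sum>x\<in>I. f x * v x) = 0"
  shows "\<exists>c. \<forall>x\<in>I. f x = (\<Sum>k\<in>K. c k * g k x)"
  using assms(1,3)
proof (induction K arbitrary: f rule: finite_induct)
  case empty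
  have "f y = 0" if "y \<in> I" for y
  proof -
    have "(\<Sum>x\<in>I. f x * (if x = y then 1 else 0)) = (\<Sum>x\<in>I. if x = y then f x else 0)"
      by (rule sum.cong) auto
    then show ?thesis using empty(1)[of "\<lambda>x. if x = y then 1 else 0"] that \<open>finite I\<close> by simp
  qed
  then show ?case by simp
next
  case (insert k K)
  show ?case
  proof (cases "\<exists>w. (\<forall>j\<in>K. (\<Sum>x\<in>I. g j x * w x) = 0) \<and> (\<Sum>x\<in>I. g k x * w x) \<noteq> 0")
    case True
    then obtain w where w: "\<And>j. j \<in> K \<Longrightarrow> (\<Sum>x\<in>I. g j x * w x) = 0" "(\<Sum>x\<in>I. g k x * w x) \<noteq> 0" by blast
    define m where "m = (\<Sum>x\<in>I. f x * w x) / (\<Sum>x\<in>I. g k x * w x)"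
    have "(\<Sum>x\<in>I. (f x - m * g k x) * v x) = 0" if v: "\<And>j. j \<in> K \<Longrightarrow> (\<Sum>x\<in>I. g j x * v x) = 0" for v
    proof -
      \<comment> \<open>Subtracting a w moves v into the kernel of \<open>g k\<close> without
        leaving the kernel of the others.\<close>
      define a where "a = (\<Sum>x\<in>I. g k x * v x) / (\<Sum>x\<in>I. g k x * w x)"
      have lin: "(\<Sum>x\<in>I. h x * (v x - a * w x)) = (\<Sum>x\<in>I. h x * v x) - a * (\<Sum>x\<in>I. h x * w x)" for h :: "'x \<Rightarrow> real"
        by (simp add: right_diff_distrib sum_subtractf sum_distrib_left algebra_simps)
      have "(\<Sum>x\<in>I. f x * (v x - a * w x)) = 0"
      proof (rule insert.prems)
        fix j assume "j \<in> insert k K"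
        then show "(\<Sum>x\<in>I. g j x * (v x - a * w x)) = 0"
          unfolding lin using w v by (auto simp: a_def)
      qed
      then have "(\<Sum>x\<in>I. f x * v x) = a * (\<Sum>x\<in>I. f x * w x)" unfolding lin by simp
      also have "\<dots> = m * (\<Sum>x\<in>I. g k x * v x)" by (simp add: a_def m_def)
      finally show ?thesis
        by (simp add: left_diff_distrib sum_subtractf sum_distrib_left mult.assoc)
    qed
    from insert.IH[OF this] obtain c where c: "\<forall>x\<in>I. f x - m * g k x = (\<Sum>k\<in>K. c k * g k x)" by blast
    have "\<forall>x\<in>I. f x = (\<Sum>j\<in>insert k K. (c(k := m)) j * g j x)"
    proof
      fix x assume "x \<in> I"
      have "(\<Sum>j\<in>K. (c(k := m)) j * g j x) = (\<Sum>j\<in>K. c j * g j x)"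
        using insert.hyps by (intro sum.cong) auto
      then show "f x = (\<Sum>j\<in>insert k K. (c(k := m)) j * g j x)"
        using c \<open>x \<in> I\<close> insert.hyps by (auto simp: algebra_simps)
    qed
    then show ?thesis by blast
  next
    case False
    then have "(\<Sum>x\<in>I. f x * v x) = 0" if "\<And>j. j \<in> K \<Longrightarrow> (\<Sum>x\<in>I. g j x * v x) = 0" for v
      using insert.prems[of v] that by blast
    from insert.IH[OF this] obtain c where c: "\<forall>x\<in>I. f x = (\<Sum>k\<in>K. c k * g k x)" by blast
    have "\<forall>x\<in>I. f x = (\<Sum>j\<in>insert k K. (c(k := 0)) j * g j x)"
    proof
      fix x assume "x \<in> I"
      have "(\<Sum>j\<in>K. (c(k := 0)) j * g j x) = (\<Sum>j\<in>K. c j * g j x)"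
        using insert.hyps by (intro sum.cong) auto
      then show "f x = (\<Sum>j\<in>insert k K. (c(k := 0)) j * g j x)" using c \<open>x \<in> I\<close> insert.hyps by auto
    qed
    then show ?thesis by blast
  qed
qed

section \<open>Coherent angle systems, strict systems and circle patterns\<close>

context
  fixes X :: "('v, 'e, 't) cells"
  assumes surface: "surface_triangulation X"
begin

lemma Delta_of_corners:
  assumes "0 < A t a" "0 < A t b" "0 < A t c"
    and "hyperideal_corner (G t i) (A t a) (A t c)" "hyperideal_corner (G t j) (A t b) (A t a)"
    "hyperideal_corner (G t k) (A t c) (A t b)" "G t i + G t j + G t k = pi"
  shows "(A t a, A t b, A t c, G t i, G t j, G t k) \<in> Delta"
  using assms by (auto simp: Delta_iff hyperideal_corner_def)

lemma strict_system_Delta: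
  assumes s: "strict_system X \<theta> \<Xi> A G" and t: "t \<in> triangles X" and l: "labels X t i j k a b c"
  shows "(A t a, A t b, A t c, G t i, G t j, G t k) \<in> Delta"
proof (rule Delta_of_corners)
  note l2 = labels_rotate[OF l]
  note l3 = labels_rotate[OF l2]
  show "hyperideal_corner (G t i) (A t a) (A t c)" "hyperideal_corner (G t j) (A t b) (A t a)"
    "hyperideal_corner (G t k) (A t c) (A t b)"
    using strict_system_corner[OF surface s t] l l2 l3 by blast+
  have "a \<in> sides X t" "b \<in> sides X t" "c \<in> sides X t" using l by (auto simp: labels_def)
  then show "0 < A t a" "0 < A t b" "0 < A t c" using s t by (auto simp: strict_system_def)
  show "G t i + G t j + G t k = pi"
    using s t sum_corners[OF surface t l, of "G t"] by (simp add: strict_system_def angle_eqs_def)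
qed

lemma strict_system_of_Delta:
  assumes D: "\<And>t i j k a b c. t \<in> triangles X \<Longrightarrow> labels X t i j k a b c \<Longrightarrow>
      (A t a, A t b, A t c, G t i, G t j, G t k) \<in> Delta"
    and E: "\<And>e. e \<in> edges X \<Longrightarrow> (\<Sum>t\<in>adj_triangles X e. A t e) = pi - \<theta> e"
    and V: "\<And>i. i \<in> vertices X \<Longrightarrow> (\<Sum>t\<in>star X i. G t i) = \<Xi> i"
  shows "strict_system X \<theta> \<Xi> A G"
  unfolding strict_system_def angle_eqs_def
proof (intro conjI ballI E V)
  fix t assume t: "t \<in> triangles X"
  obtain i j k a b c where l: "labels X t i j k a b c" using labels_exist_any[OF surface t] by metis
  show "(\<Sum>i\<in>corners X t. G t i) = pi"
    using D[OF t l] sum_corners[OF surface t l, of "G t"] by (simp add: Delta_iff)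
  show "0 < A t e" if e: "e \<in> sides X t" for e
  proof -
    obtain i j k b c where "labels X t i j k e b c" using labels_exist[OF surface t e] by metis
    from D[OF t this] show ?thesis by (simp add: Delta_iff)
  qed
  show "at_corner hyperideal_corner X A G t i" if i: "i \<in> corners X t" for i
  proof -
    obtain j k a b c where l: "labels X t i j k a b c" using labels_exist_corner[OF surface t i] by metis
    show ?thesis unfolding hyperideal_labels[OF surface t l] using Delta_corners(1)[OF D[OF t l]] .
  qed
qed auto

lemma adj_nonempty:
  assumes "e \<in> edges X" obtains t where "t \<in> triangles X" "e \<in> sides X t"
proof -
  have "card (adj_triangles X e) \<noteq> 0" using surface assms by (auto simp: surface_triangulation_def)
  then have "adj_triangles X e \<noteq> {}" by auto
  then show ?thesis using that by (auto simp: adj_triangles_def)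
qed

text \<open>At a boundary edge the condition \<theta> e > 0 follows from strictness, since a side
  angle of a triangle in \<open>Delta\<close> is below \<open>pi\<close>.\<close>

lemma coherent_iff_strict:
  "coherent_angle_systems X \<theta> \<Xi> \<noteq> {} \<longleftrightarrow> (\<exists>A G. strict_system X \<theta> \<Xi> A G)"
proof
  assume "coherent_angle_systems X \<theta> \<Xi> \<noteq> {}"
  then obtain A G where AG: "(A, G) \<in> coherent_angle_systems X \<theta> \<Xi>" by auto
  then have D: "\<And>t i j k a b c. t \<in> triangles X \<Longrightarrow> labels X t i j k a b c \<Longrightarrow>
      (A t a, A t b, A t c, G t i, G t j, G t k) \<in> Delta"
    and E2: "\<And>e t t'. e \<in> edges X \<Longrightarrow> adj_triangles X e = {t, t'} \<Longrightarrow> t \<noteq> t' \<Longrightarrow> A t e + A t' e = pi - \<theta> e"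
    and E1: "\<And>e t. e \<in> edges X \<Longrightarrow> adj_triangles X e = {t} \<Longrightarrow> A t e = pi - \<theta> e"
    and V: "\<And>i. i \<in> vertices X \<Longrightarrow> (\<Sum>t\<in>star X i. G t i) = \<Xi> i"
    unfolding coherent_angle_systems_def by blast+
  have "(\<Sum>t\<in>adj_triangles X e. A t e) = pi - \<theta> e" if e: "e \<in> edges X" for e
  proof -
    obtain t where t: "t \<in> triangles X" "e \<in> sides X t" using adj_nonempty[OF e] .
    show ?thesis
      by (rule adj_cases[OF surface t]) (use E1[OF e] E2[OF e] in auto)
  qed
  with D V have "strict_system X \<theta> \<Xi> A G" by (intro strict_system_of_Delta) blast+
  then show "\<exists>A G. strict_system X \<theta> \<Xi> A G" by blast
next
  assume "\<exists>A G. strict_system X \<theta> \<Xi> A G"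
  then obtain A G where s: "strict_system X \<theta> \<Xi> A G" by blast
  have E: "(\<Sum>t\<in>adj_triangles X e. A t e) = pi - \<theta> e" if "e \<in> edges X" for e
    using s that by (simp add: strict_system_def angle_eqs_def)
  have E1: "\<theta> e > 0 \<and> A t e = pi - \<theta> e" if e: "e \<in> edges X" and adj: "adj_triangles X e = {t}" for e t
  proof -
    have A: "A t e = pi - \<theta> e" using E[OF e] adj by simp
    have "t \<in> adj_triangles X e" using adj by simp
    then have t: "t \<in> triangles X" "e \<in> sides X t" by (auto simp: adj_triangles_def)
    obtain i j k b c where "labels X t i j k e b c" using labels_exist[OF surface t] by metis
    then have "A t e < pi" using strict_system_Delta[OF s t(1)] by (fastforce simp: Delta_iff)
    then show ?thesis using A by simp
  qed
  have E2: "A t e + A t' e = pi - \<theta> e" if "e \<in> edges X" "adj_triangles X e = {t, t'}" "t \<noteq> t'" for e t t'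
    using E[OF that(1)] that by simp
  have V: "(\<Sum>t\<in>star X i. G t i) = \<Xi> i" if "i \<in> vertices X" for i
    using s that by (simp add: strict_system_def angle_eqs_def)
  have "(A, G) \<in> coherent_angle_systems X \<theta> \<Xi>"
    unfolding coherent_angle_systems_def mem_Collect_eq prod.case
  proof (intro conjI ballI allI impI)
    fix t i j k a b c assume "t \<in> triangles X" "labels X t i j k a b c"
    then show "(A t a, A t b, A t c, G t i, G t j, G t k) \<in> Delta" by (rule strict_system_Delta[OF s])
  next
    fix e t t' assume "e \<in> edges X" "adj_triangles X e = {t, t'} \<and> t \<noteq> t'"
    then show "A t e + A t' e = pi - \<theta> e" by (intro E2) auto
  next
    fix e t assume "e \<in> edges X" "adj_triangles X e = {t}"
    then show "0 < \<theta> e" by (rule E1[THEN conjunct1])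
  next
    fix e t assume "e \<in> edges X" "adj_triangles X e = {t}"
    then show "A t e = pi - \<theta> e" by (rule E1[THEN conjunct2])
  next
    fix i assume "i \<in> vertices X"
    then show "(\<Sum>t\<in>star X i. G t i) = \<Xi> i" by (rule V)
  qed
  then show "coherent_angle_systems X \<theta> \<Xi> \<noteq> {}" by blast
qed

lemma pattern_strict:
  assumes p: "circle_pattern_with_angles X \<theta> \<Xi> l r"
  shows "strict_system X \<theta> \<Xi> (side_angle X l r) (corner_angle X l)"
proof (rule strict_system_of_Delta)
  have h: "hyperideal_circle_pattern X l r" using p by (simp add: circle_pattern_with_angles_def)
  show "(side_angle X l r t a, side_angle X l r t b, side_angle X l r t c, corner_angle X l t i,
      corner_angle X l t j, corner_angle X l t k) \<in> Delta"
    if "t \<in> triangles X" "labels X t i j k a b c" for t i j k a b c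
    using pattern_realizes[OF surface h that(1)] realizes_labels(2)[OF surface _ that(2)] by blast
  show "(\<Sum>t\<in>adj_triangles X e. side_angle X l r t e) = pi - \<theta> e" if "e \<in> edges X" for e
    using p that by (auto simp: circle_pattern_with_angles_def intersection_angle_def)
  show "(\<Sum>t\<in>star X i. corner_angle X l t i) = \<Xi> i" if "i \<in> vertices X" for i
    using p that by (auto simp: circle_pattern_with_angles_def cone_angle_def)
qed

lemma foot_cosh_law:
  assumes D: "(A t a, A t b, A t c, G t i, G t j, G t k) \<in> Delta"
    and t: "t \<in> triangles X" and l: "labels X t i j k a b c"
    and r: "ri = R * corner_rad (G t i) (A t a) (A t c)" "rj = R * corner_rad (G t j) (A t b) (A t a)"
    and la: "la = R * (corner_foot (G t i) (A t a) (A t c) + corner_foot (G t j) (A t a) (A t b))"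
  shows "la\<^sup>2 = ri\<^sup>2 + rj\<^sup>2 + 2 * ri * rj * cosh (edge_len X A G t a)"
  unfolding edge_len_labels[OF surface t l]
  using cosh_law[OF Delta_corners(1)[OF D] Delta_corners(4)[OF D] la r(1)] r(2)
  by (simp add: corner_rad_commute)

lemma realizes_cosh_law:
  assumes re: "realizes X l r t R (A t) (G t)" and t: "t \<in> triangles X" and l: "labels X t i j k a b c"
  shows "(l a)\<^sup>2 = (r i)\<^sup>2 + (r j)\<^sup>2 + 2 * r i * r j * cosh (edge_len X A G t a)"
  using foot_cosh_law[where A = A and G = G, OF realizes_labels(2)[OF surface re l] t l realizes_labels(3)[OF surface re l]
      realizes_labels(3)[OF surface re labels_rotate[OF l]] realizes_labels(4)[OF surface re l]] .

lemma strict_edge_len_pos: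
  assumes s: "strict_system X \<theta> \<Xi> A G" and t: "t \<in> triangles X" "e \<in> sides X t"
  shows "0 < edge_len X A G t e"
  by (rule edge_len_pos[OF surface t]) (use s t in \<open>auto simp: strict_system_def\<close>)

lemma labels_across:
  assumes t: "t \<in> triangles X" "labels X t i j k e b c" and t': "t' \<in> triangles X" "e \<in> sides X t'"
  obtains m b' c' where "labels X t' i j m e b' c'"
proof -
  obtain i' j' m b' c' where l: "labels X t' i' j' m e b' c'" using labels_exist[OF surface t'] by metis
  have "{i', j'} = {i, j}" using l t(2) by (auto simp: labels_def)
  then have "(i' = i \<and> j' = j) \<or> (i' = j \<and> j' = i)" by (auto simp: doubleton_eq_iff)
  then show ?thesis using that l labels_reflect[OF l] by blast
qed

text \<open>The two triangles share the euclidean length of e and the radii at its ends. The cosh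
  law recovers the cosh of the hyperbolic length from these data, and both hyperbolic lengths are
  positive.\<close>

lemma realizes_edge_len:
  assumes s: "strict_system X \<theta> \<Xi> A G"
    and re: "\<And>t. t \<in> triangles X \<Longrightarrow> realizes X l r t (R t) (A t) (G t)"
    and t: "t \<in> adj_triangles X e" "t' \<in> adj_triangles X e"
  shows "edge_len X A G t e = edge_len X A G t' e"
proof -
  have t': "t \<in> triangles X" "e \<in> sides X t" "t' \<in> triangles X" "e \<in> sides X t'"
    using t by (auto simp: adj_triangles_def)
  obtain i j k b c where l: "labels X t i j k e b c" using labels_exist[OF surface t'(1,2)] by metis
  obtain m b' c' where l': "labels X t' i j m e b' c'" using labels_across[OF t'(1) l t'(3,4)] .
  have pos: "0 < r i" "0 < r j"
    using realizes_triangle(3)[OF surface re[OF t'(1)] t'(1)] l labels_rotate[OF l] by blast+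
  have "cosh (edge_len X A G t e) = cosh (edge_len X A G t' e)"
    using realizes_cosh_law[where A = A and G = G, OF re[OF t'(1)] t'(1) l] realizes_cosh_law[where A = A and G = G, OF re[OF t'(3)] t'(3) l'] pos by simp
  moreover have "0 < edge_len X A G t e" "0 < edge_len X A G t' e"
    using strict_edge_len_pos[OF s] t' by blast+
  ultimately show ?thesis by (metis arcosh_cosh_real less_imp_le)
qed

section \<open>Existence\<close>

text \<open>By \<open>max_radius\<close> the logarithms of the radii annihilate every change of
  corner angles whose sums in the triangles and at the vertices are 0. p and q are the multipliers
  of these two families of constraints.\<close>

lemma log_radii_split:
  assumes "strict_system X \<theta> \<Xi> B H" and "\<And>e. e \<in> edges X \<Longrightarrow> 0 \<le> \<theta> e \<and> \<theta> e < pi"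
    and closed: "closed_system X \<theta> \<Xi> A G"
    and max: "\<And>B H. closed_system X \<theta> \<Xi> B H \<Longrightarrow> volume X B H \<le> volume X A G"
  obtains p q where "\<And>t i. t \<in> triangles X \<Longrightarrow> i \<in> corners X t \<Longrightarrow>
    ln (at_corner corner_rad X A G t i) = p t + q i"
proof -
  note h = max_hyperideal[OF surface closed max assms(1,2)]
  let ?T = "triangles X" and ?V = "vertices X"
  let ?I = "Sigma ?T (corners X)"
  let ?K = "Inl ` ?T \<union> Inr ` ?V"
  \<comment> \<open>As coefficient vectors over the pairs of a triangle and a corner,
    \<open>Inl s\<close> is the angle sum in the triangle s and \<open>Inr j\<close> the angle sum
    at the vertex j.\<close>
  define g where "g = (\<lambda>k (x :: 't \<times> 'v). case k of Inl s \<Rightarrow> if fst x = s then 1 else 0 | Inr j \<Rightarrow> if snd x = j then 1 else (0::real))"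
  define f where "f = (\<lambda>x. ln (at_corner corner_rad X A G (fst x) (snd x)))"
  have fin: "finite ?T" "finite ?V" using surface_finite[OF surface] by auto
  have finI: "finite ?I" using fin finite_corners[OF surface] by (intro finite_SigmaI) auto
  have sig: "(\<Sum>x\<in>?I. u (fst x) (snd x)) = (\<Sum>t\<in>?T. \<Sum>i\<in>corners X t. u t i)" for u :: "'t \<Rightarrow> 'v \<Rightarrow> real"
    using sum.Sigma[of ?T "corners X" u] fin finite_corners[OF surface] by (simp add: split_beta)
  have "\<exists>c. \<forall>x\<in>?I. f x = (\<Sum>k\<in>?K. c k * g k x)"
  proof (rule functional_span)
    show "finite ?K" using fin by simp
    show "finite ?I" by (rule finI)
    fix v assume v: "\<And>k. k \<in> ?K \<Longrightarrow> (\<Sum>x\<in>?I. g k x * v x) = 0"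
    define dG where "dG = (\<lambda>t i. v (t, i))"
    have row: "(\<Sum>i\<in>corners X t. dG t i) = 0" if t: "t \<in> ?T" for t
    proof -
      have "0 = (\<Sum>x\<in>?I. (\<lambda>s i. (if s = t then 1 else 0) * dG s i) (fst x) (snd x))"
        using v[of "Inl t"] t by (simp add: g_def dG_def)
      also have "\<dots> = (\<Sum>s\<in>?T. \<Sum>i\<in>corners X s. (if s = t then 1 else 0) * dG s i)"
        by (rule sig)
      also have "\<dots> = (\<Sum>s\<in>?T. if s = t then (\<Sum>i\<in>corners X t. dG t i) else 0)"
        by (intro sum.cong) auto
      also have "\<dots> = (\<Sum>i\<in>corners X t. dG t i)" using t fin by simp
      finally show ?thesis by simp
    qed
    have col: "(\<Sum>t\<in>star X j. dG t j) = 0" if j: "j \<in> ?V" for j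
    proof -
      have "0 = (\<Sum>x\<in>?I. (\<lambda>s i. (if i = j then 1 else 0) * dG s i) (fst x) (snd x))"
        using v[of "Inr j"] j by (simp add: g_def dG_def)
      also have "\<dots> = (\<Sum>s\<in>?T. \<Sum>i\<in>corners X s. (if i = j then 1 else 0) * dG s i)"
        by (rule sig)
      also have "\<dots> = (\<Sum>i\<in>?V. if i = j then (\<Sum>t\<in>star X j. dG t j) else 0)"
        unfolding sum_corners_swap[OF surface] by (intro sum.cong) auto
      also have "\<dots> = (\<Sum>t\<in>star X j. dG t j)" using j fin by simp
      finally show ?thesis by simp
    qed
    have null: "null_direction X (\<lambda>_ _. 0) dG" "null_direction X (\<lambda>_ _. 0) (\<lambda>t i. - dG t i)"
      using row col by (simp_all add: null_direction_def sum_negf)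
    have "(\<Sum>t\<in>?T. \<Sum>i\<in>corners X t. ln (at_corner corner_rad X A G t i) * dG t i) = 0"
      using max_radius[OF surface closed max h null(1)] max_radius[OF surface closed max h null(2)]
      by (simp add: sum_negf)
    then show "(\<Sum>x\<in>?I. f x * v x) = 0"
      using sig[of "\<lambda>t i. ln (at_corner corner_rad X A G t i) * dG t i"] by (simp add: f_def dG_def)
  qed
  then obtain c where c: "\<And>x. x \<in> ?I \<Longrightarrow> f x = (\<Sum>k\<in>?K. c k * g k x)" by blast
  show ?thesis
  proof (rule that[of "\<lambda>t. c (Inl t)" "\<lambda>i. c (Inr i)"])
    fix t i assume t: "t \<in> triangles X" and i: "i \<in> corners X t"
    have "ln (at_corner corner_rad X A G t i) = (\<Sum>k\<in>?K. c k * g k (t, i))"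
      using c[of "(t, i)"] t i by (simp add: f_def)
    also have "\<dots> = (\<Sum>k\<in>Inl ` ?T. c k * g k (t, i)) + (\<Sum>k\<in>Inr ` ?V. c k * g k (t, i))"
      using fin by (intro sum.union_disjoint) auto
    also have "(\<Sum>k\<in>Inl ` ?T. c k * g k (t, i)) = (\<Sum>s\<in>?T. if s = t then c (Inl t) else 0)"
      by (subst sum.reindex) (auto simp: g_def intro!: sum.cong)
    also have "\<dots> = c (Inl t)" using t fin by simp
    also have "(\<Sum>k\<in>Inr ` ?V. c k * g k (t, i)) = (\<Sum>j\<in>?V. if j = i then c (Inr i) else 0)"
      by (subst sum.reindex) (auto simp: g_def intro!: sum.cong)
    also have "\<dots> = c (Inr i)" using corners_vertices[OF surface t] i fin by auto
    finally show "ln (at_corner corner_rad X A G t i) = c (Inl t) + c (Inr i)" .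
  qed
qed

text \<open>Side angles adding up to at most \<open>pi\<close> are the hypothesis of
  \<open>delaunay_plane\<close>; at a boundary edge the condition is vacuous.\<close>

lemma realizes_delaunay:
  assumes re: "\<And>t. t \<in> triangles X \<Longrightarrow> realizes X l r t (R t) (A t) (G t)"
    and sum: "(\<Sum>t\<in>adj_triangles X e. A t e) \<le> pi"
  shows "locally_delaunay X l r e"
  unfolding locally_delaunay_def
proof (intro allI impI, elim conjE)
  fix t t' p q
  assume adj: "adj_triangles X e = {t, t'}" and ne: "t \<noteq> t'" and ab: "abutting_layouts X l e t t' p q"
  have "t \<in> adj_triangles X e" "t' \<in> adj_triangles X e" using adj by auto
  then have t: "t \<in> triangles X" "e \<in> sides X t" "t' \<in> triangles X" "e \<in> sides X t'" by (auto simp: adj_triangles_def)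
  obtain i j k b c where L: "labels X t i j k e b c" using labels_exist[OF surface t(1,2)] by metis
  obtain m b' c' where L': "labels X t' i j m e b' c'" using labels_across[OF t(1) L t(3,4)] .
  have opp: "opposite_corner X t e = k" "opposite_corner X t' e = m"
    using opposite_corner_eq[OF surface t(1) L] opposite_corner_eq[OF surface t(3) L'] by auto
  have ends: "ends X e = {i, j}" using L by (simp add: labels_def)
  have ab': "is_layout X l t p" "is_layout X l t' q" "p i = q i" "p j = q j"
    "signed_dist (affine hull {p i, p j}) (p k) (q m) < 0"
    using ab unfolding abutting_layouts_def opp ends image_insert image_empty by blast+
  note re1 = re[OF t(1)] and re2 = re[OF t(3)]
  have d: "dist (p i) (p j) = l e" "dist (p j) (p k) = l b" "dist (p k) (p i) = l c"
    using ab'(1) is_layout_iff[OF surface t(1) L] by auto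
  have d': "dist (p i) (p j) = l e" "dist (p j) (q m) = l b'" "dist (q m) (p i) = l c'"
    using ab' is_layout_iff[OF surface t(3) L'] by auto
  note tri = realizes_triangle[OF surface re1 t(1) L] and tri' = realizes_triangle[OF surface re2 t(3) L']
  note pos = tri(3) realizes_triangle(3)[OF surface re1 t(1) labels_rotate[OF L]]
  obtain c0 where c0: "orthogonal_circle (p i) (p j) (p k) (r i) (r j) (r k) c0 (R t)"
    "signed_dist (affine hull {p i, p j}) (p k) c0 = R t * cos (A t e)"
    using realizes_circle[OF surface re1 t(1) L ab'(1)] .
  obtain c1 where c1: "orthogonal_circle (p i) (p j) (q m) (r i) (r j) (r m) c1 (R t')"
    "signed_dist (affine hull {p i, p j}) (q m) c1 = R t' * cos (A t' e)"
    using realizes_circle[OF surface re2 t(3) L' ab'(2)] ab'(3,4) by metis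
  have R: "0 < R t" "0 < R t'" using c0(1) c1(1) by (simp_all add: orthogonal_circle_def)
  have "arccos (cos (A t e)) = A t e" "arccos (cos (A t' e)) = A t' e"
    using realizes_labels(2)[OF surface re1 L] realizes_labels(2)[OF surface re2 L']
    by (auto simp: Delta_iff intro!: arccos_cos)
  moreover have "A t e + A t' e \<le> pi" using sum adj ne by simp
  ultimately have le: "arccos (signed_dist (affine hull {p i, p j}) (p k) c0 / R t)
      + arccos (signed_dist (affine hull {p i, p j}) (q m) c1 / R t') \<le> pi"
    unfolding c0(2) c1(2) using R by simp
  have "(R t)\<^sup>2 + (r m)\<^sup>2 \<le> (dist c0 (q m))\<^sup>2"
    by (rule delaunay_plane[OF _ _ pos _ c0(1) c1(1) ab'(5) le])
       (use tri tri' d d' in simp_all)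
  moreover have "face_circle (corners X t) p r = (c0, R t)"
    by (rule face_circle_eq[OF surface L _ c0(1)]) (use tri d in simp)
  ultimately show "let (c, R) = face_circle (corners X t) p r; m = opposite_corner X t' e
         in (dist c (q m))\<^sup>2 \<ge> R\<^sup>2 + (r m)\<^sup>2"
    by (simp add: opp)
qed

lemma pattern_of_realizes:
  assumes re: "\<And>t. t \<in> triangles X \<Longrightarrow> realizes X l r t (R t) (A t) (G t)"
    and s: "strict_system X \<theta> \<Xi> A G" and theta: "\<And>e. e \<in> edges X \<Longrightarrow> 0 \<le> \<theta> e"
  shows "circle_pattern_with_angles X \<theta> \<Xi> l r"
proof -
  have E: "(\<Sum>t\<in>adj_triangles X e. A t e) = pi - \<theta> e" if "e \<in> edges X" for e
    using s that by (simp add: strict_system_def angle_eqs_def)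
  have V: "(\<Sum>t\<in>star X i. G t i) = \<Xi> i" if "i \<in> vertices X" for i
    using s that by (simp add: strict_system_def angle_eqs_def)
  have edge: "0 < l e \<and> (\<forall>i j. ends X e = {i, j} \<longrightarrow> r i + r j < l e)" if e: "e \<in> edges X" for e
  proof -
    obtain t where t: "t \<in> triangles X" "e \<in> sides X t" using adj_nonempty[OF e] .
    obtain i j k b c where L: "labels X t i j k e b c" using labels_exist[OF surface t] by metis
    note tri = realizes_triangle(1,2)[OF surface re[OF t(1)] t(1) L]
    have "r i' + r j' < l e" if "ends X e = {i', j'}" for i' j'
    proof -
      have "{i', j'} = {i, j}" using that L by (simp add: labels_def)
      then have "(i' = i \<and> j' = j) \<or> (i' = j \<and> j' = i)" by (auto simp: doubleton_eq_iff)
      then show ?thesis using tri(2) by auto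
    qed
    then show ?thesis using triangle_ineqs_pos[OF tri(1)] by blast
  qed
  have "0 < r i" if i: "i \<in> vertices X" for i
  proof -
    have "star X i \<noteq> {}" using surface i by (auto simp: surface_triangulation_def)
    then obtain t where t: "t \<in> triangles X" "i \<in> corners X t" by (auto simp: star_def)
    obtain j k a b c where L: "labels X t i j k a b c" using labels_exist_corner[OF surface t] by metis
    show ?thesis by (rule realizes_triangle(3)[OF surface re[OF t(1)] t(1) L])
  qed
  moreover have "l a < l b + l c \<and> l b < l c + l a \<and> l c < l a + l b"
    if "t \<in> triangles X" "labels X t i j k a b c" for t i j k a b c
    using realizes_triangle(1)[OF surface re[OF that(1)] that] by (auto simp: triangle_ineqs_def)
  moreover have "locally_delaunay X l r e" if e: "e \<in> edges X" for e
    by (rule realizes_delaunay[OF re]) (use E[OF e] theta[OF e] in auto)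
  ultimately have h: "hyperideal_circle_pattern X l r"
    using edge unfolding hyperideal_circle_pattern_def by blast
  have "intersection_angle X l r e = \<theta> e" if e: "e \<in> edges X" for e
  proof -
    have "(\<Sum>t\<in>adj_triangles X e. side_angle X l r t e) = (\<Sum>t\<in>adj_triangles X e. A t e)"
      using realizes_side_angle[OF surface re] by (intro sum.cong) (auto simp: adj_triangles_def)
    then show ?thesis using E[OF e] by (simp add: intersection_angle_def)
  qed
  moreover have "cone_angle X l i = \<Xi> i" if i: "i \<in> vertices X" for i
  proof -
    have "corner_angle X l t i = G t i" if t: "t \<in> star X i" for t
    proof -
      have t': "t \<in> triangles X" "i \<in> corners X t" using t by (auto simp: star_def)
      obtain j k a b c where L: "labels X t i j k a b c" using labels_exist_corner[OF surface t'] by metis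
      show ?thesis by (rule realizes_triangle(4)[OF surface re[OF t'(1)] t'(1) L])
    qed
    then show ?thesis using V[OF i] by (simp add: cone_angle_def)
  qed
  ultimately show ?thesis using h by (simp add: circle_pattern_with_angles_def)
qed

lemma pattern_exists:
  assumes strict: "strict_system X \<theta> \<Xi> B H" and theta: "\<And>e. e \<in> edges X \<Longrightarrow> 0 \<le> \<theta> e \<and> \<theta> e < pi"
  shows "\<exists>l r. circle_pattern_with_angles X \<theta> \<Xi> l r"
proof -
  obtain A G where closed: "closed_system X \<theta> \<Xi> A G"
    and max: "\<And>B H. closed_system X \<theta> \<Xi> B H \<Longrightarrow> volume X B H \<le> volume X A G"
    using volume_max_exists[OF surface strict_closed[OF strict]] by metis
  note s = max_strict[OF surface closed max strict theta]
  obtain p q where pq: "\<And>t i. t \<in> triangles X \<Longrightarrow> i \<in> corners X t \<Longrightarrow>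
    ln (at_corner corner_rad X A G t i) = p t + q i"
    using log_radii_split[OF strict theta closed max] by metis
  \<comment> \<open>With the split of the logarithm into p t + q i, the quotient r i / R t becomes
    the normalized radius at the corner i in every triangle t around i.\<close>
  define r where "r = (\<lambda>i. exp (q i))"
  define R where "R = (\<lambda>t. exp (- p t))"
  define len where "len = (\<lambda>t e. R t * (\<Sum>i\<in>ends X e. corner_foot (G t i) (A t e) (A t (other_side X t i e))))"
  \<comment> \<open>Any adjacent triangle may be chosen: \<open>len_eq\<close> shows, by the cosh
    law and \<open>max_edge_len\<close>, that all of them assign the same length to e.\<close>
  define l where "l = (\<lambda>e. len (SOME t. t \<in> adj_triangles X e) e)"
  have R: "0 < R t" for t by (simp add: R_def)
  have D: "(A t a, A t b, A t c, G t i, G t j, G t k) \<in> Delta"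
    if "t \<in> triangles X" "labels X t i j k a b c" for t i j k a b c
    by (rule strict_system_Delta[OF s that])
  have rad: "r i = R t * corner_rad (G t i) (A t a) (A t c)"
    if t: "t \<in> triangles X" and L: "labels X t i j k a b c" for t i j k a b c
  proof -
    have i: "i \<in> corners X t" using L by (simp add: labels_def)
    have "0 < corner_rad (G t i) (A t a) (A t c)"
      by (rule corner_rad_pos[OF Delta_corners(1)[OF D[OF t L]]])
    then have "corner_rad (G t i) (A t a) (A t c) = exp (p t + q i)"
      using pq[OF t i] unfolding at_corner_labels[where \<phi> = corner_rad, OF surface t L corner_rad_commute]
      by (metis exp_ln)
    then show ?thesis by (simp add: r_def R_def flip: exp_add)
  qed
  have len: "len t a = R t * (corner_foot (G t i) (A t a) (A t c) + corner_foot (G t j) (A t a) (A t b))"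
    if t: "t \<in> triangles X" and L: "labels X t i j k a b c" for t i j k a b c
  proof -
    note d = labels_distinct[OF surface t L]
    have "other_side X t i a = c" "other_side X t j a = b"
      using corner_sides_labels[OF surface t L] corner_sides_labels[OF surface t labels_rotate[OF L]] d
      by (auto simp: other_side_def)
    moreover have "ends X a = {i, j}" using L by (simp add: labels_def)
    ultimately show ?thesis using d by (simp add: len_def)
  qed
  have len_eq: "len t e = len t' e" if t: "t \<in> adj_triangles X e" "t' \<in> adj_triangles X e" for t t' e
  proof -
    have t': "t \<in> triangles X" "e \<in> sides X t" "t' \<in> triangles X" "e \<in> sides X t'"
      using t by (auto simp: adj_triangles_def)
    have edge: "e \<in> edges X" using sides_edges[OF surface t'(1)] t'(2) by blast
    obtain i j k b c where L: "labels X t i j k e b c" using labels_exist[OF surface t'(1,2)] by metis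
    obtain m b' c' where L': "labels X t' i j m e b' c'" using labels_across[OF t'(1) L t'(3,4)] .
    have "edge_len X A G t e = edge_len X A G t' e"
      by (rule max_edge_len[OF surface closed max strict theta edge t])
    then have "(len t e)\<^sup>2 = (len t' e)\<^sup>2"
      using foot_cosh_law[where A = A and G = G, OF D[OF t'(1) L] t'(1) L rad[OF t'(1) L] rad[OF t'(1) labels_rotate[OF L]] len[OF t'(1) L]]
        foot_cosh_law[where A = A and G = G, OF D[OF t'(3) L'] t'(3) L' rad[OF t'(3) L'] rad[OF t'(3) labels_rotate[OF L']] len[OF t'(3) L']]
      by simp
    moreover have "0 < len t e" "0 < len t' e"
      unfolding len[OF t'(1) L] len[OF t'(3) L']
      using R Delta_corners[OF D[OF t'(1) L]] Delta_corners[OF D[OF t'(3) L']] corner_foot_pos(1)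
      by (simp_all add: add_pos_pos)
    ultimately show ?thesis by (simp add: power2_eq_iff)
  qed
  have "realizes X l r t (R t) (A t) (G t)" if t: "t \<in> triangles X" for t
    unfolding realizes_def[OF surface]
  proof (intro conjI allI impI R)
    fix i j k a b c assume L: "labels X t i j k a b c"
    show "(A t a, A t b, A t c, G t i, G t j, G t k) \<in> Delta" by (rule D[OF t L])
    show "r i = R t * corner_rad (G t i) (A t a) (A t c)" by (rule rad[OF t L])
    have mem: "t \<in> adj_triangles X a" using t L by (auto simp: adj_triangles_def labels_def)
    then have "(SOME t. t \<in> adj_triangles X a) \<in> adj_triangles X a" by (rule someI)
    then have "l a = len t a" unfolding l_def using mem by (rule len_eq)
    then show "l a = R t * (corner_foot (G t i) (A t a) (A t c) + corner_foot (G t j) (A t a) (A t b))"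
      using len[OF t L] by simp
  qed
  then have "circle_pattern_with_angles X \<theta> \<Xi> l r"
    using pattern_of_realizes[of l r R A G] s theta by blast
  then show ?thesis by blast
qed

section \<open>Uniqueness\<close>

lemma triangle_monotone:
  assumes s: "strict_system X \<theta> \<Xi> A G" and s': "strict_system X \<theta> \<Xi> B H" and t: "t \<in> triangles X"
  defines "\<delta> \<equiv> (\<Sum>i\<in>corners X t. (ln (at_corner corner_rad X B H t i) - ln (at_corner corner_rad X A G t i)) * (H t i - G t i))
    - (\<Sum>e\<in>sides X t. (edge_len X B H t e - edge_len X A G t e) * (B t e - A t e))"
  shows "\<delta> \<le> 0" "\<delta> = 0 \<Longrightarrow> (\<forall>e\<in>sides X t. B t e = A t e) \<and> (\<forall>i\<in>corners X t. H t i = G t i)"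
proof -
  obtain i j k a b c where l: "labels X t i j k a b c" using labels_exist_any[OF surface t] by metis
  note l2 = labels_rotate[OF l]
  note l3 = labels_rotate[OF l2]
  note rad = at_corner_labels[where \<phi> = corner_rad, OF surface t _ corner_rad_commute]
  note \<delta> = \<delta>_def[unfolded sum_corners[OF surface t l] sum_sides[OF surface t l] rad[OF l] rad[OF l2] rad[OF l3]
      edge_len_labels[OF surface t l] edge_len_labels[OF surface t l2] edge_len_labels[OF surface t l3]]
  have cs: "corners X t = {i, j, k}" "sides X t = {a, b, c}" using l by (auto simp: labels_def)
  have "\<delta> < 0" if "(A t a, A t b, A t c, G t i, G t j, G t k) \<noteq> (B t a, B t b, B t c, H t i, H t j, H t k)"
    using length_monotone[OF strict_system_Delta[OF s t l] strict_system_Delta[OF s' t l] that]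
    unfolding side_len_def \<delta> by linarith
  moreover have "\<delta> = 0" if "(A t a, A t b, A t c, G t i, G t j, G t k) = (B t a, B t b, B t c, H t i, H t j, H t k)"
    using that unfolding \<delta> by simp
  ultimately show "\<delta> \<le> 0" "\<delta> = 0 \<Longrightarrow> (\<forall>e\<in>sides X t. B t e = A t e) \<and> (\<forall>i\<in>corners X t. H t i = G t i)"
    unfolding cs by force+
qed

lemma realizes_rad:
  assumes re: "realizes X l r t R (A t) (G t)" and t: "t \<in> triangles X" and i: "i \<in> corners X t"
  shows "r i = R * at_corner corner_rad X A G t i" "0 < R" "0 < r i"
proof -
  obtain j k a b c where L: "labels X t i j k a b c" using labels_exist_corner[OF surface t i] by metis
  show "r i = R * at_corner corner_rad X A G t i"
    unfolding at_corner_labels[where \<phi> = corner_rad, OF surface t L corner_rad_commute]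
    by (rule realizes_labels(3)[OF surface re L])
  show "0 < R" by (rule realizes_labels(1)[OF surface re L])
  show "0 < r i" by (rule realizes_triangle(3)[OF surface re t L])
qed

text \<open>Pair the difference of the gradients with the difference of the angles. The terms ln R
  drop out by the angle sums of the triangles, the terms ln r by the sums at the vertices, and the
  edge lengths, equal on both sides of an edge, by the sums at the edges. The total is 0 while each
  triangle contributes at most 0, so \<open>triangle_monotone\<close> applies with equality
  everywhere.\<close>

lemma realized_angles_unique:
  assumes s: "strict_system X \<theta> \<Xi> A G" and re: "\<And>t. t \<in> triangles X \<Longrightarrow> realizes X l r t (R t) (A t) (G t)"
    and s': "strict_system X \<theta> \<Xi> B H" and re': "\<And>t. t \<in> triangles X \<Longrightarrow> realizes X l' r' t (R' t) (B t) (H t)"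
    and t: "t \<in> triangles X"
  shows "(\<forall>e\<in>sides X t. B t e = A t e) \<and> (\<forall>i\<in>corners X t. H t i = G t i)"
proof -
  have eqs: "angle_eqs X \<theta> \<Xi> A G" "angle_eqs X \<theta> \<Xi> B H" using s s' by (auto simp: strict_system_def)
  note null = null_direction_diff[OF eqs]
  define P where "P = (\<lambda>t. \<Sum>i\<in>corners X t. (ln (at_corner corner_rad X B H t i) - ln (at_corner corner_rad X A G t i)) * (H t i - G t i))"
  define Q where "Q = (\<lambda>t. \<Sum>e\<in>sides X t. (edge_len X B H t e - edge_len X A G t e) * (B t e - A t e))"
  have "(\<Sum>t\<in>triangles X. Q t) = (\<Sum>e\<in>edges X. \<Sum>t\<in>adj_triangles X e. (edge_len X B H t e - edge_len X A G t e) * (B t e - A t e))"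
    unfolding Q_def by (rule sum_sides_swap[OF surface])
  also have "\<dots> = (\<Sum>e\<in>edges X. 0)"
  proof (rule sum.cong[OF refl])
    fix e assume e: "e \<in> edges X"
    obtain u where u: "u \<in> triangles X" "e \<in> sides X u" using adj_nonempty[OF e] .
    have mem: "u \<in> adj_triangles X e" using u by (simp add: adj_triangles_def)
    have "(\<Sum>t\<in>adj_triangles X e. (edge_len X B H t e - edge_len X A G t e) * (B t e - A t e))
      = (\<Sum>t\<in>adj_triangles X e. (edge_len X B H u e - edge_len X A G u e) * (B t e - A t e))"
      using realizes_edge_len[OF s re _ mem] realizes_edge_len[OF s' re' _ mem] by (intro sum.cong) auto
    also have "\<dots> = (edge_len X B H u e - edge_len X A G u e) * (\<Sum>t\<in>adj_triangles X e. B t e - A t e)"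
      by (simp add: sum_distrib_left)
    also have "\<dots> = 0" using null e by (simp add: null_direction_def)
    finally show "(\<Sum>t\<in>adj_triangles X e. (edge_len X B H t e - edge_len X A G t e) * (B t e - A t e)) = 0" .
  qed
  finally have Q0: "(\<Sum>t\<in>triangles X. Q t) = 0" by simp
  have "P t = (\<Sum>i\<in>corners X t. (ln (r' i) - ln (r i)) * (H t i - G t i))" if t: "t \<in> triangles X" for t
  proof -
    have ln: "ln (at_corner corner_rad X B H t i) - ln (at_corner corner_rad X A G t i)
      = (ln (r' i) - ln (r i)) - (ln (R' t) - ln (R t))" if i: "i \<in> corners X t" for i
    proof -
      have pos: "0 < at_corner corner_rad X A G t i" "0 < at_corner corner_rad X B H t i"
        using realizes_rad[where A = A and G = G, OF re[OF t] t i] realizes_rad[where A = B and G = H, OF re'[OF t] t i] by (simp_all add: zero_less_mult_iff)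
      show ?thesis
        using realizes_rad(1,2)[where A = A and G = G, OF re[OF t] t i] realizes_rad(1,2)[where A = B and G = H, OF re'[OF t] t i] pos by (simp add: ln_mult)
    qed
    have "P t = (\<Sum>i\<in>corners X t. (ln (r' i) - ln (r i)) * (H t i - G t i)
       - (ln (R' t) - ln (R t)) * (H t i - G t i))"
      unfolding P_def by (rule sum.cong[OF refl]) (simp only: ln left_diff_distrib)
    also have "\<dots> = (\<Sum>i\<in>corners X t. (ln (r' i) - ln (r i)) * (H t i - G t i))
       - (ln (R' t) - ln (R t)) * (\<Sum>i\<in>corners X t. H t i - G t i)"
      unfolding sum_distrib_left by (rule sum_subtractf)
    also have "(\<Sum>i\<in>corners X t. H t i - G t i) = 0" using null t by (simp add: null_direction_def)
    finally show ?thesis by simp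
  qed
  then have "(\<Sum>t\<in>triangles X. P t) = (\<Sum>t\<in>triangles X. \<Sum>i\<in>corners X t. (ln (r' i) - ln (r i)) * (H t i - G t i))"
    by simp
  also have "\<dots> = (\<Sum>i\<in>vertices X. \<Sum>t\<in>star X i. (ln (r' i) - ln (r i)) * (H t i - G t i))"
    by (rule sum_corners_swap[OF surface])
  also have "\<dots> = (\<Sum>i\<in>vertices X. (ln (r' i) - ln (r i)) * (\<Sum>t\<in>star X i. H t i - G t i))"
    by (simp add: sum_distrib_left)
  also have "\<dots> = 0" using null by (simp add: null_direction_def)
  finally have P0: "(\<Sum>t\<in>triangles X. P t) = 0" .
  have le: "P t - Q t \<le> 0" if "t \<in> triangles X" for t
    using triangle_monotone(1)[OF s s' that] by (simp add: P_def Q_def)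
  have "(\<Sum>t\<in>triangles X. - (P t - Q t)) = 0" using P0 Q0 by (simp add: sum_subtractf)
  then have "- (P t - Q t) = 0"
    using sum_nonneg_eq_0_iff[OF surface_finite(3)[OF surface], of "\<lambda>t. - (P t - Q t)"] le t by force
  then show ?thesis using triangle_monotone(2)[OF s s' t] by (simp add: P_def Q_def)
qed

text \<open>Equal angles make corresponding triangles similar with ratio R' t / R t, which is also
  the ratio of the radii at their corners. So this ratio is the same at both ends of every edge and
  constant on a component.\<close>

lemma pattern_unique:
  assumes p: "circle_pattern_with_angles X \<theta> \<Xi> l r" and p': "circle_pattern_with_angles X \<theta> \<Xi> l' r'"
    and C: "C \<in> surface_components X"
  shows "\<exists>s>0. (\<forall>i\<in>C. r' i = s * r i) \<and> (\<forall>e\<in>edges X. ends X e \<subseteq> C \<longrightarrow> l' e = s * l e)"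
proof -
  define A where "A = side_angle X l r"
  define G where "G = corner_angle X l"
  define B where "B = side_angle X l' r'"
  define H where "H = corner_angle X l'"
  have s: "strict_system X \<theta> \<Xi> A G" "strict_system X \<theta> \<Xi> B H"
    using pattern_strict[OF p] pattern_strict[OF p'] by (simp_all add: A_def G_def B_def H_def)
  have h: "hyperideal_circle_pattern X l r" "hyperideal_circle_pattern X l' r'"
    using p p' by (simp_all add: circle_pattern_with_angles_def)
  have "\<forall>t\<in>triangles X. \<exists>R. realizes X l r t R (A t) (G t)" "\<forall>t\<in>triangles X. \<exists>R. realizes X l' r' t R (B t) (H t)"
    using pattern_realizes[OF surface h(1)] pattern_realizes[OF surface h(2)]
    by (simp_all add: A_def G_def B_def H_def)
  then obtain R R' where re: "\<And>t. t \<in> triangles X \<Longrightarrow> realizes X l r t (R t) (A t) (G t)"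
    and re': "\<And>t. t \<in> triangles X \<Longrightarrow> realizes X l' r' t (R' t) (B t) (H t)"
    by metis
  have same: "(\<forall>e\<in>sides X t. B t e = A t e) \<and> (\<forall>i\<in>corners X t. H t i = G t i)" if "t \<in> triangles X" for t
    by (rule realized_angles_unique[OF s(1) re s(2) re' that])
  have scale: "l' a = (R' t / R t) * l a" "r' i = (R' t / R t) * r i" "r' j = (R' t / R t) * r j" "0 < R' t / R t" "0 < r i" "0 < r j"
    if t: "t \<in> triangles X" and L: "labels X t i j k a b c" for t i j k a b c
  proof -
    note L2 = labels_rotate[OF L]
    have eq: "B t a = A t a" "B t b = A t b" "B t c = A t c" "H t i = G t i" "H t j = G t j"
      using same[OF t] L by (auto simp: labels_def)
    note 1 = realizes_labels[OF surface re[OF t] L] and 2 = realizes_labels[OF surface re'[OF t] L]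
    note 3 = realizes_labels(3)[OF surface re[OF t] L2] and 4 = realizes_labels(3)[OF surface re'[OF t] L2]
    show "l' a = (R' t / R t) * l a" "r' i = (R' t / R t) * r i" "r' j = (R' t / R t) * r j" "0 < R' t / R t"
      using 1(1) 2(1) unfolding 1(3,4) 2(3,4) 3 4 eq by simp_all
    show "0 < r i" "0 < r j"
      using realizes_triangle(3)[OF surface re[OF t] t] L L2 by blast+
  qed
  obtain v where v: "v \<in> vertices X" "C = component_of X v" using C by (auto simp: surface_components_def)
  define s where "s = r' v / r v"
  have edge: "r' i / r i = r' j / r j" if ij: "(i, j) \<in> adjacent_vertices X" for i j
  proof -
    obtain e where e: "e \<in> edges X" "ends X e = {i, j}" using ij by (auto simp: adjacent_vertices_def)
    obtain t where t: "t \<in> triangles X" "e \<in> sides X t" using adj_nonempty[OF e(1)] .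
    obtain i' j' k b c where L: "labels X t i' j' k e b c" using labels_exist[OF surface t] by metis
    have "{i', j'} = {i, j}" using L e by (simp add: labels_def)
    then have "(i' = i \<and> j' = j) \<or> (i' = j \<and> j' = i)" by (auto simp: doubleton_eq_iff)
    moreover have "r' i' / r i' = r' j' / r j'" using scale(2-6)[OF t(1) L] by simp
    ultimately show ?thesis by auto
  qed
  have ratio: "r' i / r i = s" if "i \<in> C" for i
  proof -
    have "(v, i) \<in> (adjacent_vertices X)\<^sup>*" using that v by (simp add: component_of_def)
    then show ?thesis
    proof (induction rule: rtrancl_induct)
      case base
      then show ?case by (simp add: s_def)
    next
      case (step y z)
      then show ?case using edge by metis
    qed
  qed
  have pos: "0 < r i" "0 < r' i" if i: "i \<in> vertices X" for i
    using h i by (auto simp: hyperideal_circle_pattern_def)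
  have CV: "C \<subseteq> vertices X"
  proof
    fix i assume "i \<in> C"
    then have "(v, i) \<in> (adjacent_vertices X)\<^sup>*" using v by (simp add: component_of_def)
    then show "i \<in> vertices X"
    proof (induction rule: rtrancl_induct)
      case base
      then show ?case using v by simp
    next
      case (step y z)
      then obtain e where "e \<in> edges X" "ends X e = {y, z}" by (auto simp: adjacent_vertices_def)
      then show ?case using surface by (auto simp: surface_triangulation_def)
    qed
  qed
  have "0 < s" using pos[OF v(1)] by (simp add: s_def)
  moreover have "r' i = s * r i" if i: "i \<in> C" for i
  proof -
    have "0 < r i" using CV i pos by blast
    then show ?thesis using ratio[OF i] by (simp add: field_simps)
  qed
  moreover have "l' e = s * l e" if e: "e \<in> edges X" and sub: "ends X e \<subseteq> C" for e
  proof -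
    obtain t where t: "t \<in> triangles X" "e \<in> sides X t" using adj_nonempty[OF e] .
    obtain i j k b c where L: "labels X t i j k e b c" using labels_exist[OF surface t] by metis
    have "i \<in> C" using L sub by (auto simp: labels_def)
    then have "R' t / R t = s" using ratio[of i] scale(2,5)[OF t(1) L] by simp
    then show ?thesis using scale(1)[OF t(1) L] by simp
  qed
  ultimately show ?thesis by blast
qed

end

theorem theorem1:
  fixes X :: "('v, 'e, 't) cells" and \<theta> :: "'e \<Rightarrow> real" and \<Xi> :: "'v \<Rightarrow> real"
  assumes "surface_triangulation X"
    and "\<forall>e\<in>edges X. 0 \<le> \<theta> e \<and> \<theta> e < pi"
    and "\<forall>i\<in>vertices X. 0 < \<Xi> i"
  shows "((\<exists>l r. circle_pattern_with_angles X \<theta> \<Xi> l r) \<longleftrightarrow> coherent_angle_systems X \<theta> \<Xi> \<noteq> {}) \<and>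
    (\<forall>l r l' r'. circle_pattern_with_angles X \<theta> \<Xi> l r \<and> circle_pattern_with_angles X \<theta> \<Xi> l' r' \<longrightarrow>
       (\<forall>C\<in>surface_components X. \<exists>s>0. (\<forall>i\<in>C. r' i = s * r i) \<and>
          (\<forall>e\<in>edges X. ends X e \<subseteq> C \<longrightarrow> l' e = s * l e)))"
proof (intro conjI)
  show "(\<exists>l r. circle_pattern_with_angles X \<theta> \<Xi> l r) \<longleftrightarrow> coherent_angle_systems X \<theta> \<Xi> \<noteq> {}"
    unfolding coherent_iff_strict[OF assms(1)]
    using pattern_strict[OF assms(1)] pattern_exists[OF assms(1)] assms(2) by blast
  show "\<forall>l r l' r'. circle_pattern_with_angles X \<theta> \<Xi> l r \<and> circle_pattern_with_angles X \<theta> \<Xi> l' r' \<longrightarrow>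
       (\<forall>C\<in>surface_components X. \<exists>s>0. (\<forall>i\<in>C. r' i = s * r i) \<and>
          (\<forall>e\<in>edges X. ends X e \<subseteq> C \<longrightarrow> l' e = s * l e))"
    using pattern_unique[OF assms(1)] by blast
qed

end
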